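(* Let $\psi\in(0,\pi)$, $f\in L^2(\mathbb S^2)$ and $g=\mathcal A_\psi f\in L^2(\mathrm{SO}(3))$. Let $\hat g_n^{j,k}=\frac{2n+1}{8\pi^2}\int_{\mathrm{SO}(3)}g(Q)\,\overline{D_n^{j,k}(Q)}\,dQ$ for $n\in\mathbb N_0$, $j,k\in\{-n,\dots,n\}$. Then \[ f=\sum_{n=0}^\infty\sum_{k=-n}^n\frac{\sum_{j=-n}^n\widetilde P_n^j(0)\,s_j(\psi)\,\hat g_n^{j,k}}{\sum_{j=-n}^n\widetilde P_n^j(0)^2\,s_j(\psi)^2}\,Y_n^k, \] with convergence in $L^2(\mathbb S^2)$.
   Context: $\mathbb S^2$ is the unit sphere in $\mathbb R^3$ with spherical coordinates $\xi(\varphi,\vartheta)=(\cos\varphi\sin\vartheta,\sin\varphi\sin\vartheta,\cos\vartheta)^\top$. Associated Legendre functions $P_n^k(t)=\frac{(-1)^k}{2^n n!}(1-t^2)^{k/2}\frac{d^{n+k}}{dt^{n+k}}(t^2-1)^n$ ($k=0,\dots,n$), normalized $\widetilde P_n^k=\sqrt{\frac{2n+1}{4\pi}\frac{(n-k)!}{(n+k)!}}P_n^k$, $\widetilde P_n^{-k}=(-1)^k\widetilde P_n^k$. Spherical harmonics $Y_n^k(\xi(\varphi,\vartheta))=\widetilde P_n^k(\cos\vartheta)e^{ik\varphi}$. Rotations: $Q(\alpha,\beta,\gamma)=R_3(\alpha)R_2(\beta)R_3(\gamma)$ (zyz Euler angles; $R_3$, $R_2$ the rotations about the third and second coordinate axes)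 with measure $\int_{\mathrm{SO}(3)}g\,dQ=\int_0^{2\pi}\int_0^\pi\int_0^{2\pi}g(Q(\alpha,\beta,\gamma))\sin\beta\,d\alpha\,d\beta\,d\gamma$. Wigner D-functions $D_n^{k,j}(Q(\alpha,\beta,\gamma))=e^{-ik\alpha}d_n^{k,j}(\cos\beta)e^{-ij\gamma}$ with $d_n^{k,j}(t)=\frac{(-1)^{n-j}}{2^n}\sqrt{\frac{(n+k)!(1-t)^{j-k}}{(n-j)!(n+j)!(n-k)!(1+t)^{j+k}}}\left(\frac{d}{dt}\right)^{n-k}\left[(1+t)^{n+j}(1-t)^{n-j}\right]$. With $e_\varphi=(\cos\varphi,\sin\varphi,0)^\top$, the fixed-length arc transform is $\mathcal A_\psi f(Q)=\int_{-\psi}^{\psi}f(Q^{-1}e_\varphi)\,d\varphi$ for $f\in C(\mathbb S^2)$, extended to a bounded operator $L^2(\mathbb S^2)\to L^2(\mathrm{SO}(3))$. Let $s_0(\psi)=2\psi$ and $s_j(\psi)=\frac{2\sin(j\psi)}{j}$ for $j\ne0$. *)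

theory Defs
  imports "HOL-Analysis.Analysis"
begin

definition sph :: "real \<Rightarrow> real \<Rightarrow> real^3" where
  "sph \<phi> \<theta> = vector [cos \<phi> * sin \<theta>, sin \<phi> * sin \<theta>, cos \<theta>]"

text \<open>Surface measure of S2 pulled back to spherical coordinates (phi, theta).\<close>
definition S2_measure :: "(real \<times> real) measure" where
  "S2_measure = density lborel
     (\<lambda>p. indicator ({0..2*pi} \<times> {0..pi}) p * ennreal (sin (snd p)))"

definition R3 :: "real \<Rightarrow> real^3^3" where
  "R3 a = vector [vector [cos a, - sin a, 0], vector [sin a, cos a, 0], vector [0, 0, 1]]"

definition R2 :: "real \<Rightarrow> real^3^3" where
  "R2 b = vector [vector [cos b, 0, sin b], vector [0, 1, 0], vector [- sin b, 0, cos b]]"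

definition euler_rot :: "real \<Rightarrow> real \<Rightarrow> real \<Rightarrow> real^3^3" where
  "euler_rot a b c = R3 a ** R2 b ** R3 c"

text \<open>Measure dQ on SO(3) in Euler-angle coordinates (alpha, beta, gamma).\<close>
definition SO3_measure :: "(real \<times> real \<times> real) measure" where
  "SO3_measure = density lborel
     (\<lambda>(a, b, c). indicator ({0..2*pi} \<times> {0..pi} \<times> {0..2*pi}) (a, b, c) * ennreal (sin b))"

definition assoc_legendre :: "nat \<Rightarrow> nat \<Rightarrow> real \<Rightarrow> real" where
  "assoc_legendre n k t =
     (-1) ^ k / (2 ^ n * fact n) * sqrt (1 - t\<^sup>2) ^ k
       * (deriv ^^ (n + k)) (\<lambda>s. (s\<^sup>2 - 1) ^ n) t"

definition norm_legendre_pos :: "nat \<Rightarrow> nat \<Rightarrow> real \<Rightarrow> real" where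
  "norm_legendre_pos n k t =
     sqrt ((2 * real n + 1) / (4 * pi) * fact (n - k) / fact (n + k)) * assoc_legendre n k t"

definition norm_legendre :: "nat \<Rightarrow> int \<Rightarrow> real \<Rightarrow> real" where
  "norm_legendre n k t =
     (if k \<ge> 0 then norm_legendre_pos n (nat k) t
      else (-1) ^ nat (- k) * norm_legendre_pos n (nat (- k)) t)"

definition sph_harm :: "nat \<Rightarrow> int \<Rightarrow> real \<Rightarrow> real \<Rightarrow> complex" where
  "sph_harm n k \<phi> \<theta> = complex_of_real (norm_legendre n k (cos \<theta>)) * exp (\<i> * of_int k * of_real \<phi>)"

definition wigner_d :: "nat \<Rightarrow> int \<Rightarrow> int \<Rightarrow> real \<Rightarrow> real" where
  "wigner_d n k j t =
     (-1) ^ nat (int n - j) / 2 ^ n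
     * sqrt (fact (nat (int n + k)) * (1 - t) powr (real_of_int (j - k))
             / (fact (nat (int n - j)) * fact (nat (int n + j)) * fact (nat (int n - k))
                * (1 + t) powr (real_of_int (j + k))))
     * (deriv ^^ nat (int n - k)) (\<lambda>s. (1 + s) ^ nat (int n + j) * (1 - s) ^ nat (int n - j)) t"

definition wigner_D :: "nat \<Rightarrow> int \<Rightarrow> int \<Rightarrow> real \<times> real \<times> real \<Rightarrow> complex" where
  "wigner_D n k j = (\<lambda>(a, b, c).
     exp (- \<i> * of_int k * of_real a) * complex_of_real (wigner_d n k j (cos b))
     * exp (- \<i> * of_int j * of_real c))"

definition e_vec :: "real \<Rightarrow> real^3" where
  "e_vec \<phi> = vector [cos \<phi>, sin \<phi>, 0]"

text \<open>A_psi f (Q(alpha,beta,gamma)); for f in L2 the integral exists for a.e. Q and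
  agrees a.e. with the bounded extension of the transform from C(S2).\<close>
definition arc_transform :: "real \<Rightarrow> (real^3 \<Rightarrow> complex) \<Rightarrow> real \<times> real \<times> real \<Rightarrow> complex" where
  "arc_transform \<psi> f = (\<lambda>(a, b, c).
     LBINT \<phi>=-\<psi>..\<psi>. f (matrix_inv (euler_rot a b c) *v e_vec \<phi>))"

definition wigner_coeff :: "(real \<times> real \<times> real \<Rightarrow> complex) \<Rightarrow> nat \<Rightarrow> int \<Rightarrow> int \<Rightarrow> complex" where
  "wigner_coeff g n j k =
     of_real ((2 * real n + 1) / (8 * pi\<^sup>2)) * (LINT q|SO3_measure. g q * cnj (wigner_D n j k q))"

definition s_coef :: "real \<Rightarrow> int \<Rightarrow> real" where
  "s_coef \<psi> j = (if j = 0 then 2 * \<psi> else 2 * sin (real_of_int j * \<psi>) / real_of_int j)"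

end

theory Submission
  imports Defs "HOL-Computational_Algebra.Polynomial"
begin

text \<open>
  The polynomial \<open>(x\<^sub>1 - i x\<^sub>2) + 2 x\<^sub>3 w - (x\<^sub>1 + i x\<^sub>2) w\<^sup>2\<close> in \<open>w\<close> has as its \<open>n\<close>-th power a generating
  function of the spherical harmonics of degree \<open>n\<close> (Taylor expansion of \<open>(t\<^sup>2 - 1)\<^sup>n\<close>). A rotation of
  \<open>x\<close> acts on \<open>w\<close> by a Moebius transformation whose coefficients are the Wigner functions, whence
  \<open>Y n k (Q\<^sup>T x) = (\<Sum>j. D n j k Q * Y n j x)\<close>. As harmonics of positive degree have mean zero and
  polynomials are dense, the surface measure is rotation invariant, and the decomposition
  \<open>Q = S(\<xi>) R3(c)\<close> turns this into left invariance of the measure on SO(3).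
  Multiplied by the value of the Legendre function of order \<open>j\<close> at \<open>0\<close>, \<open>D n j k Q\<close> is a Fourier coefficient of
  \<open>d \<mapsto> Y n k (Q\<^sup>T e\<^sub>d)\<close>. Left invariance moves \<open>e\<^sub>0\<close> to the north pole, and averaging over the first
  Euler angle leaves only the zonal term. Thus the \<open>j\<close>-th summand of the numerator in the theorem is
  that of the denominator times the Fourier coefficient of \<open>f\<close>, and completeness of the harmonics concludes.
\<close>

section \<open>Spherical harmonics and Wigner functions from a generating polynomial\<close>

text \<open>The factor s_j records the arc. Its point at angle p is \<open>R3 p\<close> applied to
  the point at angle 0; left translation by \<open>R3 p\<close> therefore brings the argument of f
  back to angle 0 and multiplies the conjugated coefficient by e^(i j p), whose integral over
  [-\<psi>, \<psi>] is s_j. The other factor, the Legendre value at 0, is what makes left invariance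
  applicable: \<open>wigner_D\<close> is given by Euler angles, while its product with that value is
  a Fourier integral that makes sense for every matrix. The obstacle is the poles. The formula for
  \<open>wigner_d\<close> contains powers of 1 - t and 1 + t, and the angles and
  \<open>coset_rep\<close> degenerate there. Pointwise identities are therefore confined to polar
  angles strictly between 0 and \<pi>, and integrals see them almost everywhere. The harmonics are
  extended to the homogeneous polynomials \<open>solid_harm\<close>, since rotations act on vectors
  and not on angles. Left invariance is shown for \<open>R3 s\<close> and for
  \<open>R2 (- b)\<close> with 0 < b < \<pi>; together these move any point of the equator to the
  pole.\<close>

lemma higher_deriv_poly:
  fixes p :: "real poly"
  shows "(deriv ^^ i) (poly p) = poly ((pderiv ^^ i) p)"
  by (induction i) (auto intro!: ext DERIV_imp_deriv poly_DERIV)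

lemma higher_pderiv_pcompose_shift:
  fixes p :: "'a :: field_char_0 poly"
  shows "(pderiv ^^ i) (pcompose p [:t, 1:]) = pcompose ((pderiv ^^ i) p) [:t, 1:]"
  by (induction i) (simp_all add: pderiv_pcompose pderiv_pCons)

text \<open>This is Taylor's formula read for coefficients. It turns the Rodrigues formulas of both
  the Legendre and the Wigner functions into coefficients of explicit products of powers.\<close>

lemma poly_higher_pderiv_eq_coeff_shift:
  fixes p :: "'a :: field_char_0 poly"
  shows "poly ((pderiv ^^ i) p) t = fact i * coeff (pcompose p [:t, 1:]) i"
proof -
  have "poly ((pderiv ^^ i) p) t = coeff ((pderiv ^^ i) (pcompose p [:t, 1:])) 0"
    by (simp add: higher_pderiv_pcompose_shift poly_0_coeff_0[symmetric] poly_pcompose)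
  also have "\<dots> = fact i * coeff (pcompose p [:t, 1:]) i"
    by (simp add: coeff_higher_pderiv pochhammer_fact)
  finally show ?thesis .
qed

text \<open>The value at w is the bilinear product of \<open>x\<close> with (1 - w^2, - i (1 + w^2),
  2 w). This vector is isotropic, which is why the powers are harmonic in \<open>x\<close>.\<close>

definition harm_poly :: "real^3 \<Rightarrow> complex poly" where
  "harm_poly x = [:Complex (x$1) (- (x$2)), of_real (2 * x$3), - Complex (x$1) (x$2):]"

text \<open>The index \<open>n + k\<close> shifts the orders -n, ..., n to the exponents 0, ..., 2
  n, so that one formula serves both signs of \<open>k\<close>. A derivative is (n + k)! times a
  Taylor coefficient, and this factorial turns the usual root of (n - k)! / (n + k)! into the
  symmetric root of (n - k)! (n + k)!.\<close>

definition solid_harm :: "nat \<Rightarrow> int \<Rightarrow> real^3 \<Rightarrow> complex" where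
  "solid_harm n k x =
     of_real (sqrt ((2 * real n + 1) / (4 * pi)) * sqrt (fact (nat (int n - k)) * fact (nat (int n + k)))
              / (2 ^ n * fact n))
     * coeff (harm_poly x ^ n) (nat (int n + k))"

lemma sph_nth [simp]:
  "sph a b $ 1 = cos a * sin b" "sph a b $ 2 = sin a * sin b" "sph a b $ 3 = cos b"
  by (simp_all add: sph_def)

lemma coeff_map_poly_power:
  fixes h :: "'a :: comm_semiring_1 \<Rightarrow> 'b :: comm_semiring_1"
  assumes h: "h 0 = 0" "h 1 = 1" "\<And>x y. h (x + y) = h x + h y" "\<And>x y. h (x * y) = h x * h y"
  shows "coeff (map_poly h p ^ n) i = h (coeff (p ^ n) i)"
proof -
  have hsum: "h (sum f A) = (\<Sum>x\<in>A. h (f x))" if "finite A" for f :: "nat \<Rightarrow> 'a" and A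
    using that by induction (simp_all add: h)
  show ?thesis
    by (induction n arbitrary: i) (simp_all add: coeff_mult coeff_map_poly h hsum)
qed

lemma pcompose_power:
  fixes p :: "'a :: comm_semiring_1 poly"
  shows "pcompose (p ^ n) q = pcompose p q ^ n"
  by (induction n) (simp_all add: pcompose_mult pcompose_1)

text \<open>Recentred at cos b, the polynomial s^2 - 1 becomes - sin^2 b + 2 cos b w + w^2.
  Replacing w by \<open>z\<close> w with \<open>z\<close> = - sin b e^(i a) makes it
  \<open>z\<close> times \<open>harm_poly (sph a b)\<close>. Comparing coefficients of the n-th
  powers leaves \<open>z ^ k\<close>, which carries both the power of - sin b and the phase.\<close>

lemma coeff_harm_poly_pos:
  fixes a b :: real and n k :: nat
  assumes "sin b \<noteq> 0"
  shows "coeff (harm_poly (sph a b) ^ n) (n + k) =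
     of_real ((- sin b) ^ k / fact (n + k) * (deriv ^^ (n + k)) (\<lambda>s. (s\<^sup>2 - 1) ^ n) (cos b)) * cis (real k * a)"
proof -
  define z where "z = complex_of_real (- sin b) * cis a"
  have z0: "z \<noteq> 0" using assms by (simp add: z_def)
  define P where "P = [:-1, 0, 1 :: real:] ^ n"
  have P: "(\<lambda>s::real. (s\<^sup>2 - 1) ^ n) = poly P"
    by (auto simp: P_def poly_power power2_eq_square)
  have s2: "(cos b)\<^sup>2 - 1 = - (sin b)\<^sup>2"
    using sin_cos_squared_add[of b] by linarith
  have "pcompose P [:cos b, 1:] = [:- (sin b)\<^sup>2, 2 * cos b, 1:] ^ n"
    by (simp add: P_def pcompose_power pcompose_pCons flip: s2) (simp add: power2_eq_square)
  then have D: "(deriv ^^ i) (\<lambda>s. (s\<^sup>2 - 1) ^ n) (cos b) = fact i * coeff ([:- (sin b)\<^sup>2, 2 * cos b, 1:] ^ n) i" for i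
    by (simp only: P higher_deriv_poly poly_higher_pderiv_eq_coeff_shift)
  let ?r = "[:- (sin b)\<^sup>2, 2 * cos b, 1:]"
  let ?c = "[:- (of_real (sin b))\<^sup>2, 2 * of_real (cos b), 1 :: complex:]"
  have of_r: "of_real (coeff (?r ^ n) i) = coeff (?c ^ n) i" for i
    using coeff_map_poly_power[of "of_real :: real \<Rightarrow> complex" ?r n i] by (simp add: map_poly_pCons)
  have "pcompose ?c [:0, z:] = smult z (harm_poly (sph a b))"
    unfolding harm_poly_def z_def
    by (simp add: pcompose_pCons complex_eq_iff power2_eq_square algebra_simps)
       (use sin_cos_squared_add[of a] in algebra)
  then have "pcompose (?c ^ n) [:0, z:] = smult (z ^ n) (harm_poly (sph a b) ^ n)"
    by (simp add: pcompose_power smult_power)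
  then have "z ^ (n + k) * coeff (?c ^ n) (n + k) = z ^ n * coeff (harm_poly (sph a b) ^ n) (n + k)"
    by (metis coeff_pcompose_linear coeff_smult)
  then have "coeff (harm_poly (sph a b) ^ n) (n + k) = z ^ k * coeff (?c ^ n) (n + k)"
    using z0 by (simp add: power_add)
  also have "\<dots> = of_real ((- sin b) ^ k * coeff (?r ^ n) (n + k)) * cis (real k * a)"
    by (simp add: of_r[symmetric] z_def power_mult_distrib power_minus[of "_ * _"] power_minus[of "complex_of_real _"] Complex.DeMoivre)
  finally show ?thesis by (simp add: D)
qed

text \<open>The symmetry expresses that \<open>x\<close> is real: reversing the coefficients of
  \<open>harm_poly x\<close> amounts to conjugating them, replacing w by - w and changing the sign.
  Off the third axis the degree is exactly 2, so that \<open>reflect_poly\<close> reverses the n-th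
  power about 2 n.\<close>

lemma coeff_harm_poly_reflect:
  assumes "x $ 1 \<noteq> 0 \<or> x $ 2 \<noteq> 0" "k \<le> n"
  shows "coeff (harm_poly x ^ n) (n - k) = (-1) ^ k * cnj (coeff (harm_poly x ^ n) (n + k))"
proof -
  let ?q = "harm_poly x"
  have nz: "Complex (x $ 1) (x $ 2) \<noteq> 0" "Complex (x $ 1) (- (x $ 2)) \<noteq> 0"
    using assms by (auto simp: complex_eq_iff)
  then have deg: "degree ?q = 2"
    by (simp add: harm_poly_def)
  then have "degree (?q ^ n) = 2 * n"
    using degree_power_eq[of ?q n] by force
  then have "coeff (?q ^ n) (n - k) = coeff (reflect_poly (?q ^ n)) (n + k)"
    using assms(2) by (auto simp: coeff_reflect_poly mult_2)
  also have "reflect_poly ?q = smult (-1) (pcompose (map_poly cnj ?q) [:0, -1:])"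
    using nz unfolding harm_poly_def
    by (auto simp: reflect_poly_def map_poly_pCons pcompose_pCons cCons_def complex_eq_iff)
  then have "reflect_poly (?q ^ n) = smult ((-1) ^ n) (pcompose (map_poly cnj ?q ^ n) [:0, -1:])"
    by (simp only: reflect_poly_power pcompose_power smult_power)
  also have "coeff \<dots> (n + k) = (-1) ^ k * cnj (coeff (?q ^ n) (n + k))"
    by (simp add: coeff_pcompose_linear coeff_map_poly_power power_add)
  finally show ?thesis .
qed

text \<open>For nonnegative orders this is the Rodrigues formula read as a Taylor coefficient.
  Negative orders follow by conjugation up to sign: on the left by the convention for
  \<open>norm_legendre\<close>, on the right by the reflection symmetry.\<close>

lemma sph_harm_eq_solid_harm:
  assumes "0 < b" "b < pi" "\<bar>k\<bar> \<le> int n"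
  shows "sph_harm n k a b = solid_harm n k (sph a b)"
proof -
  have s: "sin b > 0" using assms sin_gt_zero by auto
  then have s': "sqrt (1 - (cos b)\<^sup>2) = sin b"
    using sin_cos_sqrt[of b] by simp
  have pos: "sph_harm n (int m) a b = solid_harm n (int m) (sph a b)" if "m \<le> n" for m
  proof -
    have [simp]: "nat (int n - int m) = n - m" "nat (int n + int m) = n + m"
      using that by auto
    define A where "A = sqrt ((2 * real n + 1) / (4 * pi))"
    define D where "D = (deriv ^^ (n + m)) (\<lambda>s. (s\<^sup>2 - 1) ^ n) (cos b)"
    have sq: "sqrt ((2 * real n + 1) / (4 * pi) * fact (n - m) / fact (n + m))
        = A * (sqrt (fact (n - m) * fact (n + m)) / fact (n + m))"
    proof -
      have "sqrt (x / y) = sqrt (x * y) / y" if "y > 0" for x y :: real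
        using that by (simp add: real_sqrt_divide real_sqrt_mult field_simps)
      from this[of "fact (n + m)" "fact (n - m)"] show ?thesis
        unfolding A_def by (metis fact_gt_zero real_sqrt_mult times_divide_eq_right)
    qed
    have e: "exp (\<i> * of_int (int m) * of_real a) = cis (real m * a)"
      by (simp add: cis_conv_exp mult_ac)
    have "norm_legendre n (int m) (cos b) =
        A * (sqrt (fact (n - m) * fact (n + m)) / fact (n + m)) * ((-1) ^ m / (2 ^ n * fact n) * sin b ^ m * D)"
      unfolding norm_legendre_def norm_legendre_pos_def assoc_legendre_def s' D_def nat_int sq by simp
    also have "\<dots> = A * sqrt (fact (n - m) * fact (n + m)) / (2 ^ n * fact n) * ((- sin b) ^ m / fact (n + m) * D)"
      unfolding power_minus[of "sin b"] by (simp add: field_simps)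
    finally show ?thesis
      using s unfolding sph_harm_def solid_harm_def e
      by (simp add: coeff_harm_poly_pos A_def D_def)
  qed
  show ?thesis
  proof (cases "k \<ge> 0")
    case True
    then show ?thesis using pos[of "nat k"] assms by auto
  next
    case False
    define m where "m = nat (- k)"
    have m: "k = - int m" "0 < m" "m \<le> n" using False assms by (auto simp: m_def)
    have ne: "sph a b $ 1 \<noteq> 0 \<or> sph a b $ 2 \<noteq> 0"
      using s sin_zero_abs_cos_one[of a] by auto
    have "sph_harm n k a b = (-1) ^ m * cnj (sph_harm n (int m) a b)"
      using m by (auto simp: sph_harm_def norm_legendre_def exp_cnj)
    also have "\<dots> = (-1) ^ m * cnj (solid_harm n (int m) (sph a b))"
      using pos m by simp
    also have "\<dots> = solid_harm n k (sph a b)"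
      using coeff_harm_poly_reflect[OF ne m(3)] m
      by (simp add: solid_harm_def nat_diff_distrib nat_add_distrib add.commute mult_ac)
    finally show ?thesis .
  qed
qed

text \<open>A matrix entry, in the monomial basis, of a plane rotation acting on binary forms of
  degree 2 n. The half angle reflects that rotations of space are covered twice by these
  substitutions.\<close>

definition rot_coeff :: "nat \<Rightarrow> int \<Rightarrow> int \<Rightarrow> real \<Rightarrow> real" where
  "rot_coeff n j k b =
     coeff ([:sin (b/2), cos (b/2):] ^ nat (int n + k) * [:cos (b/2), - sin (b/2):] ^ nat (int n - k))
       (nat (int n + j))"

text \<open>In half angles 1 + cos b = 2 c^2 and 1 - cos b = 2 s^2. The derivative in
  \<open>wigner_d\<close> is a Taylor coefficient at cos b of a product of powers of two linear
  factors; rescaling the variable and reversing the coefficients turn these factors into those of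
  \<open>rot_coeff\<close>.\<close>

lemma wigner_d_eq_rot_coeff:
  assumes b: "0 < b" "b < pi" and jk: "\<bar>j\<bar> \<le> int n" "\<bar>k\<bar> \<le> int n"
  shows "wigner_d n j k (cos b) =
    sqrt (fact (nat (int n + j)) * fact (nat (int n - j)) / (fact (nat (int n + k)) * fact (nat (int n - k))))
    * rot_coeff n j k b"
proof -
  define c s where "c = cos (b/2)" and "s = sin (b/2)"
  have c: "c > 0" unfolding c_def using b by (intro cos_gt_zero_pi) auto
  have s: "s > 0" unfolding s_def using b by (intro sin_gt_zero) auto
  define p m i l where "p = nat (int n + k)" and "m = nat (int n - k)"
    and "i = nat (int n - j)" and "l = nat (int n + j)"
  have pm: "p + m = 2 * n" "i + l = 2 * n" using jk by (auto simp: p_def m_def i_def l_def)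
  have t1: "1 + cos b = 2 * c\<^sup>2" using cos_double_cos[of "b/2"] by (simp add: c_def)
  have t2: "1 - cos b = 2 * s\<^sup>2" using cos_double_sin[of "b/2"] sin_cos_squared_add[of "b/2"]
    unfolding s_def by simp
  define R where "R = coeff ([:s, c:] ^ p * [:c, - s:] ^ m) l"
  have R: "rot_coeff n j k b = R" by (simp add: R_def rot_coeff_def p_def m_def l_def s_def c_def)
  have D: "(deriv ^^ i) (\<lambda>x. (1 + x) ^ p * (1 - x) ^ m) (cos b)
    = fact i * ((2 * c) ^ p * (2 * s) ^ m * (-1) ^ m / (2 * c * s) ^ i * R)"
  proof -
    let ?A = "[:2 * c\<^sup>2, 1:] ^ p * [:2 * s\<^sup>2, -1:] ^ m" and ?B = "[:c, s:] ^ p * [:s, - c:] ^ m"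
      and ?C = "[:s, c:] ^ p * [:- c, s:] ^ m"
    let ?P = "[:1, 1:] ^ p * [:1, -1 :: real:] ^ m"
    have "(\<lambda>x::real. (1 + x) ^ p * (1 - x) ^ m) = poly ?P"
      by (auto simp: poly_power)
    then have 1: "(deriv ^^ i) (\<lambda>x. (1 + x) ^ p * (1 - x) ^ m) (cos b) = fact i * coeff (pcompose ?P [:cos b, 1:]) i"
      by (simp only: higher_deriv_poly poly_higher_pderiv_eq_coeff_shift)
    have 2: "pcompose ?P [:cos b, 1:] = ?A"
      by (simp add: pcompose_mult pcompose_power pcompose_pCons t1 t2)
    \<comment> \<open>With the variable scaled by 2 c s the two factors become 2 c (c + s w) and 2 s
      (s - c w).\<close>
    have "(2 * c * s) ^ i * coeff ?A i
      = coeff (pcompose ?A [:0, 2 * c * s:]) i"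
      by (simp add: coeff_pcompose_linear)
    also have "pcompose ?A [:0, 2 * c * s:]
      = smult (2 * c) [:c, s:] ^ p * smult (2 * s) [:s, - c:] ^ m"
      by (simp add: pcompose_mult pcompose_power pcompose_pCons power2_eq_square mult_ac)
    also have "\<dots> = smult ((2 * c) ^ p * (2 * s) ^ m) ?B"
      by (simp only: smult_power mult_smult_left mult_smult_right smult_smult mult_ac)
    also have "coeff \<dots> i = (2 * c) ^ p * (2 * s) ^ m * coeff ?B i"
      by simp
    also have "coeff ?B i = (-1) ^ m * R"
    proof -
      \<comment> \<open>Reversal exchanges the coefficient index n - j of the Rodrigues formula for
        the index n + j of \<open>rot_coeff\<close>. It needs c and s nonzero, so that the product
        has full degree 2 n.\<close>
      have "[:c, s:] = reflect_poly [:s, c:]" "[:s, - c:] = reflect_poly [:- c, s:]"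
        using c s by (simp_all add: reflect_poly_def cCons_def)
      then have "?B = reflect_poly ?C"
        by (simp only: reflect_poly_power reflect_poly_mult)
      moreover have "degree ([:s, c:] ^ p) = p" "degree ([:- c, s:] ^ m) = m"
        using degree_power_eq[of "[:s, c:]" p] degree_power_eq[of "[:- c, s:]" m] c s by auto
      then have "degree ?C = 2 * n"
        using c s pm by (subst degree_mult_eq) auto
      ultimately have "coeff ?B i = coeff ?C l"
        using pm by (simp add: coeff_reflect_poly) (metis add_diff_cancel_left' le_add1 not_le pm(2))
      also have "[:- c, s:] = smult (-1) [:c, - s:]" by simp
      then have "?C = smult ((-1) ^ m) ([:s, c:] ^ p * [:c, - s:] ^ m)"
        by (simp only: smult_power mult_smult_right)
      also have "coeff \<dots> l = (-1) ^ m * R" by (simp add: R_def)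
      finally show ?thesis .
    qed
    finally have "coeff ?A i
      = (2 * c) ^ p * (2 * s) ^ m * (-1) ^ m / (2 * c * s) ^ i * R"
      using c s by (simp add: field_simps)
    then show ?thesis unfolding 1 2 by simp
  qed
  have e1: "(1 - cos b) powr (of_int (k - j)) = (2 * s\<^sup>2) ^ i / (2 * s\<^sup>2) ^ m"
  proof -
    have "(of_int (k - j) :: real) = real i - real m" using jk by (simp add: i_def m_def)
    then show ?thesis unfolding t2 using s by (simp add: powr_diff powr_realpow)
  qed
  have e2: "(1 + cos b) powr (of_int (k + j)) = (2 * c\<^sup>2) ^ p / (2 * c\<^sup>2) ^ i"
  proof -
    have "(of_int (k + j) :: real) = real p - real i" using jk by (simp add: i_def p_def)
    then show ?thesis unfolding t1 using c by (simp add: powr_diff powr_realpow)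
  qed
  have 22: "(2::real) ^ n * 2 ^ n = 2 ^ p * 2 ^ m" using pm by (simp flip: power_add mult_2)
  define F where "F = fact l / (fact i * fact p * fact m :: real)"
  have F: "F \<ge> 0" by (simp add: F_def)
  \<comment> \<open>Both sides are nonnegative, so the squares are compared; p + m = 2 n distributes
    the factor 4 ^ n over the two powers of 2.\<close>
  have sq: "sqrt (fact l * (1 - cos b) powr (of_int (k - j))
             / (fact m * fact p * fact i * (1 + cos b) powr (of_int (k + j))))
     = sqrt F * (2 ^ n * (2 * c * s) ^ i / ((2 * c) ^ p * (2 * s) ^ m))" (is "sqrt ?X = ?Y")
  proof (rule real_sqrt_unique)
    show "?Y \<ge> 0" using F c s by auto
    have "?Y\<^sup>2 = F * ((2 ^ n * 2 ^ n) * ((2 * c * s) ^ i)\<^sup>2 / (((2 * c) ^ p)\<^sup>2 * ((2 * s) ^ m)\<^sup>2))"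
      using F by (simp add: power_mult_distrib power_divide power2_eq_square[of "(2::real) ^ n"])
    also have "\<dots> = F * ((2 * s\<^sup>2) ^ i * (2 * c\<^sup>2) ^ i / ((2 * s\<^sup>2) ^ m * (2 * c\<^sup>2) ^ p))"
      using c s unfolding 22 by (simp add: power_mult_distrib power2_eq_square field_simps)
    also have "\<dots> = ?X"
      unfolding e1 e2 F_def using c s by (simp add: field_simps)
    finally show "?Y\<^sup>2 = ?X" .
  qed
  have fF: "fact i * sqrt F = sqrt (fact l * fact i / (fact p * fact m))"
  proof -
    have "fact l * fact i / (fact p * fact m) = (fact i)\<^sup>2 * F"
      by (simp add: F_def power2_eq_square field_simps)
    then show ?thesis by (simp add: real_sqrt_mult)
  qed
  have "wigner_d n j k (cos b) = (-1) ^ m / 2 ^ n * (sqrt F * (2 ^ n * (2 * c * s) ^ i / ((2 * c) ^ p * (2 * s) ^ m)))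
      * (fact i * ((2 * c) ^ p * (2 * s) ^ m * (-1) ^ m / (2 * c * s) ^ i * R))"
    unfolding wigner_d_def p_def[symmetric] m_def[symmetric] i_def[symmetric] l_def[symmetric] sq D by simp
  also have "\<dots> = (fact i * sqrt F) * R"
    using c s by (simp add: field_simps)
  finally show ?thesis
    using fF unfolding R p_def m_def i_def l_def by simp
qed

text \<open>Both sides are the coefficient of \<open>w ^ m\<close> \<open>x ^ i\<close> in \<open>(x (a + b w) + (c + d w)) ^ N\<close>.\<close>

lemma binomial_coeff_linear_transpose:
  fixes a b c d :: "'a :: field_char_0"
  assumes "i \<le> N" "m \<le> N"
  shows "of_nat (N choose i) * coeff ([:a, b:] ^ i * [:c, d:] ^ (N - i)) m
       = of_nat (N choose m) * coeff ([:d, b:] ^ m * [:c, a:] ^ (N - m)) i"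
proof -
  define L where "L = (\<Sum>i\<le>N. monom (of_nat (N choose i) * coeff ([:a, b:] ^ i * [:c, d:] ^ (N - i)) m) i)"
  define R where "R = smult (of_nat (N choose m)) ([:d, b:] ^ m * [:c, a:] ^ (N - m))"
  have "poly L x = poly R x" for x
  proof -
    have "poly L x = coeff (\<Sum>i\<le>N. of_nat (N choose i) * smult x [:a, b:] ^ i * [:c, d:] ^ (N - i)) m"
      unfolding L_def
      by (simp only: poly_sum poly_monom coeff_sum smult_power of_nat_mult_conv_smult mult_smult_left
          mult_smult_right coeff_smult mult_ac)
    also have "\<dots> = coeff ((smult x [:a, b:] + [:c, d:]) ^ N) m"
      by (subst binomial_ring) simp
    also have "smult x [:a, b:] + [:c, d:] = [:c + a * x, d + b * x:]"
      by (simp add: algebra_simps)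
    also have "coeff (\<dots> ^ N) m = poly R x"
      using assms by (simp add: coeff_linear_poly_power R_def poly_power mult_ac)
    finally show ?thesis .
  qed
  then have "L = R" by (simp add: poly_eq_poly_eq_iff[symmetric] ext)
  then have "coeff L i = coeff R i" by simp
  moreover have "coeff L i = of_nat (N choose i) * coeff ([:a, b:] ^ i * [:c, d:] ^ (N - i)) m"
    using assms by (simp add: L_def coeff_sum)
  ultimately show ?thesis by (simp add: R_def)
qed

section \<open>Moebius action of rotations on the generating polynomial\<close>

lemma poly_eq_sum_le:
  fixes p :: "'a :: comm_semiring_1 poly"
  assumes "degree p \<le> n"
  shows "poly p x = (\<Sum>i\<le>n. coeff p i * x ^ i)"
proof -
  have "poly p x = poly (\<Sum>i\<le>n. monom (coeff p i) i) x"
    by (simp only: poly_as_sum_of_monoms'[OF assms])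
  then show ?thesis by (simp add: poly_sum poly_monom)
qed

text \<open>Where V does not vanish, both sides are V^(2n) times p(U / V)^n: the left side clears
  denominators before taking the power, the right side after it.\<close>

lemma homogenize_power:
  fixes p U V :: "'a :: field_char_0 poly"
  assumes "degree p \<le> 2" "V \<noteq> 0"
  shows "(smult (coeff p 0) (V\<^sup>2) + smult (coeff p 1) (U * V) + smult (coeff p 2) (U\<^sup>2)) ^ n
       = (\<Sum>i\<le>2*n. smult (coeff (p ^ n) i) (U ^ i * V ^ (2 * n - i)))" (is "?L = ?R")
proof -
  \<comment> \<open>The extra factor \<open>V\<close> makes the equation trivial at the zeros of
    \<open>V\<close>, where U / V has no meaning; it is cancelled at the end.\<close>
  have "poly (V * ?L) w = poly (V * ?R) w" for w
  proof (cases "poly V w = 0")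
    case False
    define u v where "u = poly U w" and "v = poly V w"
    have v: "v \<noteq> 0" using False by (simp add: v_def)
    have p: "poly p x = coeff p 0 + coeff p 1 * x + coeff p 2 * x\<^sup>2" for x
    proof -
      have "poly p x = (\<Sum>i\<le>2. coeff p i * x ^ i)"
        using assms(1) by (intro poly_eq_sum_le)
      then show ?thesis by (simp add: numeral_2_eq_2)
    qed
    have "degree (p ^ n) \<le> 2 * n"
      using degree_power_le[of p n] assms(1) by (meson le_trans mult_le_mono1)
    have "coeff p 0 * v\<^sup>2 + coeff p 1 * (u * v) + coeff p 2 * u\<^sup>2 = v\<^sup>2 * poly p (u / v)"
      unfolding p using v by (simp add: power2_eq_square field_simps)
    then have "poly ?L w = (v\<^sup>2 * poly p (u / v)) ^ n"
      by (simp add: u_def v_def poly_power)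
    also have "\<dots> = v ^ (2 * n) * poly (p ^ n) (u / v)"
      by (simp add: power_mult_distrib power_mult poly_power)
    also have "poly (p ^ n) (u / v) = (\<Sum>i\<le>2*n. coeff (p ^ n) i * (u / v) ^ i)"
      using \<open>degree (p ^ n) \<le> 2 * n\<close> by (intro poly_eq_sum_le)
    also have "v ^ (2 * n) * \<dots> = (\<Sum>i\<le>2*n. coeff (p ^ n) i * (u ^ i * v ^ (2 * n - i)))"
      using v by (auto simp: sum_distrib_left power_divide power_diff field_simps intro!: sum.cong)
    also have "\<dots> = poly ?R w"
      by (simp add: poly_sum poly_power u_def v_def)
    finally show ?thesis by simp
  qed simp
  then have "V * ?L = V * ?R" by (intro iffD1[OF poly_eq_poly_eq_iff] ext)
  then show ?thesis using assms(2) by simp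
qed

lemma R2_mult_vec:
  "(R2 b *v x) $ 1 = cos b * x $ 1 + sin b * x $ 3" "(R2 b *v x) $ 2 = x $ 2"
  "(R2 b *v x) $ 3 = cos b * x $ 3 - sin b * x $ 1"
  by (simp_all add: R2_def matrix_vector_mult_def sum_3)

lemma R3_mult_vec:
  "(R3 a *v x) $ 1 = cos a * x $ 1 - sin a * x $ 2" "(R3 a *v x) $ 2 = sin a * x $ 1 + cos a * x $ 2"
  "(R3 a *v x) $ 3 = x $ 3"
  by (simp_all add: R3_def matrix_vector_mult_def sum_3)

text \<open>With c and s the cosine and sine of half the angle, the rotation acts on the variable by
  the Moebius map w |-> (c w - s) / (s w + c), and \<open>V\<close> squared clears its
  denominators.\<close>

lemma harm_poly_R2:
  fixes b :: real and x :: "real^3"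
  defines "U \<equiv> [:- of_real (sin (b/2)), of_real (cos (b/2)) :: complex:]"
    and "V \<equiv> [:of_real (cos (b/2)), of_real (sin (b/2)) :: complex:]"
  shows "harm_poly (R2 (-b) *v x) =
    smult (coeff (harm_poly x) 0) (V\<^sup>2) + smult (coeff (harm_poly x) 1) (U * V) + smult (coeff (harm_poly x) 2) (U\<^sup>2)"
proof -
  have c: "cos b = (cos (b/2))\<^sup>2 - (sin (b/2))\<^sup>2" using cos_double[of "b/2"] by simp
  have s: "sin b = 2 * sin (b/2) * cos (b/2)" using sin_double[of "b/2"] by simp
  show ?thesis
    unfolding harm_poly_def U_def V_def R2_mult_vec cos_minus sin_minus c s
    using sin_cos_squared_add[of "b/2"]
    by (simp add: power2_eq_square complex_eq_iff numeral_2_eq_2) algebra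
qed

text \<open>Expanding the Moebius substitution makes the summation index an exponent, whereas in
  \<open>rot_coeff\<close> it is the index of a coefficient. The transposition lemma exchanges the
  two roles at the price of a quotient of binomial coefficients, which equals
  \<open>g j / g k\<close>.\<close>

lemma solid_harm_R2:
  assumes b: "0 < b" "b < pi" and k: "\<bar>k\<bar> \<le> int n"
  shows "solid_harm n k (R2 (-b) *v x) = (\<Sum>j=-int n..int n. of_real (wigner_d n j k (cos b)) * solid_harm n j x)"
proof -
  define q where "q = harm_poly x"
  define c s where "c = cos (b/2)" and "s = sin (b/2)"
  define U V where "U = [:- of_real s, of_real c :: complex:]" and "V = [:of_real c, of_real s :: complex:]"
  define m where "m = nat (int n + k)"
  define K where "K = sqrt ((2 * real n + 1) / (4 * pi)) / (2 ^ n * fact n)"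
  define g where "g = (\<lambda>j. fact (nat (int n - j)) * fact (nat (int n + j)) :: real)"
  have gpos: "g j > 0" for j by (simp add: g_def)
  have solid: "solid_harm n j y = of_real (K * sqrt (g j)) * coeff (harm_poly y ^ n) (nat (int n + j))" for j y
    by (simp add: solid_harm_def K_def g_def)
  have m: "m \<le> 2 * n" "2 * n - m = nat (int n - k)" using k by (auto simp: m_def)
  have s0: "s > 0" unfolding s_def using b by (intro sin_gt_zero) auto
  then have "V \<noteq> 0" by (simp add: V_def)
  moreover have "degree q \<le> 2" by (simp add: q_def harm_poly_def)
  ultimately have "harm_poly (R2 (-b) *v x) ^ n = (\<Sum>i\<le>2*n. smult (coeff (q ^ n) i) (U ^ i * V ^ (2 * n - i)))"
    unfolding harm_poly_R2 q_def[symmetric] c_def[symmetric] s_def[symmetric]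
      U_def[symmetric] V_def[symmetric] by (intro homogenize_power)
  then have "coeff (harm_poly (R2 (-b) *v x) ^ n) m = (\<Sum>i\<le>2*n. coeff (q ^ n) i * coeff (U ^ i * V ^ (2 * n - i)) m)"
    by (simp add: coeff_sum)
  also have "\<dots> = (\<Sum>j=-int n..int n. coeff (q ^ n) (nat (int n + j)) * of_real (g j / g k * rot_coeff n j k b))"
  proof (rule sum.reindex_bij_witness[of _ "\<lambda>j. nat (int n + j)" "\<lambda>i. int i - int n"], goal_cases)
    case (5 i)
    then have i: "i \<le> 2 * n" by auto
    define h where "h = ([:s, c:] ^ m * [:c, - s:] ^ (2 * n - m))"
    have h: "coeff ([:of_real s, of_real c :: complex:] ^ m * [:of_real c, - of_real s:] ^ (2 * n - m)) i = of_real (coeff h i)"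
      using coeff_map_poly_power[of "of_real :: real \<Rightarrow> complex" "[:s, c:]" m]
        coeff_map_poly_power[of "of_real :: real \<Rightarrow> complex" "[:c, -s:]" "2 * n - m"]
      by (simp add: map_poly_pCons coeff_mult h_def)
    have "of_nat (2 * n choose i) * coeff (U ^ i * V ^ (2 * n - i)) m = of_nat (2 * n choose m) * of_real (coeff h i)"
      unfolding U_def V_def h[symmetric] by (rule binomial_coeff_linear_transpose) (use i m in auto)
    moreover have m': "of_nat (2 * n choose m) = complex_of_real (fact (2 * n) / g k)"
      using m(1) by (simp add: binomial_fact g_def m(2)[symmetric] m_def[symmetric] mult_ac)
    moreover have i': "of_nat (2 * n choose i) = complex_of_real (fact (2 * n) / g (int i - int n))"
    proof -
      have "nat (int n - (int i - int n)) = 2 * n - i" using i by auto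
      then show ?thesis using i by (simp add: binomial_fact g_def mult_ac)
    qed
    ultimately have "of_real (fact (2 * n) / g (int i - int n)) * coeff (U ^ i * V ^ (2 * n - i)) m
      = of_real (fact (2 * n) / g k * coeff h i)" by simp
    then have "coeff (U ^ i * V ^ (2 * n - i)) m = of_real (g (int i - int n) / g k * coeff h i)"
      using gpos[of k] gpos[of "int i - int n"] by (simp add: field_simps)
    moreover have "rot_coeff n (int i - int n) k b = coeff h i"
      unfolding rot_coeff_def h_def c_def s_def m_def[symmetric] m(2) by simp
    ultimately show ?case using i by simp
  qed auto
  finally have *: "coeff (harm_poly (R2 (-b) *v x) ^ n) m
    = (\<Sum>j=-int n..int n. coeff (q ^ n) (nat (int n + j)) * of_real (g j / g k * rot_coeff n j k b))" .
  \<comment> \<open>One root of the weight becomes the normalisation of \<open>wigner_d\<close>, the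
    other that of \<open>solid_harm n j\<close>.\<close>
  have gg: "sqrt (g k) * (g j / g k) = sqrt (g j / g k) * sqrt (g j)" for j
    using gpos[of j] gpos[of k] by (simp add: real_sqrt_divide field_simps)
  have "solid_harm n k (R2 (-b) *v x)
    = (\<Sum>j=-int n..int n. of_real (sqrt (g k) * (g j / g k)) * of_real (K * rot_coeff n j k b) * coeff (q ^ n) (nat (int n + j)))"
    unfolding solid m_def[symmetric] * by (simp add: sum_distrib_left mult_ac)
  also have "\<dots> = (\<Sum>j=-int n..int n. of_real (wigner_d n j k (cos b)) * solid_harm n j x)"
  proof (rule sum.cong)
    fix j assume "j \<in> {-int n..int n}"
    then have j: "\<bar>j\<bar> \<le> int n" by auto
    have w: "wigner_d n j k (cos b) = sqrt (g j / g k) * rot_coeff n j k b"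
      using wigner_d_eq_rot_coeff[OF b j k] by (simp add: g_def mult_ac)
    show "of_real (sqrt (g k) * (g j / g k)) * of_real (K * rot_coeff n j k b) * coeff (q ^ n) (nat (int n + j))
      = of_real (wigner_d n j k (cos b)) * solid_harm n j x"
      unfolding w gg solid q_def by simp
  qed auto
  finally show ?thesis .
qed

text \<open>A rotation about the third axis scales the variable by e^(i a) and contributes the
  factor e^(- i a). In the n-th power this factor removes the shift by n in the coefficient index,
  leaving the phase of order k.\<close>

lemma solid_harm_R3:
  assumes "\<bar>k\<bar> \<le> int n"
  shows "solid_harm n k (R3 a *v x) = exp (\<i> * of_int k * of_real a) * solid_harm n k x"
proof -
  have "harm_poly (R3 a *v x) = smult (cis (-a)) (pcompose (harm_poly x) [:0, cis a:])"
    unfolding harm_poly_def R3_mult_vec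
    by (simp add: pcompose_pCons complex_eq_iff)
       (intro conjI; use sin_cos_squared_add[of a] in algebra)
  then have "harm_poly (R3 a *v x) ^ n = smult (cis (-a) ^ n) (pcompose (harm_poly x ^ n) [:0, cis a:])"
    by (simp only: smult_power pcompose_power)
  then have "coeff (harm_poly (R3 a *v x) ^ n) (nat (int n + k))
    = cis (-a) ^ n * cis a ^ nat (int n + k) * coeff (harm_poly x ^ n) (nat (int n + k))"
    by (simp add: coeff_pcompose_linear)
  also have "cis (-a) ^ n * cis a ^ nat (int n + k) = exp (\<i> * of_int k * of_real a)"
  proof -
    have "real (nat (int n + k)) = real n + real_of_int k" using assms by simp
    then have "cis (-a) ^ n * cis a ^ nat (int n + k) = cis (real_of_int k * a)"
      by (simp only: Complex.DeMoivre cis_mult) (simp add: algebra_simps)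
    then show ?thesis by (simp add: cis_conv_exp mult_ac)
  qed
  finally show ?thesis by (simp add: solid_harm_def)
qed

section \<open>Orthonormality\<close>

definition circM :: "real measure" where
  "circM = density lborel (\<lambda>a. indicator {0..2*pi} a)"

definition polarM :: "real measure" where
  "polarM = density lborel (\<lambda>b. indicator {0..pi} b * ennreal (sin b))"

lemma sets_circM [measurable_cong, simp]: "sets circM = sets borel"
  and space_circM [simp]: "space circM = UNIV"
  and sets_polarM [measurable_cong, simp]: "sets polarM = sets borel"
  and space_polarM [simp]: "space polarM = UNIV"
  by (simp_all add: circM_def polarM_def)

interpretation circ: finite_measure circM
  by standard (simp add: circM_def emeasure_density)

interpretation polar: finite_measure polarM
proof
  have "emeasure polarM (space polarM) = (\<integral>\<^sup>+ b. indicator {0..pi} b * ennreal (sin b) \<partial>lborel)"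
    unfolding polarM_def by (simp add: emeasure_density)
  also have "\<dots> \<le> (\<integral>\<^sup>+ b. indicator {0..pi} b \<partial>lborel)"
    by (intro nn_integral_mono) (auto split: split_indicator simp: ennreal_le_1)
  also have "\<dots> < \<infinity>" by simp
  finally show "emeasure polarM (space polarM) \<noteq> \<infinity>" by simp
qed

interpretation circ_polar: pair_sigma_finite circM polarM ..
interpretation polar_circ: pair_sigma_finite polarM circM ..

lemma S2_measure_eq_pair: "S2_measure = circM \<Otimes>\<^sub>M polarM"
  unfolding circM_def polarM_def
  apply (subst pair_measure_density[OF _ _ lborel.sigma_finite_measure_axioms
      polar.sigma_finite_measure_axioms[unfolded polarM_def]])
    apply (measurable)
  unfolding S2_measure_def lborel_prod
  by (auto intro!: arg_cong[of _ _ "density lborel"] split: split_indicator)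

interpretation S2: finite_measure S2_measure
  unfolding S2_measure_eq_pair by (intro finite_measure_pair_measure) unfold_locales

lemma sets_S2_measure [measurable_cong, simp]: "sets S2_measure = sets (borel \<Otimes>\<^sub>M borel)"
  unfolding S2_measure_def borel_prod by simp

lemma space_S2_measure [simp]: "space S2_measure = UNIV"
  by (simp add: S2_measure_def)

lemma SO3_measure_eq_pair: "SO3_measure = circM \<Otimes>\<^sub>M (polarM \<Otimes>\<^sub>M circM)"
proof -
  have 1: "polarM \<Otimes>\<^sub>M circM = density lborel (\<lambda>(b, c). (indicator {0..pi} b * ennreal (sin b)) * indicator {0..2*pi} c)"
    unfolding circM_def polarM_def
    apply (subst pair_measure_density[OF _ _ lborel.sigma_finite_measure_axioms
        circ.sigma_finite_measure_axioms[unfolded circM_def]])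
      apply (measurable)
    by (simp only: lborel_prod)
  have 2: "sigma_finite_measure (polarM \<Otimes>\<^sub>M circM)" ..
  have 3: "(\<lambda>(b, c). (indicator {0..pi} b * ennreal (sin b)) * indicator {0..2*pi} c) \<in> borel_measurable (lborel :: (real \<times> real) measure)"
    unfolding lborel_prod[symmetric] by measurable
  show ?thesis
    using 2 unfolding 1 unfolding circM_def
    apply (subst pair_measure_density[OF _ 3 lborel.sigma_finite_measure_axioms])
      apply simp
     apply assumption
    unfolding SO3_measure_def lborel_prod
    by (auto intro!: arg_cong[of _ _ "density lborel"] split: split_indicator)
qed

interpretation SO3: finite_measure SO3_measure
  unfolding SO3_measure_eq_pair by (intro finite_measure_pair_measure) unfold_locales

lemma sets_SO3_measure [measurable_cong, simp]: "sets SO3_measure = sets (borel \<Otimes>\<^sub>M borel \<Otimes>\<^sub>M borel)"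
  unfolding SO3_measure_def borel_prod by simp

lemma space_SO3_measure [simp]: "space SO3_measure = UNIV"
  by (simp add: SO3_measure_def)

lemma integral_circM:
  fixes f F :: "real \<Rightarrow> 'a :: euclidean_space"
  assumes "continuous_on UNIV f" "\<And>x. (F has_vector_derivative f x) (at x)"
  shows "(LINT a|circM. f a) = F (2 * pi) - F 0"
proof -
  have [measurable]: "f \<in> borel_measurable borel"
    using assms(1) by (rule borel_measurable_continuous_onI)
  have *: "circM = density lborel (\<lambda>a. ennreal (indicator {0..2*pi} a))"
    by (simp add: circM_def ennreal_indicator)
  have "(LINT a|circM. f a) = (LINT a:{0..2*pi}|lborel. f a)"
    unfolding set_lebesgue_integral_def * by (rule integral_density; simp)
  also have "\<dots> = F (2 * pi) - F 0"
    unfolding set_lebesgue_integral_def using assms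
    by (intro integral_FTC_atLeastAtMost) (auto intro: has_vector_derivative_at_within continuous_on_subset)
  finally show ?thesis .
qed

abbreviation (input) circ_exp :: "int \<Rightarrow> real \<Rightarrow> complex" where
  "circ_exp k a \<equiv> exp (\<i> * of_int k * of_real a)"

abbreviation (input) circ_exp_cnj :: "int \<Rightarrow> real \<Rightarrow> complex" where
  "circ_exp_cnj k a \<equiv> exp (- (\<i> * of_int k * of_real a))"

lemma has_vector_derivative_circ_exp:
  assumes "k \<noteq> 0"
  shows "((\<lambda>x. circ_exp k x / (\<i> * of_int k)) has_vector_derivative circ_exp k x) (at x within S)"
proof -
  have "((\<lambda>z. exp (\<i> * of_int k * z) / (\<i> * of_int k)) has_field_derivative circ_exp k x) (at (of_real x))"
    using assms by (auto intro!: derivative_eq_intros)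
  from has_vector_derivative_real_field[OF this] show ?thesis
    unfolding o_def by (rule has_vector_derivative_at_within)
qed

lemma integral_circ_exp:
  "(LINT a|circM. circ_exp k a) = (if k = 0 then 2 * pi else 0)"
proof (cases "k = 0")
  case True
  have "(of_real has_vector_derivative (1 :: complex)) (at x)" for x
    by (auto intro!: derivative_eq_intros)
  then have "(LINT a|circM. (1 :: complex)) = of_real (2 * pi) - of_real 0"
    by (intro integral_circM) auto
  with True show ?thesis by simp
next
  case False
  define F where "F x = circ_exp k x / (\<i> * of_int k)" for x :: real
  have "(LINT a|circM. circ_exp k a) = F (2 * pi) - F 0"
    unfolding F_def
    by (intro integral_circM has_vector_derivative_circ_exp[OF False]) (auto intro!: continuous_intros)
  also have "F (2 * pi) = F 0"
    using exp_integer_2pi[of "of_int k"] by (simp add: F_def mult_ac)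
  finally show ?thesis using False by simp
qed

text \<open>Integration by parts below needs no substitution, as \<open>- p (cos b)\<close> is an antiderivative
  of \<open>p' (cos b) * sin b\<close>.\<close>

definition legendre_int :: "real poly \<Rightarrow> real" where
  "legendre_int p = (LINT b|polarM. poly p (cos b))"

lemma integral_polarM:
  fixes f :: "real \<Rightarrow> 'a :: {banach, second_countable_topology}"
  assumes [measurable]: "f \<in> borel_measurable borel"
  shows "(LINT b|polarM. f b) = (LINT b:{0..pi}|lborel. sin b *\<^sub>R f b)"
proof -
  have *: "polarM = density lborel (\<lambda>b. ennreal (indicator {0..pi} b * sin b))"
    by (auto simp: polarM_def intro!: arg_cong[of _ _ "density lborel"] split: split_indicator)
  have "AE b in lborel. 0 \<le> indicator {0..pi} b * sin b"
    by (auto intro!: AE_I2 sin_ge_zero split: split_indicator)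
  then have "(LINT b|polarM. f b) = (LINT b|lborel. (indicator {0..pi} b * sin b) *\<^sub>R f b)"
    unfolding * by (intro integral_density) auto
  then show ?thesis by (simp add: set_lebesgue_integral_def)
qed

lemma borel_measurable_poly [measurable (raw)]:
  fixes p :: "real poly"
  shows "f \<in> borel_measurable M \<Longrightarrow> (\<lambda>x. poly p (f x)) \<in> borel_measurable M"
  by (induction p) auto

lemma integrable_polar_poly: "integrable polarM (\<lambda>b. poly p (cos b))"
proof -
  have "bounded (poly p ` {-1..1})"
    by (intro compact_imp_bounded compact_continuous_image continuous_intros) auto
  then obtain B where "\<forall>x\<in>{-1..1}. norm (poly p x) \<le> B"
    unfolding bounded_iff by auto
  then show ?thesis
    by (intro polar.integrable_const_bound[where B = B]) auto
qed

lemma legendre_int_add: "legendre_int (p + q) = legendre_int p + legendre_int q"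
  by (simp add: legendre_int_def integrable_polar_poly)

lemma legendre_int_smult: "legendre_int (smult c p) = c * legendre_int p"
  by (simp add: legendre_int_def)

lemma legendre_int_pderiv: "legendre_int (pderiv p) = poly p 1 - poly p (-1)"
proof -
  have "legendre_int (pderiv p) = (LINT b:{0..pi}|lborel. sin b * poly (pderiv p) (cos b))"
    unfolding legendre_int_def by (subst integral_polarM) auto
  also have "\<dots> = - poly p (cos pi) - (- poly p (cos 0))"
    unfolding set_lebesgue_integral_def
    by (intro integral_FTC_atLeastAtMost)
      (auto intro!: derivative_eq_intros continuous_intros simp flip: has_real_derivative_iff_has_vector_derivative)
  finally show ?thesis by simp
qed

text \<open>The hypothesis lists the boundary terms: the i-th step differentiates \<open>u\<close> i
  times and leaves \<open>v\<close> with N - Suc i derivatives.\<close>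

lemma legendre_int_by_parts:
  assumes "\<And>i t. i < N \<Longrightarrow> t \<in> {-1, 1} \<Longrightarrow> poly ((pderiv ^^ i) u) t * poly ((pderiv ^^ (N - Suc i)) v) t = 0"
  shows "legendre_int (u * (pderiv ^^ N) v) = (-1) ^ N * legendre_int ((pderiv ^^ N) u * v)"
  using assms
proof (induction N arbitrary: u)
  case (Suc N)
  have "pderiv (u * (pderiv ^^ N) v) = u * (pderiv ^^ Suc N) v + pderiv u * (pderiv ^^ N) v"
    by (simp add: pderiv_mult algebra_simps)
  then have "legendre_int (u * (pderiv ^^ Suc N) v) + legendre_int (pderiv u * (pderiv ^^ N) v)
    = poly (u * (pderiv ^^ N) v) 1 - poly (u * (pderiv ^^ N) v) (-1)"
    by (simp only: legendre_int_add[symmetric] legendre_int_pderiv[symmetric])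
  also have "\<dots> = 0" using Suc.prems[of 0 1] Suc.prems[of 0 "-1"] by auto
  finally have "legendre_int (u * (pderiv ^^ Suc N) v) = - legendre_int (pderiv u * (pderiv ^^ N) v)"
    by simp
  also have "legendre_int (pderiv u * (pderiv ^^ N) v) = (-1) ^ N * legendre_int ((pderiv ^^ N) (pderiv u) * v)"
  proof (rule Suc.IH)
    fix i t assume "i < N" "t \<in> {-1, 1 :: real}"
    then show "poly ((pderiv ^^ i) (pderiv u)) t * poly ((pderiv ^^ (N - Suc i)) v) t = 0"
      using Suc.prems[of "Suc i" t] by (simp add: funpow_Suc_right del: funpow.simps)
  qed
  finally show ?case by (simp add: funpow_swap1)
qed simp

section \<open>Orthogonality of Legendre functions and of spherical harmonics\<close>

lemma poly_higher_pderiv_eq_0: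
  fixes p :: "'a :: field_char_0 poly"
  assumes "[:- a, 1:] ^ n dvd p" "i < n"
  shows "poly ((pderiv ^^ i) p) a = 0"
proof -
  obtain r where p: "p = [:- a, 1:] ^ n * r" using assms by (elim dvdE)
  have "pcompose p [:a, 1:] = monom 1 n * pcompose r [:a, 1:]"
    unfolding p by (simp add: pcompose_mult pcompose_power pcompose_pCons monom_altdef)
  then show ?thesis
    using assms(2) by (simp add: poly_higher_pderiv_eq_coeff_shift coeff_monom_mult)
qed

abbreviation (input) legendre_base :: "real poly" where
  "legendre_base \<equiv> [:-1, 0, 1:]"

definition legendre_deriv :: "nat \<Rightarrow> nat \<Rightarrow> real poly" where
  "legendre_deriv n k = (pderiv ^^ (n + k)) (legendre_base ^ n)"

text \<open>The polynomial t (t^2 - 1)^(n+1) vanishes at both endpoints, so its derivative has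
  integral 0. Writing t^2 as (t^2 - 1) + 1 in this derivative gives (2 n + 3) I(n+1) = - (2 n + 2)
  I(n) for the integrals I(n) in question.\<close>

lemma legendre_int_base: "legendre_int (legendre_base ^ n) = (-1) ^ n * 2 ^ (2 * n + 1) * (fact n)\<^sup>2 / fact (2 * n + 1)"
proof (induction n)
  case 0
  then show ?case using legendre_int_pderiv[of "[:0, 1:]"] by (simp add: pderiv_pCons one_pCons)
next
  case (Suc n)
  define W X :: "real poly" where "W = legendre_base" and "X = [:0, 1:]"
  have W: "pderiv W = smult 2 X" "pderiv X = 1" "X * X = W + 1"
    by (simp_all add: W_def X_def pderiv_pCons one_pCons)
  have "pderiv (X * W ^ Suc n) = smult (2 * (n + 1)) (X * X * W ^ n) + W ^ Suc n"
    by (simp add: pderiv_mult pderiv_power_Suc W(1,2) mult_ac del: power_Suc)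
  also have "\<dots> = smult (2 * n + 3) (W ^ Suc n) + smult (2 * (n + 1)) (W ^ n)"
    unfolding W(3) by (rule poly_eqI) (simp add: algebra_simps)
  finally have "(2 * n + 3) * legendre_int (W ^ Suc n) + (2 * (n + 1)) * legendre_int (W ^ n)
    = legendre_int (pderiv (X * W ^ Suc n))"
    by (simp only: legendre_int_add legendre_int_smult)
  also have "\<dots> = 0" by (simp add: legendre_int_pderiv W_def)
  finally have "(2 * n + 3) * legendre_int (W ^ Suc n) = - ((2 * (n + 1)) * legendre_int (W ^ n))"
    by (simp only: eq_neg_iff_add_eq_0)
  then have "legendre_int (W ^ Suc n) = - (2 * (n + 1)) / (2 * n + 3) * legendre_int (W ^ n)"
    by (simp add: field_simps)
  also have "\<dots> = (-1) ^ Suc n * 2 ^ (2 * Suc n + 1) * (fact (Suc n))\<^sup>2 / fact (2 * Suc n + 1)"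
  proof -
    define a b G where "a = real n + 1" and "b = 2 * real n + 3" and "G = (fact (2 * n + 1) :: real)"
    have nz: "a > 0" "b > 0" "G > 0" by (simp_all add: a_def b_def G_def del: fact_Suc)
    have f: "fact (2 * Suc n + 1) = b * (2 * a) * G" "fact (Suc n) = a * (fact n :: real)"
      by (simp_all add: a_def b_def G_def algebra_simps)
    have p: "(2::real) ^ (2 * Suc n + 1) = 4 * 2 ^ (2 * n + 1)" "(-1 :: real) ^ Suc n = -1 * (-1) ^ n" by simp_all
    have "- (2 * (n + 1)) / (2 * n + 3) * legendre_int (W ^ n)
      = - (2 * a) / b * ((-1) ^ n * 2 ^ (2 * n + 1) * (fact n)\<^sup>2 / G)"
      unfolding W_def Suc.IH by (simp add: a_def b_def G_def add.commute)
    also have "\<dots> = (-1 * (-1) ^ n) * (4 * 2 ^ (2 * n + 1)) * (a * fact n)\<^sup>2 / (b * (2 * a) * G)"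
      using nz by (simp add: field_simps power2_eq_square)
    finally show ?thesis unfolding f p .
  qed
  finally show ?case unfolding W_def .
qed

lemma degree_legendre_deriv: "degree (legendre_deriv n k) = n - k"
proof -
  have "degree (legendre_base ^ n) = 2 * n"
    using degree_power_eq[of legendre_base n] by simp
  then show ?thesis by (simp add: legendre_deriv_def degree_higher_pderiv)
qed

lemma coeff_legendre_deriv:
  assumes "k \<le> n"
  shows "coeff (legendre_deriv n k) (n - k) = fact (2 * n) / fact (n - k)"
proof -
  have d: "degree (legendre_base ^ n) = 2 * n"
    using degree_power_eq[of legendre_base n] by simp
  have "coeff (legendre_base ^ n) (2 * n) = 1"
    using lead_coeff_power[of legendre_base n] unfolding d by simp
  moreover have idx: "n - k + (n + k) = 2 * n" using assms by simp
  moreover have "fact (n - k) * pochhammer (real (Suc (n - k))) (n + k) = fact (2 * n)"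
    using pochhammer_product'[of "1::real" "n - k" "n + k"] assms
    by (simp add: pochhammer_fact[symmetric] add.commute mult_2)
  ultimately show ?thesis
    unfolding legendre_deriv_def coeff_higher_pderiv idx by (simp add: field_simps)
qed

text \<open>All n + k derivatives are moved onto u = (1 - t^2)^k times the Legendre derivative of
  degree index m. Since u has degree m + k, nothing remains for m < n, and for m = n only the
  leading coefficient remains, times the integral of (t^2 - 1)^n.\<close>

lemma legendre_orthogonal_aux:
  assumes "m \<le> n" "k \<le> m"
  shows "legendre_int ([:1, 0, -1:] ^ k * legendre_deriv m k * legendre_deriv n k) =
    (if m = n then fact (n + k) / fact (n - k) * 2 ^ (2 * n + 1) * (fact n)\<^sup>2 / (2 * real n + 1) else 0)"
proof -
  let ?W = "legendre_base"
  define u where "u = [:1, 0, -1:] ^ k * legendre_deriv m k"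
  have "[:- t, 1:] dvd ?W" "[:- t, 1:] dvd [:1, 0, -1:]" if "t \<in> {-1, 1}" for t
    using that by (auto simp: poly_eq_0_iff_dvd[symmetric])
  then have "[:- t, 1:] ^ n dvd ?W ^ n" "[:- t, 1:] ^ k dvd u" if "t \<in> {-1, 1}" for t
    using that unfolding u_def by (auto intro!: dvd_power_same dvd_mult2)
  \<comment> \<open>For i < k the zero of order k of \<open>u\<close> at the endpoint counts; for
    larger i fewer than n derivatives fall on \<open>?W ^ n\<close>, which has a zero of order
    n.\<close>
  then have z: "poly ((pderiv ^^ i) u) t * poly ((pderiv ^^ (n + k - Suc i)) (?W ^ n)) t = 0"
    if "i < n + k" "t \<in> {-1, 1}" for i t
    using that poly_higher_pderiv_eq_0[of t k u i] poly_higher_pderiv_eq_0[of t n "?W ^ n" "n + k - Suc i"]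
    by (cases "i < k") auto
  have "legendre_int (u * legendre_deriv n k) = (-1) ^ (n + k) * legendre_int ((pderiv ^^ (n + k)) u * ?W ^ n)"
    unfolding legendre_deriv_def by (rule legendre_int_by_parts) (rule z)
  moreover have du: "degree u = m + k"
  proof -
    have "degree ([:1, 0, -1 :: real:] ^ k) = 2 * k"
      using degree_power_eq[of "[:1, 0, -1 :: real:]" k] by simp
    moreover have "legendre_deriv m k \<noteq> 0"
      using coeff_legendre_deriv[OF assms(2)] by auto
    ultimately show ?thesis
      using assms unfolding u_def by (subst degree_mult_eq) (auto simp: degree_legendre_deriv)
  qed
  moreover have dd: "(pderiv ^^ (n + k)) u = (if m = n then [:fact (n + k) * lead_coeff u:] else 0)"
  proof (rule poly_eqI)
    fix i
    show "coeff ((pderiv ^^ (n + k)) u) i = coeff (if m = n then [:fact (n + k) * lead_coeff u:] else 0) i"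
      using assms du
      by (cases i) (auto simp: coeff_higher_pderiv pochhammer_fact coeff_eq_0)
  qed
  moreover have lc: "lead_coeff u = (-1) ^ k * (fact (2 * m) / fact (m - k))"
  proof -
    have "lead_coeff ([:1, 0, -1 :: real:] ^ k) = (-1) ^ k"
      by (simp only: lead_coeff_power) simp
    moreover have "lead_coeff (legendre_deriv m k) = fact (2 * m) / fact (m - k)"
      unfolding degree_legendre_deriv by (rule coeff_legendre_deriv[OF assms(2)])
    ultimately show ?thesis
      unfolding u_def by (simp only: lead_coeff_mult)
  qed
  ultimately have *: "legendre_int (u * legendre_deriv n k) =
    (-1) ^ (n + k) * legendre_int ((if m = n then [:fact (n + k) * lead_coeff u:] else 0) * ?W ^ n)"
    by (simp only:)
  show ?thesis
  proof (cases "m = n")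
    case True
    have eq: "(if m = n then [:fact (n + k) * lead_coeff u:] else 0) * ?W ^ n =
        smult (fact (n + k) * ((-1) ^ k * (fact (2 * n) / fact (n - k)))) (?W ^ n)"
      unfolding lc using True by simp
    have base: "legendre_int (?W ^ n) = (-1) ^ n * (2 ^ (2 * n + 1) * (fact n)\<^sup>2 / ((2 * real n + 1) * fact (2 * n)))"
      by (simp add: legendre_int_base algebra_simps)
    have "legendre_int (u * legendre_deriv n k) = ((-1) ^ (n + k) * (-1) ^ k * (-1) ^ n) *
      (fact (n + k) * (fact (2 * n) / fact (n - k)) * (2 ^ (2 * n + 1) * (fact n)\<^sup>2 / ((2 * real n + 1) * fact (2 * n))))"
      unfolding * eq legendre_int_smult base by (simp only: mult_ac)
    also have "(-1) ^ (n + k) * (-1) ^ k * (-1) ^ n = (1 :: real)"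
      by (simp add: power_add mult_ac flip: power_mult_distrib)
    also have "1 * (fact (n + k) * (fact (2 * n) / fact (n - k)) * (2 ^ (2 * n + 1) * (fact n)\<^sup>2 / ((2 * real n + 1) * fact (2 * n))))
      = fact (n + k) / fact (n - k) * 2 ^ (2 * n + 1) * (fact n)\<^sup>2 / (2 * real n + 1)"
    proof -
      have gen: "g \<noteq> 0 \<Longrightarrow> 1 * (a * (g / h) * (x * x' / (y * g))) = a / h * x * x' / y" for a g h x x' y :: real
        by simp
      show ?thesis by (rule gen) simp
    qed
    finally show ?thesis using True by (simp only: u_def True refl if_True)
  qed (use * in \<open>simp add: u_def legendre_int_def[of 0]\<close>)
qed

lemma legendre_orthogonal:
  assumes "k \<le> n" "k \<le> m"
  shows "legendre_int ([:1, 0, -1:] ^ k * legendre_deriv n k * legendre_deriv m k) =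
    (if n = m then fact (n + k) / fact (n - k) * 2 ^ (2 * n + 1) * (fact n)\<^sup>2 / (2 * real n + 1) else 0)"
  using legendre_orthogonal_aux[of m n k] legendre_orthogonal_aux[of n m k] assms
  by (cases "n \<le> m") (auto simp: mult_ac)

lemma borel_measurable_cnj [measurable (raw)]:
  "f \<in> borel_measurable M \<Longrightarrow> (\<lambda>x. cnj (f x)) \<in> borel_measurable M"
  by (rule borel_measurable_continuous_on[OF continuous_on_cnj[OF continuous_on_id]])

lemma norm_legendre_eq:
  assumes "\<bar>k\<bar> \<le> int n"
  defines "m \<equiv> nat \<bar>k\<bar>"
  shows "norm_legendre n k t =
    (if k < 0 then (-1) ^ m else 1) * ((-1) ^ m / (2 ^ n * fact n)) * sqrt ((2 * real n + 1) / (4 * pi) * fact (n - m) / fact (n + m))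
    * sqrt (1 - t\<^sup>2) ^ m * poly (legendre_deriv n m) t"
proof -
  have "(\<lambda>s::real. (s\<^sup>2 - 1) ^ n) = poly (legendre_base ^ n)"
    by (auto simp: poly_power power2_eq_square)
  then have "(deriv ^^ (n + m)) (\<lambda>s. (s\<^sup>2 - 1) ^ n) t = poly (legendre_deriv n m) t"
    by (simp only: higher_deriv_poly legendre_deriv_def)
  moreover have "nat k = m" if "k \<ge> 0" using that by (simp add: m_def)
  moreover have "nat (- k) = m" if "k < 0" using that by (simp add: m_def)
  ultimately show ?thesis
    by (auto simp: norm_legendre_def norm_legendre_pos_def assoc_legendre_def)
qed

text \<open>The polar integral is normalised to 1 / (2 \<pi>) because the longitude contributes the
  remaining 2 \<pi>.\<close>

lemma integral_norm_legendre:
  assumes "\<bar>k\<bar> \<le> int n" "\<bar>k\<bar> \<le> int m"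
  shows "(LINT b|polarM. norm_legendre n k (cos b) * norm_legendre m k (cos b)) = (if n = m then 1 / (2 * pi) else 0)"
proof -
  define l where "l = nat \<bar>k\<bar>"
  define c where "c n = ((-1) ^ l / (2 ^ n * fact n)) * sqrt ((2 * real n + 1) / (4 * pi) * fact (n - l) / fact (n + l))" for n
  have l: "l \<le> n" "l \<le> m" using assms by (auto simp: l_def)
  have "norm_legendre n k (cos b) * norm_legendre m k (cos b) =
      c n * c m * poly ([:1, 0, -1:] ^ l * legendre_deriv n l * legendre_deriv m l) (cos b)" for b
  proof -
    have "sqrt (1 - (cos b)\<^sup>2) ^ l * sqrt (1 - (cos b)\<^sup>2) ^ l = (1 - (cos b)\<^sup>2) ^ l"
      by (simp add: abs_square_le_1 flip: power_mult_distrib)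
    moreover have "poly ([:1, 0, -1:] ^ l) (cos b) = (1 - (cos b)\<^sup>2) ^ l"
      by (simp add: poly_power power2_eq_square)
    moreover have "(if k < 0 then (-1) ^ l else 1) * (if k < 0 then (-1) ^ l else 1) = (1 :: real)"
      by simp
    moreover have "e * e = 1 \<Longrightarrow> s * s = w \<Longrightarrow>
        e * x * y * s * p * (e * x' * y' * s * p') = x * y * (x' * y') * (w * p * p')" for e x y s p x' y' p' w :: real
      by algebra
    ultimately show ?thesis
      unfolding norm_legendre_eq[OF assms(1)] norm_legendre_eq[OF assms(2)] l_def[symmetric] c_def
      by (simp only: poly_mult)
  qed
  then have "(LINT b|polarM. norm_legendre n k (cos b) * norm_legendre m k (cos b)) =
    c n * c m * legendre_int ([:1, 0, -1:] ^ l * legendre_deriv n l * legendre_deriv m l)"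
    by (simp add: legendre_int_def)
  also have "\<dots> = (if n = m then 1 / (2 * pi) else 0)"
  proof (cases "n = m")
    case True
    have "(c n)\<^sup>2 = (1 / (2 ^ n * fact n))\<^sup>2 * ((2 * real n + 1) / (4 * pi) * fact (n - l) / fact (n + l))"
      unfolding c_def by (simp add: power_mult_distrib power_divide flip: power_mult)
    moreover have gen: "y \<noteq> 0 \<Longrightarrow> A \<noteq> 0 \<Longrightarrow> B \<noteq> 0 \<Longrightarrow> F \<noteq> 0 \<Longrightarrow> P \<noteq> 0 \<Longrightarrow>
        (1 / (P * F))\<^sup>2 * (y / (4 * pi) * A / B) * (B / A * (2 * P\<^sup>2) * F\<^sup>2 / y) = 1 / (2 * pi)" for y A B F P
      by (simp add: field_simps power2_eq_square)
    moreover have "(2 :: real) ^ (2 * n + 1) = 2 * (2 ^ n)\<^sup>2"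
      by (simp add: power_mult[symmetric] mult.commute)
    ultimately have "(c n)\<^sup>2 * (fact (n + l) / fact (n - l) * 2 ^ (2 * n + 1) * (fact n)\<^sup>2 / (2 * real n + 1)) = 1 / (2 * pi)"
      by (simp only:) (rule gen; simp)
    then show ?thesis using True legendre_orthogonal[OF l] by (simp add: power2_eq_square)
  qed (simp add: legendre_orthogonal[OF l])
  finally show ?thesis .
qed

lemma continuous_norm_legendre:
  assumes "\<bar>k\<bar> \<le> int n"
  shows "continuous_on UNIV (norm_legendre n k)"
  unfolding norm_legendre_eq[OF assms, abs_def] by (intro continuous_intros)

lemma continuous_sph_harm:
  assumes "\<bar>k\<bar> \<le> int n"
  shows "continuous_on UNIV (\<lambda>p. sph_harm n k (fst p) (snd p))"
  unfolding sph_harm_def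
  by (intro continuous_intros continuous_on_compose2[OF continuous_norm_legendre[OF assms]]) auto

lemma measurable_sph_harm:
  assumes "\<bar>k\<bar> \<le> int n"
  shows "(\<lambda>p. sph_harm n k (fst p) (snd p)) \<in> borel_measurable S2_measure"
  using borel_measurable_continuous_onI[OF continuous_sph_harm[OF assms]]
  by (simp add: S2_measure_def)

lemma sph_harm_bounded:
  assumes "\<bar>k\<bar> \<le> int n"
  obtains B where "\<And>a b. norm (sph_harm n k a b) \<le> B"
proof -
  have "bounded (norm_legendre n k ` {-1..1})"
    using continuous_on_subset[OF continuous_norm_legendre[OF assms]]
    by (intro compact_imp_bounded compact_continuous_image) auto
  then obtain B where B: "\<forall>x\<in>{-1..1}. norm (norm_legendre n k x) \<le> B"
    unfolding bounded_iff by auto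
  have "norm (sph_harm n k a b) \<le> B" for a b
  proof -
    have "norm (circ_exp k a) = 1"
      using norm_exp_i_times[of "of_int k * a"] by (simp add: mult_ac)
    then show ?thesis using B by (simp add: sph_harm_def norm_mult)
  qed
  then show thesis by (rule that)
qed

lemma sph_harm_orthonormal:
  assumes k: "\<bar>k\<bar> \<le> int n" and l: "\<bar>l\<bar> \<le> int m"
  shows "(LINT p|S2_measure. sph_harm n k (fst p) (snd p) * cnj (sph_harm m l (fst p) (snd p)))
    = (if n = m \<and> k = l then 1 else 0)" (is "?I = _")
proof -
  define F where "F p = sph_harm n k (fst p) (snd p) * cnj (sph_harm m l (fst p) (snd p))" for p
  obtain B1 where B1: "\<And>a b. norm (sph_harm n k a b) \<le> B1" using sph_harm_bounded[OF k] by blast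
  obtain B2 where B2: "\<And>a b. norm (sph_harm m l a b) \<le> B2" using sph_harm_bounded[OF l] by blast
  note [measurable] = measurable_sph_harm[OF k] measurable_sph_harm[OF l]
  have "norm (F p) \<le> B1 * B2" for p
    unfolding F_def norm_mult using B1 B2 order_trans[OF norm_ge_zero B1] by (auto intro!: mult_mono)
  moreover have "F \<in> borel_measurable S2_measure"
    unfolding F_def by measurable
  ultimately have "integrable S2_measure F"
    by (intro S2.integrable_const_bound[where B = "B1 * B2"]) auto
  then have "?I = (LINT a|circM. LINT b|polarM. F (a, b))"
    unfolding F_def[symmetric] S2_measure_eq_pair by (rule circ_polar.integral_fst'[symmetric])
  also have "\<dots> = (LINT a|circM. circ_exp (k - l) a *
      of_real (LINT b|polarM. norm_legendre n k (cos b) * norm_legendre m l (cos b)))"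
  proof (intro Bochner_Integration.integral_cong refl)
    fix a
    have "circ_exp k a * cnj (circ_exp l a) = circ_exp (k - l) a"
      by (simp add: exp_cnj exp_add[symmetric] algebra_simps)
    then have "F (a, b) = circ_exp (k - l) a * of_real (norm_legendre n k (cos b) * norm_legendre m l (cos b))" for b
      by (simp add: F_def sph_harm_def mult_ac)
    then show "(LINT b|polarM. F (a, b)) = circ_exp (k - l) a *
      of_real (LINT b|polarM. norm_legendre n k (cos b) * norm_legendre m l (cos b))"
      by (simp only: integral_mult_right_zero integral_complex_of_real)
  qed
  also have "\<dots> = (LINT a|circM. circ_exp (k - l) a) *
      of_real (LINT b|polarM. norm_legendre n k (cos b) * norm_legendre m l (cos b))"
    by simp
  \<comment> \<open>The longitude integral vanishes for k different from l, so the Legendre integral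
    enters with equal orders only.\<close>
  also have "\<dots> = (if n = m \<and> k = l then 1 else 0)"
    unfolding integral_circ_exp using integral_norm_legendre[OF k, of m] l by auto
  finally show ?thesis .
qed

section \<open>Completeness\<close>

abbreviation (input) harm_sum :: "nat \<Rightarrow> (nat \<Rightarrow> int \<Rightarrow> complex) \<Rightarrow> real \<Rightarrow> real \<Rightarrow> complex" where
  "harm_sum N c a b \<equiv> \<Sum>n<N. \<Sum>k=-int n..int n. c n k * sph_harm n k a b"

text \<open>Equality is asked away from the poles, where sin b is positive and harmonics in angles
  agree with \<open>solid_harm\<close>; the poles are a null set.\<close>

definition in_harm_span :: "(real \<Rightarrow> real \<Rightarrow> complex) \<Rightarrow> bool" where
  "in_harm_span G \<longleftrightarrow> (\<exists>N c. \<forall>a b. 0 < b \<longrightarrow> b < pi \<longrightarrow>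
     G a b = harm_sum N c a b)"

lemma in_harm_span_cong:
  assumes "in_harm_span G" "\<And>a b. 0 < b \<Longrightarrow> b < pi \<Longrightarrow> G a b = H a b"
  shows "in_harm_span H"
proof -
  obtain N c where "\<And>a b. 0 < b \<Longrightarrow> b < pi \<Longrightarrow> G a b = harm_sum N c a b"
    using assms(1) unfolding in_harm_span_def by blast
  then have "H a b = harm_sum N c a b" if "0 < b" "b < pi" for a b
    using assms(2)[OF that] that by simp
  then show ?thesis unfolding in_harm_span_def by blast
qed

lemma in_harm_span_sph_harm:
  assumes "\<bar>k\<bar> \<le> int n"
  shows "in_harm_span (sph_harm n k)"
  unfolding in_harm_span_def
proof (intro exI allI impI)
  fix a b
  have "(\<Sum>n'<Suc n. \<Sum>k'=-int n'..int n'. (if n' = n \<and> k' = k then 1 else 0) * sph_harm n' k' a b)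
    = (\<Sum>n'<Suc n. if n' = n then sph_harm n k a b else 0)"
  proof (intro sum.cong refl)
    fix n'
    show "(\<Sum>k'=-int n'..int n'. (if n' = n \<and> k' = k then 1 else 0) * sph_harm n' k' a b) = (if n' = n then sph_harm n k a b else 0)"
      using assms by (cases "n' = n") (auto simp: if_distrib[of "\<lambda>x. x * _"] sum.delta cong: if_cong)
  qed
  then show "sph_harm n k a b = (\<Sum>n'<Suc n. \<Sum>k'=-int n'..int n'. (if n' = n \<and> k' = k then 1 else 0) * sph_harm n' k' a b)"
    by simp
qed

lemma in_harm_span_add:
  assumes "in_harm_span G" "in_harm_span H"
  shows "in_harm_span (\<lambda>a b. G a b + H a b)"
proof -
  obtain N c where G: "\<And>a b. 0 < b \<Longrightarrow> b < pi \<Longrightarrow> G a b = harm_sum N c a b"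
    using assms(1) unfolding in_harm_span_def by blast
  obtain M d where H: "\<And>a b. 0 < b \<Longrightarrow> b < pi \<Longrightarrow> H a b = harm_sum M d a b"
    using assms(2) unfolding in_harm_span_def by blast
  define L where "L = max N M"
  define c' where "c' n k = (if n < N then c n k else 0)" for n k
  define d' where "d' n k = (if n < M then d n k else 0)" for n k
  have "harm_sum N c a b = harm_sum L c' a b" for a b
    by (intro sum.mono_neutral_cong_left) (auto simp: L_def c'_def)
  moreover have "harm_sum M d a b = harm_sum L d' a b" for a b
    by (intro sum.mono_neutral_cong_left) (auto simp: L_def d'_def)
  ultimately have "G a b + H a b = (\<Sum>n<L. \<Sum>k=-int n..int n. (c' n k + d' n k) * sph_harm n k a b)"
    if "0 < b" "b < pi" for a b
    using G[OF that] H[OF that] by (simp add: sum.distrib algebra_simps)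
  then show ?thesis
    unfolding in_harm_span_def by (intro exI[of _ L] exI[of _ "\<lambda>n k. c' n k + d' n k"]) auto
qed

lemma in_harm_span_scale:
  assumes "in_harm_span G"
  shows "in_harm_span (\<lambda>a b. z * G a b)"
proof -
  obtain N c where G: "\<And>a b. 0 < b \<Longrightarrow> b < pi \<Longrightarrow> G a b = harm_sum N c a b"
    using assms(1) unfolding in_harm_span_def by blast
  have "z * G a b = (\<Sum>n<N. \<Sum>k=-int n..int n. (z * c n k) * sph_harm n k a b)" if "0 < b" "b < pi" for a b
    using G[OF that] by (simp add: sum_distrib_left mult.assoc)
  then show ?thesis
    unfolding in_harm_span_def by (intro exI[of _ N] exI[of _ "\<lambda>n k. z * c n k"]) auto
qed

lemma in_harm_span_sum:
  assumes "finite A" "\<And>i. i \<in> A \<Longrightarrow> in_harm_span (G i)"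
  shows "in_harm_span (\<lambda>a b. \<Sum>i\<in>A. G i a b)"
  using assms
proof (induction A)
  case empty
  have "in_harm_span (\<lambda>a b. 0 * sph_harm 0 0 a b)"
    by (intro in_harm_span_scale in_harm_span_sph_harm) simp
  then show ?case by simp
qed (simp add: in_harm_span_add)

text \<open>Multiplying by a coordinate function visibly preserves sums of such terms, while for
  harmonics themselves it would require recurrence relations. That both families span the same
  functions lets the argument switch between them.\<close>

definition harm_form :: "int \<Rightarrow> real poly \<Rightarrow> real \<Rightarrow> real \<Rightarrow> complex" where
  "harm_form k p a b = of_real (sin b ^ nat \<bar>k\<bar> * poly p (cos b)) * circ_exp k a"

lemma sph_harm_eq_harm_form:
  assumes "\<bar>k\<bar> \<le> int n"
  obtains C where "C \<noteq> 0"
    "\<And>a b. 0 < b \<Longrightarrow> b < pi \<Longrightarrow> sph_harm n k a b = of_real C * harm_form k (legendre_deriv n (nat \<bar>k\<bar>)) a b"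
proof -
  define m where "m = nat \<bar>k\<bar>"
  define C where "C = (if k < 0 then (-1) ^ m else 1) * ((-1) ^ m / (2 ^ n * fact n)) *
    sqrt ((2 * real n + 1) / (4 * pi) * fact (n - m) / fact (n + m))"
  have "(2 * real n + 1) / (4 * pi) * fact (n - m) / fact (n + m) > 0" by simp
  then have "C \<noteq> 0" unfolding C_def by (simp only: mult_eq_0_iff real_sqrt_eq_0_iff) auto
  moreover have "sph_harm n k a b = of_real C * harm_form k (legendre_deriv n (nat \<bar>k\<bar>)) a b" if "0 < b" "b < pi" for a b
  proof -
    have "sqrt (1 - (cos b)\<^sup>2) = sin b"
      by (rule sin_cos_sqrt[OF less_imp_le[OF sin_gt_zero[OF that]], symmetric])
    then show ?thesis
      unfolding sph_harm_def norm_legendre_eq[OF assms] harm_form_def m_def[symmetric] C_def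
      by simp
  qed
  ultimately show thesis by (rule that)
qed

lemma harm_form_add: "harm_form k (p + q) a b = harm_form k p a b + harm_form k q a b"
  by (simp add: harm_form_def algebra_simps)

lemma harm_form_smult: "harm_form k (smult c p) a b = of_real c * harm_form k p a b"
  by (simp add: harm_form_def)

text \<open>The harmonic of degree |k| + d and order k is a nonzero multiple of the form whose
  polynomial is a Legendre derivative of degree exactly d. Subtracting a multiple of it removes the
  leading term of \<open>p\<close>, and induction on the degree applies.\<close>

lemma in_harm_span_harm_form: "in_harm_span (harm_form k p)"
proof (induction "degree p" arbitrary: p rule: less_induct)
  case less
  define m where "m = nat \<bar>k\<bar>"
  define d where "d = degree p"
  define L where "L = legendre_deriv (m + d) m"
  have deg: "degree L = d" by (simp add: L_def degree_legendre_deriv)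
  have lc: "coeff L d > 0"
    using coeff_legendre_deriv[of m "m + d"] by (simp add: L_def)
  define c where "c = coeff p d / coeff L d"
  define r where "r = p - smult c L"
  have pr: "p = r + smult c L" by (simp add: r_def)
  have "\<bar>k\<bar> \<le> int (m + d)" by (simp add: m_def)
  then obtain C where C: "C \<noteq> 0" "\<And>a b. 0 < b \<Longrightarrow> b < pi \<Longrightarrow> sph_harm (m + d) k a b = of_real C * harm_form k L a b"
    unfolding L_def using sph_harm_eq_harm_form m_def by metis
  have L: "in_harm_span (harm_form k L)"
  proof (rule in_harm_span_cong)
    show "in_harm_span (\<lambda>a b. of_real (1 / C) * sph_harm (m + d) k a b)"
      using \<open>\<bar>k\<bar> \<le> int (m + d)\<close> by (intro in_harm_span_scale in_harm_span_sph_harm)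
  qed (use C in auto)
  have "in_harm_span (harm_form k r)"
  proof (cases "d = 0")
    case True
    \<comment> \<open>A constant leaves no smaller degree to descend to, but here the subtraction
      removes everything.\<close>
    then have "r = 0" using deg lc unfolding r_def c_def d_def
      by (auto elim!: degree_eq_zeroE)
    then have "0 * harm_form k L a b = harm_form k r a b" for a b
      by (simp add: harm_form_def)
    then show ?thesis using in_harm_span_cong[OF in_harm_span_scale[OF L, of 0]] by blast
  next
    case False
    have "coeff r i = 0" if "i \<ge> d" for i
      using that lc deg by (cases "i = d") (auto simp: r_def c_def d_def coeff_eq_0)
    then have "degree r < d"
      using False by (intro degree_lessI) auto
    then show ?thesis using less by (simp add: d_def)
  qed
  then have "in_harm_span (\<lambda>a b. harm_form k r a b + of_real c * harm_form k L a b)"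
    by (intro in_harm_span_add in_harm_span_scale L)
  also have "(\<lambda>a b. harm_form k r a b + of_real c * harm_form k L a b) = harm_form k p"
    unfolding harm_form_add[symmetric] harm_form_smult[symmetric] pr[symmetric] ..
  finally show ?case .
qed

lemma in_harm_span_induct_form:
  assumes "in_harm_span G" "\<And>k p. in_harm_span (\<lambda>a b. F a b * harm_form k p a b)"
  shows "in_harm_span (\<lambda>a b. F a b * G a b)"
proof -
  obtain N c where G: "\<And>a b. 0 < b \<Longrightarrow> b < pi \<Longrightarrow> G a b = harm_sum N c a b"
    using assms(1) unfolding in_harm_span_def by blast
  show ?thesis
  proof (rule in_harm_span_cong)
    show "in_harm_span (\<lambda>a b. \<Sum>n<N. \<Sum>k=-int n..int n. c n k * (F a b * sph_harm n k a b))"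
    proof (intro in_harm_span_sum in_harm_span_scale)
      fix n k assume "k \<in> {-int n..int n}"
      then have "\<bar>k\<bar> \<le> int n" by auto
      then obtain C where C: "C \<noteq> 0" "\<And>a b. 0 < b \<Longrightarrow> b < pi \<Longrightarrow>
          sph_harm n k a b = of_real C * harm_form k (legendre_deriv n (nat \<bar>k\<bar>)) a b"
        using sph_harm_eq_harm_form by metis
      show "in_harm_span (\<lambda>a b. F a b * sph_harm n k a b)"
        by (rule in_harm_span_cong[OF in_harm_span_scale[OF assms(2)[of k "legendre_deriv n (nat \<bar>k\<bar>)"], of "of_real C"]])
           (simp add: C)
    qed auto
  qed (simp add: G sum_distrib_left mult_ac)
qed

lemma in_harm_span_mult_z:
  assumes "in_harm_span G"
  shows "in_harm_span (\<lambda>a b. of_real (cos b) * G a b)"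
proof (rule in_harm_span_induct_form[OF assms])
  fix k :: int and p :: "real poly"
  show "in_harm_span (\<lambda>a b. of_real (cos b) * harm_form k p a b)"
    by (rule in_harm_span_cong[OF in_harm_span_harm_form[of k "[:0, 1:] * p"]])
      (simp only: harm_form_def poly_mult of_real_mult, simp)
qed

text \<open>The multiplier is x1 + i x2 or x1 - i x2 and shifts the order by \<open>s\<close>. If
  the absolute value of the order grows, the additional sine is just what the new form requires; if
  it drops, the surplus sin^2 b is rewritten as 1 - cos^2 b and joins the polynomial.\<close>

lemma in_harm_span_mult_u:
  assumes "in_harm_span G" "s \<in> {-1, 1}"
  shows "in_harm_span (\<lambda>a b. of_real (sin b) * circ_exp s a * G a b)"
proof (rule in_harm_span_induct_form[OF assms(1)])
  fix k :: int and p :: "real poly"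
  define q where "q = (if s * k \<ge> 0 then p else [:1, 0, -1:] * p)"
  show "in_harm_span (\<lambda>a b. of_real (sin b) * circ_exp s a * harm_form k p a b)"
  proof (rule in_harm_span_cong[OF in_harm_span_harm_form[of "k + s" q]])
    fix a b :: real
    have "\<i> * of_int (k + s) * of_real a = \<i> * of_int s * of_real a + \<i> * of_int k * of_real a"
      by (simp add: algebra_simps)
    then have e: "circ_exp (k + s) a = circ_exp s a * circ_exp k a"
      by (simp only: exp_add)
    have eq: "sin b ^ nat \<bar>k + s\<bar> * poly q (cos b) = sin b * (sin b ^ nat \<bar>k\<bar> * poly p (cos b))"
    proof (cases "s * k \<ge> 0")
      case True
      then have "nat \<bar>k + s\<bar> = Suc (nat \<bar>k\<bar>)" using assms(2) by (elim insertE) auto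
      then show ?thesis using True by (simp add: q_def)
    next
      case False
      then have "nat \<bar>k\<bar> = Suc (nat \<bar>k + s\<bar>)" using assms(2) by auto
      moreover have "poly [:1, 0, -1:] (cos b) = sin b * sin b"
        using sin_cos_squared_add[of b] by (simp add: power2_eq_square del: sin_cos_squared_add)
      moreover have "poly q (cos b) = poly [:1, 0, -1:] (cos b) * poly p (cos b)"
        using False by (simp only: q_def if_False poly_mult)
      ultimately show ?thesis by (simp del: poly_pCons)
    qed
    show "harm_form (k + s) q a b = of_real (sin b) * circ_exp s a * harm_form k p a b"
      unfolding harm_form_def e eq of_real_mult by (simp only: mult_ac)
  qed
qed

lemma in_harm_span_mult_linear:
  assumes G: "in_harm_span G" and f: "bounded_linear (f :: real^3 \<Rightarrow> real)"
  shows "in_harm_span (\<lambda>a b. of_real (f (sph a b)) * G a b)"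
proof (rule in_harm_span_cong)
  define U where "U s a b = complex_of_real (sin b) * circ_exp s a * G a b" for s :: int and a b
  \<comment> \<open>These express the first two terms of the linear form through x1 + i x2 and x1 -
    i x2.\<close>
  define z1 z2 where "z1 = (of_real (f (axis 1 1)) - \<i> * of_real (f (axis 2 1))) / 2"
    and "z2 = (of_real (f (axis 1 1)) + \<i> * of_real (f (axis 2 1))) / 2"
  show "in_harm_span (\<lambda>a b. z1 * U 1 a b + (z2 * U (-1) a b + of_real (f (axis 3 1)) * (of_real (cos b) * G a b)))"
    unfolding U_def by (intro in_harm_span_add in_harm_span_scale in_harm_span_mult_u in_harm_span_mult_z G) auto
  fix a b :: real
  have "x = x $ 1 *\<^sub>R axis 1 1 + x $ 2 *\<^sub>R axis 2 1 + x $ 3 *\<^sub>R axis 3 1" for x :: "real^3"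
    by (simp add: vec_eq_iff forall_3 axis_def)
  from this[of "sph a b"]
  have f: "f (sph a b) = cos a * sin b * f (axis 1 1) + sin a * sin b * f (axis 2 1) + cos b * f (axis 3 1)"
    using linear_add[OF bounded_linear.linear[OF f]] linear_scale[OF bounded_linear.linear[OF f]]
    by (metis real_scaleR_def sph_nth)
  have z: "z1 * cis a + z2 * cis (- a) = of_real (cos a * f (axis 1 1) + sin a * f (axis 2 1))"
    by (simp add: z1_def z2_def complex_eq_iff field_simps)
  have U: "U 1 a b = of_real (sin b) * cis a * G a b" "U (-1) a b = of_real (sin b) * cis (-a) * G a b"
    by (simp_all add: U_def cis_conv_exp)
  have "z1 * U 1 a b + (z2 * U (-1) a b + of_real (f (axis 3 1)) * (of_real (cos b) * G a b))
    = (of_real (sin b) * (z1 * cis a + z2 * cis (- a)) + of_real (cos b * f (axis 3 1))) * G a b"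
    unfolding U by (simp add: algebra_simps)
  also have "of_real (sin b) * (z1 * cis a + z2 * cis (- a)) + of_real (cos b * f (axis 3 1)) = complex_of_real (f (sph a b))"
    unfolding z f by (simp add: algebra_simps)
  finally show "z1 * U 1 a b + (z2 * U (-1) a b + of_real (f (axis 3 1)) * (of_real (cos b) * G a b))
      = of_real (f (sph a b)) * G a b" .
qed

lemma in_harm_span_polynomial:
  assumes "real_polynomial_function (f :: real^3 \<Rightarrow> real)"
  shows "in_harm_span (\<lambda>a b. of_real (f (sph a b)))"
proof -
  \<comment> \<open>The claim is strengthened to multiplication by \<open>f\<close> preserving the
    span, since this property passes to products by composition.\<close>
  have "in_harm_span (\<lambda>a b. of_real (f (sph a b)) * G a b)" if "in_harm_span G" for G
    using assms that
  proof (induction arbitrary: G)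
    case (linear f)
    then show ?case by (intro in_harm_span_mult_linear)
  next
    case (const c)
    then show ?case by (intro in_harm_span_scale)
  next
    case (add f g)
    then show ?case using in_harm_span_add[OF add.IH(1)[OF add.prems] add.IH(2)[OF add.prems]] by (simp add: distrib_right)
  next
    case (mult f g)
    then show ?case using mult.IH(1)[OF mult.IH(2)[OF mult.prems]] by (simp add: mult.assoc)
  qed
  note * = this
  have "in_harm_span (\<lambda>a b. 1)"
    by (rule in_harm_span_cong[OF in_harm_span_harm_form[of 0 1]]) (simp add: harm_form_def)
  from *[OF this] show ?thesis by simp
qed

text \<open>Density is phrased with nonnegative integrals, which spares all integrability side conditions.\<close>

abbreviation (input) sq_norm :: "'a measure \<Rightarrow> ('a \<Rightarrow> real) \<Rightarrow> ennreal" where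
  "sq_norm M f \<equiv> \<integral>\<^sup>+ x. ennreal ((f x)\<^sup>2) \<partial>M"

abbreviation (input) sq_dist :: "'a measure \<Rightarrow> ('a \<Rightarrow> real) \<Rightarrow> ('a \<Rightarrow> real) \<Rightarrow> ennreal" where
  "sq_dist M f g \<equiv> \<integral>\<^sup>+ x. ennreal ((f x - g x)\<^sup>2) \<partial>M"

section \<open>Polynomials are dense in mean square\<close>

definition poly_approx :: "'a::euclidean_space measure \<Rightarrow> ('a \<Rightarrow> real) \<Rightarrow> bool" where
  "poly_approx M f \<longleftrightarrow> (\<forall>e>0. \<exists>g. real_polynomial_function g \<and> sq_dist M f g < ennreal e)"

lemma borel_measurable_real_polynomial [measurable_dest]:
  fixes g :: "'a::euclidean_space \<Rightarrow> real"
  assumes "real_polynomial_function g"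
  shows "g \<in> borel_measurable borel"
  using assms by (intro borel_measurable_continuous_onI continuous_on_polymonial_function)
    (simp add: real_polynomial_function_eq)

lemma square_diff_bound: "(x - z)\<^sup>2 \<le> 2 * (x - y)\<^sup>2 + 2 * (y - z :: real)\<^sup>2"
  using zero_le_power2[of "(x - y) - (y - z)"] by (simp add: power2_eq_square algebra_simps)

lemma nn_integral_square_diff_bound:
  fixes f g h :: "'a \<Rightarrow> real"
  assumes [measurable]: "f \<in> borel_measurable M" "g \<in> borel_measurable M" "h \<in> borel_measurable M"
  shows "sq_dist M f g
    \<le> 2 * sq_dist M f h + 2 * sq_dist M h g"
proof -
  have "sq_dist M f g \<le> (\<integral>\<^sup>+ x. 2 * ennreal ((f x - h x)\<^sup>2) + 2 * ennreal ((h x - g x)\<^sup>2) \<partial>M)"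
  proof (intro nn_integral_mono)
    fix x
    have "ennreal ((f x - g x)\<^sup>2) \<le> ennreal (2 * (f x - h x)\<^sup>2 + 2 * (h x - g x)\<^sup>2)"
      by (intro ennreal_leI square_diff_bound)
    also have "\<dots> = 2 * ennreal ((f x - h x)\<^sup>2) + 2 * ennreal ((h x - g x)\<^sup>2)"
      by (simp add: ennreal_mult)
    finally show "ennreal ((f x - g x)\<^sup>2) \<le> 2 * ennreal ((f x - h x)\<^sup>2) + 2 * ennreal ((h x - g x)\<^sup>2)" .
  qed
  also have "\<dots> = 2 * sq_dist M f h + 2 * sq_dist M h g"
    by (simp add: nn_integral_add nn_integral_cmult)
  finally show ?thesis .
qed

lemma ennreal_four_quarters:
  assumes "e > 0"
  shows "2 * ennreal (e/4) + 2 * ennreal (e/4) = ennreal e"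
proof -
  have "2 * ennreal (e/4) = ennreal (e/2)" using ennreal_mult''[of "e/4" 2] assms by simp
  then show ?thesis using assms by (simp flip: ennreal_plus)
qed

lemma poly_approx_trans:
  fixes f :: "'a::euclidean_space \<Rightarrow> real"
  assumes M: "sets M = sets borel" and f: "f \<in> borel_measurable borel"
    and *: "\<And>e. e > 0 \<Longrightarrow> \<exists>h \<in> borel_measurable borel. poly_approx M h \<and> sq_dist M f h < ennreal e"
  shows "poly_approx M f"
  unfolding poly_approx_def
proof (intro allI impI)
  fix e :: real assume e: "e > 0"
  obtain h where h: "h \<in> borel_measurable borel" "poly_approx M h" "sq_dist M f h < ennreal (e/4)"
    using *[of "e/4"] e by auto
  obtain g where g: "real_polynomial_function g" "sq_dist M h g < ennreal (e/4)"
    using h(2) e unfolding poly_approx_def by (meson divide_pos_pos zero_less_numeral)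
  have m: "f \<in> borel_measurable M" "g \<in> borel_measurable M" "h \<in> borel_measurable M"
    using f h(1) borel_measurable_real_polynomial[OF g(1)] M by (simp_all cong: measurable_cong_sets)
  have "sq_dist M f g
    \<le> 2 * sq_dist M f h + 2 * sq_dist M h g"
    by (rule nn_integral_square_diff_bound[OF m])
  also have "\<dots> < 2 * ennreal (e/4) + 2 * ennreal (e/4)"
    using h(3) g(2) by (intro add_strict_mono ennreal_mult_strict_left_mono) auto
  also have "\<dots> = ennreal e"
    using e by (rule ennreal_four_quarters)
  finally show "\<exists>g. real_polynomial_function g \<and> sq_dist M f g < ennreal e"
    using g(1) by blast
qed

text \<open>\<open>w\<close> is one integrable bound for all squared errors, so dominated
  convergence sends them to 0 in the mean. Both the continuous bumps and increasing sequences of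
  functions are covered.\<close>

lemma poly_approx_limit:
  fixes f :: "'a::euclidean_space \<Rightarrow> real"
  assumes M: "sets M = sets borel" and f: "f \<in> borel_measurable borel"
    and h: "\<And>n. h n \<in> borel_measurable borel" "\<And>n. poly_approx M (h n)"
    and w: "w \<in> borel_measurable borel" "integral\<^sup>N M w < \<infinity>" "\<And>n x. ennreal ((f x - h n x)\<^sup>2) \<le> w x"
    and lim: "\<And>x. (\<lambda>n. h n x) \<longlonglongrightarrow> f x"
  shows "poly_approx M f"
proof (rule poly_approx_trans[OF M f])
  fix e :: real assume e: "e > 0"
  have "(\<lambda>n. \<integral>\<^sup>+ x. ennreal ((f x - h n x)\<^sup>2) \<partial>M) \<longlonglongrightarrow> (\<integral>\<^sup>+ x. 0 \<partial>M)"
  proof (rule nn_integral_dominated_convergence)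
    have "(\<lambda>n. ennreal ((f x - h n x)\<^sup>2)) \<longlonglongrightarrow> ennreal ((f x - f x)\<^sup>2)" for x
      by (intro tendsto_intros lim)
    then show "AE x in M. (\<lambda>n. ennreal ((f x - h n x)\<^sup>2)) \<longlonglongrightarrow> 0" by simp
  qed (use f h w M in \<open>auto cong: measurable_cong_sets\<close>)
  then have "eventually (\<lambda>n. sq_dist M f (h n) < ennreal e) sequentially"
    using e by (intro order_tendstoD) auto
  then obtain n where "sq_dist M f (h n) < ennreal e"
    by (auto simp: eventually_sequentially)
  then show "\<exists>h \<in> borel_measurable borel. poly_approx M h \<and> sq_dist M f h < ennreal e"
    using h by blast
qed

lemma poly_approx_add:
  fixes f1 f2 :: "'a::euclidean_space \<Rightarrow> real"
  assumes M: "sets M = sets borel" and f: "f1 \<in> borel_measurable borel" "f2 \<in> borel_measurable borel"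
    and P: "poly_approx M f1" "poly_approx M f2"
  shows "poly_approx M (\<lambda>x. f1 x + f2 x)"
proof (rule poly_approx_trans[OF M])
  fix e :: real assume "e > 0"
  then obtain g2 where g2: "real_polynomial_function g2" "sq_dist M f2 g2 < ennreal e"
    using P(2) unfolding poly_approx_def by blast
  have "poly_approx M (\<lambda>x. f1 x + g2 x)"
    unfolding poly_approx_def
  proof (intro allI impI)
    fix d :: real assume "d > 0"
    then obtain g1 where g1: "real_polynomial_function g1" "sq_dist M f1 g1 < ennreal d"
      using P(1) unfolding poly_approx_def by blast
    then show "\<exists>g. real_polynomial_function g \<and> sq_dist M (\<lambda>x. f1 x + g2 x) g < ennreal d"
      using g2(1) by (intro exI[of _ "\<lambda>x. g1 x + g2 x"]) (auto simp: algebra_simps)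
  qed
  then show "\<exists>h \<in> borel_measurable borel. poly_approx M h \<and> sq_dist M (\<lambda>x. f1 x + f2 x) h < ennreal e"
    using f(1) g2 borel_measurable_real_polynomial[OF g2(1)]
    by (intro bexI[of _ "\<lambda>x. f1 x + g2 x"]) auto
qed (use f in measurable)

lemma poly_approx_scale:
  fixes f :: "'a::euclidean_space \<Rightarrow> real"
  assumes M: "sets M = sets borel" and f: "f \<in> borel_measurable borel" and P: "poly_approx M f"
  shows "poly_approx M (\<lambda>x. c * f x)"
  unfolding poly_approx_def
proof (intro allI impI)
  fix e :: real assume e: "e > 0"
  \<comment> \<open>The summand 1 keeps the tolerance meaningful for c = 0 and the final inequality
    strict.\<close>
  have pos: "e / (c\<^sup>2 + 1) > 0" using e by (simp add: add_nonneg_pos)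
  then obtain g where g: "real_polynomial_function g" "sq_dist M f g < ennreal (e / (c\<^sup>2 + 1))"
    using P unfolding poly_approx_def by meson
  have [measurable]: "f \<in> borel_measurable M" "g \<in> borel_measurable M"
    using f borel_measurable_real_polynomial[OF g(1)] M by (simp_all cong: measurable_cong_sets)
  have "(\<integral>\<^sup>+ x. ennreal ((c * f x - c * g x)\<^sup>2) \<partial>M) = (\<integral>\<^sup>+ x. ennreal (c\<^sup>2) * ennreal ((f x - g x)\<^sup>2) \<partial>M)"
    by (simp add: ennreal_mult[symmetric] power_mult_distrib[symmetric] right_diff_distrib)
  also have "\<dots> = ennreal (c\<^sup>2) * sq_dist M f g"
    by (simp add: nn_integral_cmult)
  also have "\<dots> \<le> ennreal (c\<^sup>2) * ennreal (e / (c\<^sup>2 + 1))"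
    using g(2) by (intro mult_left_mono) auto
  also have "\<dots> = ennreal (c\<^sup>2 * (e / (c\<^sup>2 + 1)))"
    using pos by (intro ennreal_mult[symmetric]) auto
  also have "\<dots> < ennreal e"
  proof (rule ennreal_lessI[OF e])
    have "c\<^sup>2 + 1 > 0" by (simp add: add_nonneg_pos)
    then show "c\<^sup>2 * (e / (c\<^sup>2 + 1)) < e" using e by (simp add: divide_simps algebra_simps)
  qed
  finally show "\<exists>g. real_polynomial_function g \<and> (\<integral>\<^sup>+ x. ennreal ((c * f x - g x)\<^sup>2) \<partial>M) < ennreal e"
    using g(1) by blast
qed

lemma poly_approx_continuous:
  fixes f :: "'a::euclidean_space \<Rightarrow> real"
  assumes "finite_measure M" and M: "sets M = sets borel" and S: "compact S" "AE x in M. x \<in> S"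
    and f: "continuous_on S f"
  shows "poly_approx M f"
  unfolding poly_approx_def
proof (intro allI impI)
  interpret finite_measure M by fact
  fix e :: real assume e: "e > 0"
  \<comment> \<open>Adding 1 avoids division by 0 for the null measure and makes e / m times the
    total mass strictly smaller than e.\<close>
  define m where "m = measure M (space M) + 1"
  have m: "m > 0" unfolding m_def by (simp add: add_nonneg_pos)
  then have em: "e / m > 0" using e by simp
  then obtain g where g: "real_polynomial_function g" "\<And>x. x \<in> S \<Longrightarrow> \<bar>f x - g x\<bar> < sqrt (e / m)"
    using Stone_Weierstrass_real_polynomial_function[OF S(1) f, of "sqrt (e / m)"] by auto
  have "sq_dist M f g \<le> (\<integral>\<^sup>+ x. ennreal (e / m) \<partial>M)"
  proof (rule nn_integral_mono_AE)
    show "AE x in M. ennreal ((f x - g x)\<^sup>2) \<le> ennreal (e / m)"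
      using S(2)
    proof eventually_elim
      case (elim x)
      have "(f x - g x)\<^sup>2 \<le> (sqrt (e / m))\<^sup>2"
        using g(2)[OF elim] by (metis abs_ge_zero less_imp_le power2_abs power_mono)
      then show ?case using em by (auto intro!: ennreal_leI)
    qed
  qed
  also have "\<dots> = ennreal (e / m) * ennreal (measure M (space M))"
    by (simp add: emeasure_eq_measure)
  also have "\<dots> = ennreal (e / m * measure M (space M))"
    using em by (intro ennreal_mult[symmetric]) auto
  also have "\<dots> < ennreal e"
    using e m by (intro ennreal_lessI) (auto simp: m_def divide_simps algebra_simps)
  finally show "\<exists>g. real_polynomial_function g \<and> sq_dist M f g < ennreal e"
    using g(1) by blast
qed

definition closed_bump :: "'a::metric_space set \<Rightarrow> nat \<Rightarrow> 'a \<Rightarrow> real" where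
  "closed_bump K n x = max 0 (1 - real n * infdist x K)"

lemma closed_bump_bounds: "0 \<le> closed_bump K n x" "closed_bump K n x \<le> 1"
  by (simp_all add: closed_bump_def infdist_nonneg)

lemma continuous_closed_bump: "continuous_on S (closed_bump K n)"
  unfolding closed_bump_def[abs_def] by (intro continuous_intros)

text \<open>A point outside the closed set has positive distance from it, so its bump is eventually
  0. The empty set is special because \<open>infdist x {}\<close> is 0, which would make its bump
  constantly 1.\<close>

lemma closed_bump_tendsto:
  assumes "closed K" "K \<noteq> {}"
  shows "(\<lambda>n. closed_bump K n x) \<longlonglongrightarrow> indicator K x"
proof (cases "x \<in> K")
  case True
  then show ?thesis by (simp add: closed_bump_def)
next
  case False
  then have d: "infdist x K > 0"
    using assms by (metis in_closed_iff_infdist_zero infdist_nonneg less_eq_real_def)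
  then obtain N where N: "1 < real N * infdist x K"
    using reals_Archimedean3 by blast
  have "closed_bump K n x = 0" if "n \<ge> N" for n
  proof -
    have "real N * infdist x K \<le> real n * infdist x K"
      using that d by (intro mult_right_mono) auto
    then show ?thesis using N by (simp add: closed_bump_def)
  qed
  then have "eventually (\<lambda>n. closed_bump K n x = 0) sequentially"
    by (auto simp: eventually_sequentially)
  then show ?thesis using False by (simp add: tendsto_eventually)
qed

context
  fixes M :: "'a::euclidean_space measure" and S :: "'a set"
  assumes fin: "finite_measure M" and M: "sets M = sets borel" and S: "compact S" "AE x in M. x \<in> S"
begin

interpretation finite_measure M by (rule fin)

lemma poly_approx_indicator_closed:
  assumes "closed K"
  shows "poly_approx M (indicator K)"
proof (cases "K = {}")
  case True
  then have "indicator K = (\<lambda>_. 0 :: real)" by auto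
  then show ?thesis
    using poly_approx_continuous[OF fin M S, of "\<lambda>_. 0"] by simp
next
  case False
  show ?thesis
  proof (rule poly_approx_limit[OF M, where h = "closed_bump K" and w = "\<lambda>_. 1"])
    show "closed_bump K n \<in> borel_measurable borel" for n
      by (intro borel_measurable_continuous_onI continuous_closed_bump)
    show "poly_approx M (closed_bump K n)" for n
      by (intro poly_approx_continuous[OF fin M S] continuous_closed_bump)
    show "ennreal ((indicator K x - closed_bump K n x)\<^sup>2) \<le> 1" for n x
    proof -
      have "\<bar>indicator K x - closed_bump K n x\<bar> \<le> 1"
        using closed_bump_bounds[of K n x] by (auto simp: indicator_def)
      then show ?thesis
        using abs_square_le_1[of "indicator K x - closed_bump K n x :: real"] by (simp add: ennreal_le_1)
    qed
  qed (use assms False closed_bump_tendsto in \<open>auto simp: emeasure_eq_measure\<close>)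
qed

text \<open>Inner regularity replaces the Borel set by a closed subset; the squared error is then
  the measure of the difference.\<close>

lemma poly_approx_indicator:
  assumes B: "B \<in> sets borel"
  shows "poly_approx M (indicator B)"
proof (rule poly_approx_trans[OF M])
  fix e :: real assume e: "e > 0"
  have "\<exists>K. closed K \<and> K \<subseteq> B \<and> measure M B < measure M K + e"
  \<comment> \<open>For a set of small measure the empty subset serves; otherwise
    \<open>measure M B - e\<close> is nonnegative and faithfully represented in
    \<open>ennreal\<close>.\<close>
  proof (cases "measure M B < e")
    case True
    then show ?thesis by (intro exI[of _ "{}"]) auto
  next
    case False
    have "ennreal (measure M B - e) < emeasure M B"
      using False e by (simp add: emeasure_eq_measure ennreal_lessI)
    also have "emeasure M B = (SUP K \<in> {K. K \<subseteq> B \<and> compact K}. emeasure M K)"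
      using B by (intro inner_regular M) auto
    finally obtain K where K: "K \<subseteq> B" "compact K" "ennreal (measure M B - e) < emeasure M K"
      unfolding less_SUP_iff by auto
    then have "measure M B - e < measure M K"
      using False by (simp add: emeasure_eq_measure ennreal_less_iff)
    then show ?thesis using K compact_imp_closed by (intro exI[of _ K]) auto
  qed
  then obtain K where K: "closed K" "K \<subseteq> B" "measure M B < measure M K + e" by blast
  have "(\<integral>\<^sup>+ x. ennreal ((indicator B x - indicator K x)\<^sup>2) \<partial>M) = (\<integral>\<^sup>+ x. indicator (B - K) x \<partial>M)"
    using K(2) by (intro nn_integral_cong) (auto simp: indicator_def)
  also have "\<dots> = ennreal (measure M (B - K))"
    using B K(1) M by (simp add: emeasure_eq_measure)
  also have "\<dots> < ennreal e"
    using K B M e by (subst finite_measure_Diff) (auto intro!: ennreal_lessI)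
  finally show "\<exists>h\<in>borel_measurable borel. poly_approx M h \<and> (\<integral>\<^sup>+ x. ennreal ((indicator B x - h x)\<^sup>2) \<partial>M) < ennreal e"
    using poly_approx_indicator_closed[OF K(1)] K(1) by (intro bexI[of _ "indicator K"]) auto
qed (use B in auto)

lemma poly_approx_nonneg:
  assumes u: "u \<in> borel_measurable borel" "\<And>x. 0 \<le> u x" "sq_norm M u < \<infinity>"
  shows "poly_approx M u"
  using assms
proof (induction rule: borel_measurable_induct_real)
  case (set A)
  then show ?case by (intro poly_approx_indicator) auto
next
  case (mult u c)
  show ?case
  \<comment> \<open>For c = 0 a finite norm of the product says nothing about \<open>u\<close>, and
    the induction hypothesis cannot be invoked.\<close>
  proof (cases "c = 0")
    case True
    then show ?thesis using poly_approx_continuous[OF fin M S, of "\<lambda>_. 0"] by simp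
  next
    case False
    have [measurable]: "u \<in> borel_measurable M" using mult.hyps M by (simp cong: measurable_cong_sets)
    have "sq_norm M u = (\<integral>\<^sup>+ x. ennreal ((1 / c)\<^sup>2) * ennreal ((c * u x)\<^sup>2) \<partial>M)"
      using False by (simp add: ennreal_mult[symmetric] power_mult_distrib[symmetric])
    also have "\<dots> = ennreal ((1 / c)\<^sup>2) * sq_norm M (\<lambda>x. c * u x)"
      by (simp add: nn_integral_cmult)
    also have "\<dots> < \<infinity>" using mult.prems by (simp add: ennreal_mult_less_top)
    finally show ?thesis using mult by (intro poly_approx_scale M) auto
  qed
next
  case (add u v)
  have "sq_norm M w < \<infinity>" if "w = u \<or> w = v" for w
  proof -
    have "sq_norm M w \<le> sq_norm M (\<lambda>x. v x + u x)"
      using that add.hyps by (intro nn_integral_mono ennreal_leI power_mono) auto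
    then show ?thesis using add.prems by (metis infinity_ennreal_def order_le_less_trans)
  qed
  then show ?case using add by (intro poly_approx_add M) auto
next
  case (seq U)
  have U: "0 \<le> U n x" "U n x \<le> u x" for n x
  proof -
    show "0 \<le> U n x" using seq.hyps by auto
    have "incseq (\<lambda>i. U i x)" using seq.hyps by (auto simp: incseq_def le_fun_def)
    then show "U n x \<le> u x" using seq.hyps by (intro incseq_le) auto
  qed
  show ?case
  proof (rule poly_approx_limit[OF M, where h = U and w = "\<lambda>x. ennreal ((u x)\<^sup>2)"])
    show "poly_approx M (U n)" for n
    proof (rule seq.IH)
      have "sq_norm M (U n) \<le> sq_norm M u"
        using U by (intro nn_integral_mono ennreal_leI power_mono) auto
      then show "sq_norm M (U n) < \<infinity>"
        using seq.prems by (metis infinity_ennreal_def order_le_less_trans)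
    qed
    show "ennreal ((u x - U n x)\<^sup>2) \<le> ennreal ((u x)\<^sup>2)" for n x
      using U[of n x] by (intro ennreal_leI power_mono) auto
  qed (use u seq in auto)
qed

lemma poly_approx_L2:
  assumes f: "f \<in> borel_measurable borel" "sq_norm M f < \<infinity>"
  shows "poly_approx M f"
proof -
  have P: "poly_approx M u" if "u = (\<lambda>x. max 0 (f x)) \<or> u = (\<lambda>x. max 0 (- f x))" for u
  proof (rule poly_approx_nonneg)
    show "u \<in> borel_measurable borel" using that f(1) by auto
    show "0 \<le> u x" for x using that by auto
    have "sq_norm M u \<le> sq_norm M f"
      using that by (intro nn_integral_mono ennreal_leI) (auto simp: max_def)
    then show "sq_norm M u < \<infinity>"
      using f(2) by (metis infinity_ennreal_def order_le_less_trans)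
  qed
  have "poly_approx M (\<lambda>x. max 0 (f x) + (-1) * max 0 (- f x))"
    using f(1) by (intro poly_approx_add poly_approx_scale P M) auto
  also have "(\<lambda>x. max 0 (f x) + (-1) * max 0 (- f x)) = f"
    by (auto simp: max_def)
  finally show ?thesis .
qed

end

text \<open>Closed sets are a generator stable under intersections, and their measures are limits of
  integrals of continuous bumps.\<close>

lemma finite_measure_eqI_continuous:
  fixes M N :: "'a::euclidean_space measure"
  assumes "finite_measure M" "finite_measure N" and s: "sets M = sets borel" "sets N = sets borel"
    and eq: "\<And>f. continuous_on UNIV f \<Longrightarrow> (\<And>x. 0 \<le> f x \<and> f x \<le> 1) \<Longrightarrow> (LINT x|M. f x :: real) = (LINT x|N. f x)"
  shows "M = N"
proof -
  interpret M: finite_measure M by fact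
  interpret N: finite_measure N by fact
  have lim: "(\<lambda>n. LINT x|L. closed_bump K n x) \<longlonglongrightarrow> measure L K"
    if "finite_measure L" "sets L = sets borel" "closed K" "K \<noteq> {}" for L :: "'a measure" and K
  proof -
    interpret L: finite_measure L by fact
    have [measurable]: "K \<in> sets L" using that by simp
    have "closed_bump K n \<in> borel_measurable L" for n
      using that(2) borel_measurable_continuous_onI[OF continuous_closed_bump]
      by (simp cong: measurable_cong_sets)
    then have "(\<lambda>n. LINT x|L. closed_bump K n x) \<longlonglongrightarrow> (LINT x|L. indicator K x)"
      using closed_bump_bounds[of K] closed_bump_tendsto[OF that(3,4)]
      by (intro integral_dominated_convergence[where w = "\<lambda>_. 1"]) auto
    then show ?thesis using that by (simp add: sets_eq_imp_space_eq[OF that(2)])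
  qed
  show ?thesis
  proof (rule measure_eqI_generator_eq[where E = "Collect closed" and \<Omega> = UNIV and A = "\<lambda>_. UNIV"])
    show "Int_stable (Collect (closed :: 'a set \<Rightarrow> bool))" by (auto simp: Int_stable_def)
    show "sets M = sigma_sets UNIV (Collect closed)" "sets N = sigma_sets UNIV (Collect closed)"
      by (simp_all add: s borel_eq_closed)
    fix K :: "'a set" assume "K \<in> Collect closed"
    then have K: "closed K" by simp
    show "emeasure M K = emeasure N K"
    proof (cases "K = {}")
      case False
      have "(\<lambda>n. LINT x|M. closed_bump K n x) = (\<lambda>n. LINT x|N. closed_bump K n x)"
        by (intro ext eq continuous_closed_bump conjI closed_bump_bounds)
      then have "measure M K = measure N K"
        using lim[OF assms(1) s(1) K False] lim[OF assms(2) s(2) K False] LIMSEQ_unique by metis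
      then show ?thesis by (simp add: M.emeasure_eq_measure N.emeasure_eq_measure)
    qed simp
  qed (auto simp: M.emeasure_eq_measure)
qed

section \<open>Rotation invariance of the surface measure\<close>

lemma borel_measurable_vecI:
  fixes f :: "'a \<Rightarrow> 'b::euclidean_space ^ 'n"
  assumes "\<And>i. (\<lambda>x. f x $ i) \<in> borel_measurable M"
  shows "f \<in> borel_measurable M"
  unfolding borel_measurable_euclidean_space[of f]
proof
  fix b :: "'b ^ 'n" assume "b \<in> Basis"
  then obtain i u where b: "b = axis i u" by (auto simp: Basis_vec_def)
  show "(\<lambda>x. f x \<bullet> b) \<in> borel_measurable M"
    unfolding b inner_axis by (intro borel_measurable_inner assms) auto
qed

lemma borel_measurable_vec_nth_comp [measurable (raw)]:
  fixes f :: "'a \<Rightarrow> 'b::euclidean_space ^ 'n"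
  shows "f \<in> borel_measurable M \<Longrightarrow> (\<lambda>x. f x $ i) \<in> borel_measurable M"
  by (rule borel_measurable_continuous_on[OF continuous_on_component])  (rule continuous_on_id)

lemma borel_measurable_vector_3 [measurable (raw)]:
  fixes f g h :: "'a \<Rightarrow> 'b::euclidean_space"
  assumes "f \<in> borel_measurable M" "g \<in> borel_measurable M" "h \<in> borel_measurable M"
  shows "(\<lambda>x. vector [f x, g x, h x] :: 'b ^ 3) \<in> borel_measurable M"
proof (rule borel_measurable_vecI)
  fix i :: 3
  show "(\<lambda>x. (vector [f x, g x, h x] :: 'b ^ 3) $ i) \<in> borel_measurable M"
    using assms exhaust_3[of i] by auto
qed

lemma borel_measurable_sph [measurable]: "(\<lambda>p. sph (fst p) (snd p)) \<in> borel_measurable (borel \<Otimes>\<^sub>M borel)"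
  unfolding sph_def by measurable

lemma sin_pos_imp_interior:
  assumes "0 \<le> b" "b \<le> pi" "0 < sin b"
  shows "0 < b" "b < pi"
  using assms by (cases "b = 0 \<or> b = pi"; auto simp: less_le)+

lemma AE_S2_measure: "AE p in S2_measure. 0 < snd p \<and> snd p < pi"
  unfolding S2_measure_def
proof (subst AE_density)
  show "AE p in lborel. 0 < indicator ({0..2*pi} \<times> {0..pi}) p * ennreal (sin (snd p)) \<longrightarrow> 0 < snd p \<and> snd p < pi"
    by (auto simp: indicator_def zero_less_mult_iff sin_pos_imp_interior)
qed (simp add: borel_prod[symmetric])

definition sphereM :: "(real^3) measure" where
  "sphereM = distr S2_measure borel (\<lambda>p. sph (fst p) (snd p))"

lemma sets_sphereM [measurable_cong, simp]: "sets sphereM = sets borel"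
  and space_sphereM [simp]: "space sphereM = UNIV"
  by (simp_all add: sphereM_def)

interpretation sphere: finite_measure sphereM
  unfolding sphereM_def by (intro S2.finite_measure_distr) measurable

lemma norm_sph [simp]: "norm (sph a b) = 1"
proof -
  have "(cos a * sin b)\<^sup>2 + (sin a * sin b)\<^sup>2 + (cos b)\<^sup>2 = 1"
    using sin_cos_squared_add[of a] sin_cos_squared_add[of b] by algebra
  then show ?thesis by (simp add: norm_vec_def L2_set_def sum_3)
qed

lemma AE_sphereM_norm: "AE x in sphereM. norm x = 1"
  unfolding sphereM_def by (subst AE_distr_iff) auto

text \<open>A latitude circle corresponds to the single polar angle arccos t. This serves to discard
  the points that a rotation carries to the third axis.\<close>

lemma AE_sphereM_nth: "AE x in sphereM. x $ 3 \<noteq> t"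
proof -
  have "AE b in polarM. cos b \<noteq> t"
    unfolding polarM_def
  proof (subst AE_density)
    have "AE b in lborel. b \<noteq> arccos t" by (rule AE_lborel_singleton)
    then show "AE b in lborel. 0 < indicator {0..pi} b * ennreal (sin b) \<longrightarrow> cos b \<noteq> t"
      by eventually_elim (auto simp: indicator_def arccos_cos)
  qed simp
  moreover have "{p \<in> space (circM \<Otimes>\<^sub>M polarM). cos (snd p) \<noteq> t} \<in> sets (circM \<Otimes>\<^sub>M polarM)"
    by measurable
  ultimately have "AE p in S2_measure. cos (snd p) \<noteq> t"
    unfolding S2_measure_eq_pair by (intro circ_polar.AE_pair_measure) simp_all
  then show ?thesis unfolding sphereM_def by (subst AE_distr_iff) auto
qed

lemma sphere_eq_sph:
  fixes x :: "real^3"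
  assumes "norm x = 1" "x $ 1 \<noteq> 0 \<or> x $ 2 \<noteq> 0"
  obtains a b where "0 < b" "b < pi" "x = sph a b"
proof -
  have n: "(x $ 1)\<^sup>2 + (x $ 2)\<^sup>2 + (x $ 3)\<^sup>2 = 1"
    using assms(1) by (simp add: norm_vec_def L2_set_def sum_3)
  have pos: "(x $ 1)\<^sup>2 + (x $ 2)\<^sup>2 > 0"
    using assms(2) by (simp add: sum_power2_gt_zero_iff)
  define b where "b = arccos (x $ 3)"
  have "(x $ 3)\<^sup>2 < 1" using n pos by linarith
  then have x3: "-1 < x $ 3" "x $ 3 < 1" by (simp_all add: abs_square_less_1)
  have b: "0 < b" "b < pi" "cos b = x $ 3"
    using x3 arccos_lt_bounded[of "x $ 3"] by (auto simp: b_def)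
  have s: "sin b > 0" using b by (intro sin_gt_zero)
  have "(sin b)\<^sup>2 = (x $ 1)\<^sup>2 + (x $ 2)\<^sup>2"
    using n sin_squared_eq[of b] b(3) by simp
  then have "(x $ 1 / sin b)\<^sup>2 + (x $ 2 / sin b)\<^sup>2 = (sin b)\<^sup>2 / (sin b)\<^sup>2"
    by (simp only: power_divide add_divide_distrib[symmetric])
  then have "(x $ 1 / sin b)\<^sup>2 + (x $ 2 / sin b)\<^sup>2 = 1"
    using s by simp
  then obtain a where "x $ 1 / sin b = cos a" "x $ 2 / sin b = sin a"
    using sincos_total_2pi by metis
  then have "x = sph a b"
    using s b(3) by (simp add: vec_eq_iff forall_3 field_simps)
  then show thesis using b that by blast
qed

lemma continuous_coeff_power:
  fixes p :: "'a::topological_space \<Rightarrow> 'b::real_normed_field poly"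
  assumes "\<And>i. continuous_on S (\<lambda>x. coeff (p x) i)"
  shows "continuous_on S (\<lambda>x. coeff (p x ^ n) i)"
proof (induction n arbitrary: i)
  case 0
  have "(\<lambda>x. coeff (p x ^ 0) i) = (\<lambda>_. if i = 0 then 1 else 0)" by (auto simp: coeff_1)
  then show ?case by simp
qed (auto simp: coeff_mult intro!: continuous_intros assms)

lemma continuous_coeff_pCons:
  fixes p :: "'a::topological_space \<Rightarrow> 'b::{zero,topological_space} poly"
  assumes "continuous_on S f" "\<And>i. continuous_on S (\<lambda>x. coeff (p x) i)"
  shows "continuous_on S (\<lambda>x. coeff (pCons (f x) (p x)) i)"
  using assms by (cases i) auto

lemma continuous_solid_harm: "continuous_on S (solid_harm n k)"
proof -
  have "continuous_on S (\<lambda>x. coeff (harm_poly x) i)" for i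
    unfolding harm_poly_def Complex_eq
    by (intro continuous_coeff_pCons continuous_intros)
  then show ?thesis
    unfolding solid_harm_def[abs_def] by (intro continuous_intros continuous_coeff_power)
qed

lemma measurable_solid_harm [measurable]: "solid_harm n k \<in> borel_measurable borel"
  by (intro borel_measurable_continuous_onI continuous_solid_harm)

lemma solid_harm_bounded:
  obtains B where "\<And>x. norm x = 1 \<Longrightarrow> norm (solid_harm n k x) \<le> B" "B \<ge> 0"
proof -
  have "bounded (solid_harm n k ` sphere 0 1)"
    by (intro compact_imp_bounded compact_continuous_image continuous_solid_harm compact_sphere)
  then obtain B where B: "\<forall>x\<in>sphere 0 1. norm (solid_harm n k x) \<le> B"
    unfolding bounded_iff by auto
  have "norm (solid_harm n k x) \<le> \<bar>B\<bar>" if "norm x = 1" for x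
    using bspec[OF B, of x] that by simp
  then show thesis by (rule that) simp_all
qed

lemma integrable_solid_harm: "integrable sphereM (solid_harm n k)"
proof -
  obtain B where "\<And>x. norm x = 1 \<Longrightarrow> norm (solid_harm n k x) \<le> B"
    using solid_harm_bounded by blast
  then show ?thesis
    using AE_sphereM_norm by (intro sphere.integrable_const_bound[where B = B]) auto
qed

text \<open>This is orthogonality to the harmonic of degree 0, which is a nonzero constant.\<close>

lemma integral_solid_harm:
  assumes "0 < n" "\<bar>k\<bar> \<le> int n"
  shows "(LINT x|sphereM. solid_harm n k x) = 0"
proof -
  have "(LINT x|sphereM. solid_harm n k x) = (LINT p|S2_measure. solid_harm n k (sph (fst p) (snd p)))"
    unfolding sphereM_def by (subst integral_distr) measurable
  also have "\<dots> = (LINT p|S2_measure. sph_harm n k (fst p) (snd p))"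
  proof (rule integral_cong_AE)
    show "AE p in S2_measure. solid_harm n k (sph (fst p) (snd p)) = sph_harm n k (fst p) (snd p)"
      using AE_S2_measure by eventually_elim (use assms in \<open>simp add: sph_harm_eq_solid_harm\<close>)
  qed (use measurable_sph_harm[OF assms(2)] in measurable)
  also have "\<dots> = 0"
  proof -
    define c where "c = norm_legendre 0 0 0"
    have c: "sph_harm 0 0 a b = of_real c" for a b
      by (simp add: sph_harm_def norm_legendre_def norm_legendre_pos_def assoc_legendre_def c_def)
    have "c \<noteq> 0"
      by (simp add: norm_legendre_def norm_legendre_pos_def assoc_legendre_def c_def)
    moreover have "of_real c * (LINT p|S2_measure. sph_harm n k (fst p) (snd p)) = 0"
      using sph_harm_orthonormal[OF assms(2), of 0 0] assms(1) by (simp add: c mult.commute)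
    ultimately show ?thesis by simp
  qed
  finally show ?thesis .
qed

lemma R2_minus_R2: "R2 (- b) *v (R2 b *v x) = x" "R2 b *v (R2 (- b) *v x) = x"
  by (simp_all add: vec_eq_iff forall_3 R2_mult_vec)
    (intro conjI; use sin_cos_squared_add[of b] in algebra)+

lemma norm_R2: "norm (R2 b *v x) = norm x"
proof -
  have "(cos b * x $ 1 + sin b * x $ 3)\<^sup>2 + (x $ 2)\<^sup>2 + (cos b * x $ 3 - sin b * x $ 1)\<^sup>2 = (x $ 1)\<^sup>2 + (x $ 2)\<^sup>2 + (x $ 3)\<^sup>2"
    using sin_cos_squared_add[of b] by algebra
  then show ?thesis by (simp add: norm_vec_def L2_set_def sum_3 R2_mult_vec)
qed

lemma borel_measurable_matrix_vector_mult [measurable (raw)]: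
  fixes f :: "'a \<Rightarrow> real^3^3" and g :: "'a \<Rightarrow> real^3"
  assumes [measurable]: "f \<in> borel_measurable M" "g \<in> borel_measurable M"
  shows "(\<lambda>x. f x *v g x) \<in> borel_measurable M"
proof (intro borel_measurable_vecI)
  fix i :: 3
  show "(\<lambda>x. (f x *v g x) $ i) \<in> borel_measurable M"
    unfolding matrix_vector_mult_def by simp
qed

text \<open>If the rotated point is a pole, then rotating back gives \<open>x\<close> the third
  coordinate cos b or - cos b; these two latitude circles are null sets.\<close>

lemma AE_sphereM_R2: "AE x in sphereM. (R2 b *v x) $ 1 \<noteq> 0 \<or> (R2 b *v x) $ 2 \<noteq> 0"
  using AE_sphereM_norm AE_sphereM_nth[of "cos b"] AE_sphereM_nth[of "- cos b"]
proof eventually_elim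
  case (elim x)
  show ?case
  proof (rule ccontr)
    assume "\<not> ?thesis"
    then have z: "(R2 b *v x) $ 1 = 0" "(R2 b *v x) $ 2 = 0" by auto
    moreover have "norm (R2 b *v x) = 1" using elim by (simp add: norm_R2)
    ultimately have "((R2 b *v x) $ 3)\<^sup>2 = 1" by (simp add: norm_vec_def L2_set_def sum_3) (metis power2_abs power_one)
    then have "(R2 b *v x) $ 3 = 1 \<or> (R2 b *v x) $ 3 = -1" by (simp add: power2_eq_1_iff)
    moreover have "x $ 3 = cos b * (R2 b *v x) $ 3"
      using R2_mult_vec(3)[of "- b" "R2 b *v x"] z by (simp add: R2_minus_R2)
    ultimately show False using elim by auto
  qed
qed

lemma polynomial_eq_solid_harm:
  assumes "real_polynomial_function (g :: real^3 \<Rightarrow> real)"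
  obtains N c where "\<And>x. norm x = 1 \<Longrightarrow> x $ 1 \<noteq> 0 \<or> x $ 2 \<noteq> 0 \<Longrightarrow>
    of_real (g x) = (\<Sum>n<N. \<Sum>k=-int n..int n. c n k * solid_harm n k x)"
proof -
  obtain N c where Nc: "\<And>a b. 0 < b \<Longrightarrow> b < pi \<Longrightarrow>
      complex_of_real (g (sph a b)) = harm_sum N c a b"
    using in_harm_span_polynomial[OF assms] unfolding in_harm_span_def by blast
  show thesis
  proof (rule that)
    fix x :: "real^3" assume "norm x = 1" "x $ 1 \<noteq> 0 \<or> x $ 2 \<noteq> 0"
    then obtain a b where b: "0 < b" "b < pi" "x = sph a b" by (rule sphere_eq_sph)
    then show "of_real (g x) = (\<Sum>n<N. \<Sum>k=-int n..int n. c n k * solid_harm n k x)"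
      unfolding b(3) Nc[OF b(1,2)] by (intro sum.cong refl) (auto simp: sph_harm_eq_solid_harm)
  qed
qed

text \<open>A rotated harmonic is a combination of harmonics of the same degree. In positive degree
  all of them have integral 0, and in degree 0 the function is constant.\<close>

lemma integral_solid_harm_R2:
  assumes b: "0 < b" "b < pi" and k: "\<bar>k\<bar> \<le> int n"
  shows "(LINT x|sphereM. solid_harm n k (R2 (-b) *v x)) = (LINT x|sphereM. solid_harm n k x)"
proof (cases "n = 0")
  case True
  then show ?thesis by (simp add: solid_harm_def)
next
  case False
  have "(LINT x|sphereM. solid_harm n k (R2 (-b) *v x))
    = (\<Sum>j=-int n..int n. of_real (wigner_d n j k (cos b)) * (LINT x|sphereM. solid_harm n j x))"
    unfolding solid_harm_R2[OF b k] by (simp add: integrable_solid_harm)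
  also have "\<dots> = 0"
    using False by (intro sum.neutral) (auto simp: integral_solid_harm)
  finally show ?thesis using integral_solid_harm[of n k] False k by simp
qed

lemma integral_polynomial_R2:
  assumes b: "0 < b" "b < pi" and g: "real_polynomial_function (g :: real^3 \<Rightarrow> real)"
  shows "(LINT x|sphereM. g (R2 (-b) *v x)) = (LINT x|sphereM. g x)"
proof -
  obtain N c where Nc: "\<And>x. norm x = 1 \<Longrightarrow> x $ 1 \<noteq> 0 \<or> x $ 2 \<noteq> 0 \<Longrightarrow>
    of_real (g x) = (\<Sum>n<N. \<Sum>k=-int n..int n. c n k * solid_harm n k x)"
    using polynomial_eq_solid_harm[OF g] by blast
  have [measurable]: "g \<in> borel_measurable borel" using g by (rule borel_measurable_real_polynomial)
  have int: "integrable sphereM (\<lambda>x. solid_harm n k (R2 b' *v x))" for n k b'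
  proof -
    obtain B where "\<And>x. norm x = 1 \<Longrightarrow> norm (solid_harm n k x) \<le> B"
      using solid_harm_bounded by blast
    then show ?thesis
      using AE_sphereM_norm by (intro sphere.integrable_const_bound[where B = B]) (auto simp: norm_R2)
  qed
  \<comment> \<open>The angle is left free because the expansion is used twice, for - b and for 0,
    where \<open>R2 0\<close> is the identity.\<close>
  have *: "complex_of_real (LINT x|sphereM. g (R2 b' *v x))
    = (\<Sum>n<N. \<Sum>k=-int n..int n. c n k * (LINT x|sphereM. solid_harm n k (R2 b' *v x)))" for b'
  proof -
    have "complex_of_real (LINT x|sphereM. g (R2 b' *v x)) = (LINT x|sphereM. of_real (g (R2 b' *v x)))"
      by simp
    also have "\<dots> = (LINT x|sphereM. (\<Sum>n<N. \<Sum>k=-int n..int n. c n k * solid_harm n k (R2 b' *v x)))"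
    proof (rule integral_cong_AE)
      show "AE x in sphereM. complex_of_real (g (R2 b' *v x)) = (\<Sum>n<N. \<Sum>k=-int n..int n. c n k * solid_harm n k (R2 b' *v x))"
        using AE_sphereM_norm AE_sphereM_R2[of b']
        by eventually_elim (use Nc norm_R2 in auto)
    qed measurable
    also have "\<dots> = (\<Sum>n<N. \<Sum>k=-int n..int n. c n k * (LINT x|sphereM. solid_harm n k (R2 b' *v x)))"
      by (simp add: int)
    finally show ?thesis .
  qed
  have "R2 0 *v x = x" for x
    by (simp add: vec_eq_iff forall_3 R2_mult_vec)
  moreover have "complex_of_real (LINT x|sphereM. g (R2 (-b) *v x)) = complex_of_real (LINT x|sphereM. g (R2 0 *v x))"
    unfolding * using integral_solid_harm_R2[OF b] calculation
    by (intro sum.cong refl arg_cong2[of _ _ _ _ "(*)"]) auto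
  ultimately have "complex_of_real (LINT x|sphereM. g (R2 (-b) *v x)) = complex_of_real (LINT x|sphereM. g x)"
    by simp
  then show ?thesis by simp
qed

text \<open>Polynomials approximate a continuous function uniformly on the sphere. Rotations
  preserve the sphere, so the same bound holds for the rotated functions, and invariance passes from
  polynomials to continuous functions and on to the measure.\<close>

lemma sphereM_R2:
  assumes b: "0 < b" "b < pi"
  shows "distr sphereM borel (\<lambda>x. R2 (-b) *v x) = sphereM"
proof (rule finite_measure_eqI_continuous)
  fix f :: "real^3 \<Rightarrow> real"
  assume f: "continuous_on UNIV f" "\<And>x. 0 \<le> f x \<and> f x \<le> 1"
  have [measurable]: "f \<in> borel_measurable borel" using f(1) by (rule borel_measurable_continuous_onI)
  define m where "m = measure sphereM UNIV"
  have "\<bar>(LINT x|sphereM. f (R2 (-b) *v x)) - (LINT x|sphereM. f x)\<bar> \<le> e" if "e > 0" for e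
  proof -
    \<comment> \<open>The error arises twice, for the rotated and for the original integral, each
      time at most \<open>d\<close> times the total mass.\<close>
    define d where "d = e / (2 * (m + 1))"
    have m: "m + 1 > 0" by (simp add: m_def add_nonneg_pos)
    have d: "d > 0" using that m by (simp add: d_def)
    obtain g where g: "real_polynomial_function g" "\<And>x. x \<in> sphere 0 1 \<Longrightarrow> \<bar>f x - g x\<bar> < d"
      using Stone_Weierstrass_real_polynomial_function[OF compact_sphere continuous_on_subset[OF f(1)] d] by blast
    have [measurable]: "g \<in> borel_measurable borel" using g(1) by (rule borel_measurable_real_polynomial)
    have fi: "integrable sphereM (\<lambda>x. f (R2 b' *v x))" for b'
      using f(2) by (intro sphere.integrable_const_bound[where B = 1]) auto
    have gi: "integrable sphereM (\<lambda>x. g (R2 b' *v x))" for b'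
    proof (rule sphere.integrable_const_bound)
      show "AE x in sphereM. norm (g (R2 b' *v x)) \<le> 1 + d"
        using AE_sphereM_norm
      proof eventually_elim
        case (elim x)
        then show ?case using g(2)[of "R2 b' *v x"] f(2)[of "R2 b' *v x"] by (auto simp: norm_R2)
      qed
    qed measurable
    have close: "\<bar>(LINT x|sphereM. f (R2 b' *v x)) - (LINT x|sphereM. g (R2 b' *v x))\<bar> \<le> d * m" for b'
    proof -
      have "\<bar>LINT x|sphereM. f (R2 b' *v x) - g (R2 b' *v x)\<bar> \<le> (LINT x|sphereM. \<bar>f (R2 b' *v x) - g (R2 b' *v x)\<bar>)"
        using integral_norm_bound[of sphereM "\<lambda>x. f (R2 b' *v x) - g (R2 b' *v x)"] by simp
      also have "\<dots> \<le> (LINT x|sphereM. d)"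
      proof (rule integral_mono_AE)
        show "AE x in sphereM. \<bar>f (R2 b' *v x) - g (R2 b' *v x)\<bar> \<le> d"
          using AE_sphereM_norm
        proof eventually_elim
          case (elim x)
          then show ?case using g(2)[of "R2 b' *v x"] by (auto simp: norm_R2)
        qed
      qed (use fi gi in auto)
      finally show ?thesis using fi gi by (simp add: m_def mult.commute)
    qed
    have "R2 0 *v x = x" for x
      by (simp add: vec_eq_iff forall_3 R2_mult_vec)
    then have "\<bar>(LINT x|sphereM. f (R2 (-b) *v x)) - (LINT x|sphereM. f x)\<bar> \<le> 2 * (d * m)"
      using close[of "-b"] close[of 0] integral_polynomial_R2[OF b g(1)] by simp
    also have "\<dots> \<le> e" using m that by (simp add: d_def field_simps m_def)
    finally show ?thesis .
  qed
  then have "(LINT x|sphereM. f (R2 (-b) *v x)) = (LINT x|sphereM. f x)"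
    by (metis abs_le_zero_iff dense_ge eq_iff_diff_eq_0)
  then show "(LINT x|distr sphereM borel (\<lambda>x. R2 (-b) *v x). f x) = (LINT x|sphereM. f x)"
    by (simp add: integral_distr)
qed (auto intro!: sphere.finite_measure_distr sphere.finite_measure_axioms)

section \<open>Left invariance of the measure on SO(3)\<close>

lemma R3_add: "R3 s ** R3 t = R3 (s + t)"
  by (simp add: R3_def vec_eq_iff forall_3 matrix_matrix_mult_def sum_3 cos_add sin_add algebra_simps)

lemma transpose_R3: "transpose (R3 a) = R3 (- a)"
  by (simp add: R3_def vec_eq_iff forall_3 transpose_def)

lemma transpose_R2: "transpose (R2 b) = R2 (- b)"
  by (simp add: R2_def vec_eq_iff forall_3 transpose_def)

lemma rotation_R3: "rotation_matrix (R3 a)"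
proof -
  have "R3 (- a) ** R3 a = mat 1"
    unfolding R3_add by (simp add: R3_def vec_eq_iff forall_3 mat_def)
  then show ?thesis
    using sin_cos_squared_add[of a] unfolding rotation_matrix_def orthogonal_matrix transpose_R3
    by (simp add: R3_def det_3 power2_eq_square)
qed

lemma rotation_R2: "rotation_matrix (R2 b)"
  using sin_cos_squared_add[of b] unfolding rotation_matrix_def orthogonal_matrix transpose_R2
  by (simp add: R2_def det_3 power2_eq_square vec_eq_iff forall_3 matrix_matrix_mult_def sum_3 mat_def)

lemma rotation_matrix_mult:
  fixes A B :: "real^'n^'n"
  assumes "rotation_matrix A" "rotation_matrix B"
  shows "rotation_matrix (A ** B)"
  using assms by (simp add: rotation_matrix_def orthogonal_matrix_mul det_mul)

lemma rotation_matrix_transpose: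
  fixes A :: "real^'n^'n"
  assumes "rotation_matrix A"
  shows "rotation_matrix (transpose A)"
  using assms by (simp add: rotation_matrix_def orthogonal_matrix_def)

text \<open>The quotient \<open>transpose M ** N\<close> is a rotation fixing the third axis, hence
  a plane rotation in the other two coordinates.\<close>

lemma rotation_matrix_same_axis:
  fixes M N :: "real^3^3"
  assumes M: "rotation_matrix M" and N: "rotation_matrix N" and e: "M *v axis 3 1 = N *v axis 3 1"
  obtains t where "N = M ** R3 t" "0 \<le> t" "t < 2 * pi"
proof -
  define P where "P = transpose M ** N"
  have MP: "N = M ** P"
    using M by (simp add: P_def matrix_mul_assoc rotation_matrix_def orthogonal_matrix_def)
  have P: "rotation_matrix P"
    unfolding P_def by (intro rotation_matrix_mult rotation_matrix_transpose M N)
  have "P *v axis 3 1 = transpose M *v (M *v axis 3 1)"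
    by (simp add: P_def e matrix_vector_mul_assoc[symmetric])
  also have "\<dots> = axis 3 1"
    using M by (simp add: matrix_vector_mul_assoc rotation_matrix_def orthogonal_matrix_def)
  finally have col: "P $ 1 $ 3 = 0" "P $ 2 $ 3 = 0" "P $ 3 $ 3 = 1"
    by (simp_all add: vec_eq_iff forall_3 matrix_vector_mult_def sum_3 axis_def)
  have PP: "P ** transpose P = mat 1" and "det P = 1"
    using P by (simp_all add: rotation_matrix_def orthogonal_matrix_def)
  have row: "(P $ 3 $ 1)\<^sup>2 + (P $ 3 $ 2)\<^sup>2 + (P $ 3 $ 3)\<^sup>2 = 1" "(P $ 1 $ 1)\<^sup>2 + (P $ 1 $ 2)\<^sup>2 + (P $ 1 $ 3)\<^sup>2 = 1"
    "(P $ 2 $ 1)\<^sup>2 + (P $ 2 $ 2)\<^sup>2 + (P $ 2 $ 3)\<^sup>2 = 1"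
    using PP by (simp_all add: vec_eq_iff forall_3 matrix_matrix_mult_def sum_3 transpose_def mat_def power2_eq_square)
  have row3: "P $ 3 $ 1 = 0" "P $ 3 $ 2 = 0"
    using row(1) col by (auto simp: sum_power2_eq_zero_iff)
  have "P $ 1 $ 1 * P $ 2 $ 2 - P $ 1 $ 2 * P $ 2 $ 1 = 1"
    using \<open>det P = 1\<close> by (simp add: det_3 col row3)
  moreover have "(P $ 1 $ 1)\<^sup>2 + (P $ 1 $ 2)\<^sup>2 = 1" "(P $ 2 $ 1)\<^sup>2 + (P $ 2 $ 2)\<^sup>2 = 1"
    using row(2,3) by (simp_all add: col)
  \<comment> \<open>Expanded, the sum of squares is the sum of the two squared row lengths minus
    twice the determinant, thus 1 + 1 - 2.\<close>
  ultimately have "(P $ 1 $ 1 - P $ 2 $ 2)\<^sup>2 + (P $ 1 $ 2 + P $ 2 $ 1)\<^sup>2 = 0"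
    by algebra
  then have eq: "P $ 2 $ 2 = P $ 1 $ 1" "P $ 1 $ 2 = - P $ 2 $ 1"
    by (auto simp: sum_power2_eq_zero_iff)
  have "(P $ 1 $ 1)\<^sup>2 + (P $ 2 $ 1)\<^sup>2 = 1" using row(2) unfolding col eq by simp
  then obtain t where t: "0 \<le> t" "t < 2 * pi" "P $ 1 $ 1 = cos t" "P $ 2 $ 1 = sin t"
    using sincos_total_2pi by metis
  then have "P = R3 t"
    by (simp add: vec_eq_iff forall_3 R3_def col row3 eq)
  then show thesis using that MP t by blast
qed

text \<open>A section of M |-> M e3: the third column is \<open>x\<close>. Off the poles it is
  \<open>R3 a ** R2 b\<close> at \<open>sph a b\<close>, written in Cartesian coordinates so that
  measurability requires no choice of angles. On the third axis, where r = 0, the value is no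
  rotation; this set is null.\<close>

definition coset_rep :: "real^3 \<Rightarrow> real^3^3" where
  "coset_rep x = (let r = sqrt ((x$1)\<^sup>2 + (x$2)\<^sup>2) in
     vector [vector [x$1 * x$3 / r, - x$2 / r, x$1], vector [x$2 * x$3 / r, x$1 / r, x$2], vector [- r, 0, x$3]])"

lemma coset_rep_sph:
  assumes "0 < b" "b < pi"
  shows "coset_rep (sph a b) = R3 a ** R2 b"
proof -
  have s: "sin b > 0" using assms by (intro sin_gt_zero)
  have "(cos a * sin b)\<^sup>2 + (sin a * sin b)\<^sup>2 = (sin b)\<^sup>2"
    using sin_cos_squared_add[of a] by algebra
  then have "sqrt ((sph a b $ 1)\<^sup>2 + (sph a b $ 2)\<^sup>2) = sin b"
    using s by simp
  then show ?thesis
    unfolding coset_rep_def Let_def using s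
    by (simp add: R3_def R2_def vec_eq_iff forall_3 matrix_matrix_mult_def sum_3)
qed

text \<open>Both matrices send the third axis to \<open>R2 b *v x\<close>, so they differ by a
  rotation about that axis on the right. The angle t depends on \<open>x\<close>.\<close>

lemma R2_coset_rep:
  assumes "norm x = 1" "x $ 1 \<noteq> 0 \<or> x $ 2 \<noteq> 0" "(R2 b *v x) $ 1 \<noteq> 0 \<or> (R2 b *v x) $ 2 \<noteq> 0"
  obtains t where "R2 b ** coset_rep x = coset_rep (R2 b *v x) ** R3 t" "0 \<le> t" "t < 2 * pi"
proof -
  have rep: "rotation_matrix (coset_rep y) \<and> coset_rep y *v axis 3 1 = y" if y: "norm y = 1" "y $ 1 \<noteq> 0 \<or> y $ 2 \<noteq> 0" for y
  proof -
    obtain a b where b: "0 < b" "b < pi" "y = sph a b" using sphere_eq_sph[OF y] .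
    show ?thesis
      unfolding b(3) coset_rep_sph[OF b(1,2)]
      by (simp add: rotation_matrix_mult rotation_R2 rotation_R3)
        (simp add: vec_eq_iff forall_3 matrix_matrix_mult_def R2_def R3_def matrix_vector_mult_def sum_3 axis_def)
  qed
  have "rotation_matrix (R2 b ** coset_rep x)"
    using rep[OF assms(1,2)] by (intro rotation_matrix_mult rotation_R2) auto
  moreover have "norm (R2 b *v x) = 1" using assms(1) by (simp add: norm_R2)
  note r = rep[OF this assms(3)]
  moreover have "(R2 b ** coset_rep x) *v axis 3 1 = R2 b *v x"
    using rep[OF assms(1,2)] by (simp add: matrix_vector_mul_assoc[symmetric])
  ultimately show thesis
    using rotation_matrix_same_axis[of "coset_rep (R2 b *v x)" "R2 b ** coset_rep x"] that by metis
qed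

lemma borel_measurable_matrix_mult [measurable (raw)]:
  fixes f g :: "'a \<Rightarrow> real^3^3"
  assumes [measurable]: "f \<in> borel_measurable M" "g \<in> borel_measurable M"
  shows "(\<lambda>x. f x ** g x) \<in> borel_measurable M"
proof (intro borel_measurable_vecI)
  fix i j :: 3
  show "(\<lambda>x. (f x ** g x) $ i $ j) \<in> borel_measurable M"
    unfolding matrix_matrix_mult_def by simp
qed

lemma borel_measurable_transpose [measurable (raw)]:
  fixes f :: "'a \<Rightarrow> real^3^3"
  assumes [measurable]: "f \<in> borel_measurable M"
  shows "(\<lambda>x. transpose (f x)) \<in> borel_measurable M"
proof (intro borel_measurable_vecI)
  fix i j :: 3
  show "(\<lambda>x. transpose (f x) $ i $ j) \<in> borel_measurable M"
    unfolding transpose_def by simp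
qed

lemma borel_measurable_R3 [measurable (raw)]:
  assumes [measurable]: "f \<in> borel_measurable M"
  shows "(\<lambda>x. R3 (f x)) \<in> borel_measurable M"
  unfolding R3_def by measurable

lemma borel_measurable_R2 [measurable (raw)]:
  assumes [measurable]: "f \<in> borel_measurable M"
  shows "(\<lambda>x. R2 (f x)) \<in> borel_measurable M"
  unfolding R2_def by measurable

lemma borel_measurable_coset_rep [measurable]: "coset_rep \<in> borel_measurable borel"
  unfolding coset_rep_def[abs_def] Let_def by measurable

lemma nn_integral_circ_half_open:
  assumes [measurable]: "h \<in> borel_measurable borel"
  shows "integral\<^sup>N circM h = (\<integral>\<^sup>+ a. h a * indicator {0..<2*pi} a \<partial>lborel)"
proof -
  have "integral\<^sup>N circM h = (\<integral>\<^sup>+ a. indicator {0..2*pi} a * h a \<partial>lborel)"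
    unfolding circM_def by (subst nn_integral_density) auto
  also have "\<dots> = (\<integral>\<^sup>+ a. h a * indicator {0..<2*pi} a \<partial>lborel)"
  proof (rule nn_integral_cong_AE)
    show "AE a in lborel. indicator {0..2*pi} a * h a = h a * indicator {0..<2*pi} a"
      using AE_lborel_singleton[of "2*pi"] by eventually_elim (auto simp: indicator_def)
  qed
  finally show ?thesis .
qed

text \<open>With \<open>t\<close> inside one period, the shifted interval leaves [0, 2 \<pi>) in a
  single piece, which periodicity moves back to [0, t).\<close>

lemma nn_integral_circ_shift:
  fixes h :: "real \<Rightarrow> ennreal"
  assumes [measurable]: "h \<in> borel_measurable borel" and per: "\<And>x. h (x + 2 * pi) = h x"
    and t: "0 \<le> t" "t < 2 * pi"
  shows "(\<integral>\<^sup>+ a. h (t + a) \<partial>circM) = integral\<^sup>N circM h"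
proof -
  have "(\<integral>\<^sup>+ a. h (t + a) \<partial>circM) = (\<integral>\<^sup>+ a. h (t + a) * indicator {t..<t+2*pi} (t + 1 * a) \<partial>lborel)"
    by (subst nn_integral_circ_half_open) (auto intro!: nn_integral_cong simp: indicator_def)
  also have "\<dots> = (\<integral>\<^sup>+ a. h a * indicator {t..<t+2*pi} a \<partial>lborel)"
    using nn_integral_real_affine[of "\<lambda>a. h a * indicator {t..<t+2*pi} a" 1 t] by simp
  also have "\<dots> = (\<integral>\<^sup>+ a. h a * indicator {t..<2*pi} a + h a * indicator {2*pi..<t+2*pi} a \<partial>lborel)"
    using t by (intro nn_integral_cong) (auto simp: indicator_def)
  also have "\<dots> = (\<integral>\<^sup>+ a. h a * indicator {t..<2*pi} a \<partial>lborel) + (\<integral>\<^sup>+ a. h a * indicator {2*pi..<t+2*pi} a \<partial>lborel)"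
    by (intro nn_integral_add) auto
  also have "(\<integral>\<^sup>+ a. h a * indicator {2*pi..<t+2*pi} a \<partial>lborel) = (\<integral>\<^sup>+ a. h (2*pi + 1 * a) * indicator {2*pi..<t+2*pi} (2*pi + 1 * a) \<partial>lborel)"
    using nn_integral_real_affine[of "\<lambda>a. h a * indicator {2*pi..<t+2*pi} a" 1 "2*pi"] by simp
  also have "\<dots> = (\<integral>\<^sup>+ a. h a * indicator {0..<t} a \<partial>lborel)"
    using per by (intro nn_integral_cong) (auto simp: indicator_def add.commute)
  also have "(\<integral>\<^sup>+ a. h a * indicator {t..<2*pi} a \<partial>lborel) + \<dots> = (\<integral>\<^sup>+ a. h a * indicator {t..<2*pi} a + h a * indicator {0..<t} a \<partial>lborel)"
    by (intro nn_integral_add[symmetric]) auto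
  also have "\<dots> = (\<integral>\<^sup>+ a. h a * indicator {0..<2*pi} a \<partial>lborel)"
    using t by (intro nn_integral_cong) (auto simp: indicator_def)
  also have "\<dots> = integral\<^sup>N circM h"
    by (rule nn_integral_circ_half_open[symmetric]) simp
  finally show ?thesis .
qed

lemma nn_integral_circ_reflect:
  fixes h :: "real \<Rightarrow> ennreal"
  assumes [measurable]: "h \<in> borel_measurable borel" and per: "\<And>x. h (x + 2 * pi) = h x"
  shows "(\<integral>\<^sup>+ a. h (- a) \<partial>circM) = integral\<^sup>N circM h"
proof -
  have "integral\<^sup>N circM h = (\<integral>\<^sup>+ a. indicator {0..2*pi} a * h a \<partial>lborel)"
    unfolding circM_def by (subst nn_integral_density) auto
  also have "\<dots> = (\<integral>\<^sup>+ a. indicator {0..2*pi} (2*pi + (-1) * a) * h (2*pi + (-1) * a) \<partial>lborel)"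
    using nn_integral_real_affine[of "\<lambda>a. indicator {0..2*pi} a * h a" "-1" "2*pi"] by simp
  also have "\<dots> = (\<integral>\<^sup>+ a. indicator {0..2*pi} a * h (- a) \<partial>lborel)"
    using per[of "- a" for a] by (intro nn_integral_cong) (auto simp: indicator_def add.commute)
  also have "\<dots> = (\<integral>\<^sup>+ a. h (- a) \<partial>circM)"
    unfolding circM_def by (subst nn_integral_density) auto
  finally show ?thesis by simp
qed

section \<open>The measure on SO(3) as a measure on matrices\<close>

definition haarM :: "(real^3^3) measure" where
  "haarM = distr SO3_measure borel (\<lambda>(a, b, c). euler_rot a b c)"

lemma borel_measurable_euler_rot [measurable]: "(\<lambda>(a, b, c). euler_rot a b c) \<in> borel_measurable (borel \<Otimes>\<^sub>M borel \<Otimes>\<^sub>M borel)"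
  unfolding euler_rot_def by measurable

lemma sets_haarM [measurable_cong, simp]: "sets haarM = sets borel"
  and space_haarM [simp]: "space haarM = UNIV"
  by (simp_all add: haarM_def)

interpretation haar: finite_measure haarM
  unfolding haarM_def by (intro SO3.finite_measure_distr) measurable

lemma nn_integral_haar_iterated:
  assumes [measurable]: "h \<in> borel_measurable borel"
  shows "integral\<^sup>N haarM h
    = (\<integral>\<^sup>+ a. \<integral>\<^sup>+ b. \<integral>\<^sup>+ c. h (R3 a ** R2 b ** R3 c) \<partial>circM \<partial>polarM \<partial>circM)"
proof -
  have sf: "sigma_finite_measure (polarM \<Otimes>\<^sub>M circM)" ..
  have "integral\<^sup>N haarM h = (\<integral>\<^sup>+ q. h (case q of (a, b, c) \<Rightarrow> euler_rot a b c) \<partial>SO3_measure)"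
    unfolding haarM_def by (subst nn_integral_distr) auto
  also have "\<dots> = (\<integral>\<^sup>+ a. \<integral>\<^sup>+ q. h (case (a, q) of (a, b, c) \<Rightarrow> euler_rot a b c) \<partial>(polarM \<Otimes>\<^sub>M circM) \<partial>circM)"
    unfolding SO3_measure_eq_pair by (intro sigma_finite_measure.nn_integral_fst[OF sf, symmetric]) measurable
  also have "\<dots> = (\<integral>\<^sup>+ a. \<integral>\<^sup>+ b. \<integral>\<^sup>+ c. h (case (a, b, c) of (a, b, c) \<Rightarrow> euler_rot a b c) \<partial>circM \<partial>polarM \<partial>circM)"
    by (intro nn_integral_cong circ.nn_integral_fst[symmetric]) measurable
  finally show ?thesis by (simp add: euler_rot_def)
qed

text \<open>A disintegration: the first two Euler angles are a point of the sphere and the third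
  runs through the fibre. Only in this form can invariance of the surface measure be brought
  in.\<close>

lemma nn_integral_haar_coset:
  assumes [measurable]: "h \<in> borel_measurable borel"
  shows "integral\<^sup>N haarM h = (\<integral>\<^sup>+ x. \<integral>\<^sup>+ c. h (coset_rep x ** R3 c) \<partial>circM \<partial>sphereM)"
proof -
  have "(\<integral>\<^sup>+ x. \<integral>\<^sup>+ c. h (coset_rep x ** R3 c) \<partial>circM \<partial>sphereM)
    = (\<integral>\<^sup>+ p. \<integral>\<^sup>+ c. h (coset_rep (sph (fst p) (snd p)) ** R3 c) \<partial>circM \<partial>S2_measure)"
    unfolding sphereM_def by (subst nn_integral_distr) measurable
  also have "\<dots> = (\<integral>\<^sup>+ p. \<integral>\<^sup>+ c. h (R3 (fst p) ** R2 (snd p) ** R3 c) \<partial>circM \<partial>S2_measure)"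
    by (rule nn_integral_cong_AE) (use AE_S2_measure in eventually_elim, simp add: coset_rep_sph)
  also have "\<dots> = (\<integral>\<^sup>+ a. \<integral>\<^sup>+ b. \<integral>\<^sup>+ c. h (R3 a ** R2 b ** R3 c) \<partial>circM \<partial>polarM \<partial>circM)"
  proof -
    have "(\<lambda>p. \<integral>\<^sup>+ c. h (R3 (fst p) ** R2 (snd p) ** R3 c) \<partial>circM) \<in> borel_measurable (circM \<Otimes>\<^sub>M polarM)"
      by measurable
    from polar.nn_integral_fst[OF this] show ?thesis
      unfolding S2_measure_eq_pair by simp
  qed
  finally show ?thesis unfolding nn_integral_haar_iterated[OF assms] by simp
qed

lemma R3_periodic: "R3 (a + 2 * pi) = R3 a"
  by (simp add: R3_def)

text \<open>Left multiplication rotates the base point and shifts the fibre by an angle depending on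
  this point. The inner integral does not feel the shift, and the outer one is invariant under the
  rotation.\<close>

lemma nn_integral_haar_R2:
  assumes b: "0 < b" "b < pi" and [measurable]: "h \<in> borel_measurable borel"
  shows "(\<integral>\<^sup>+ M. h (R2 (-b) ** M) \<partial>haarM) = integral\<^sup>N haarM h"
proof -
  define K where "K x = (\<integral>\<^sup>+ c. h (coset_rep x ** R3 c) \<partial>circM)" for x
  have [measurable]: "K \<in> borel_measurable borel" unfolding K_def by measurable
  have "(\<integral>\<^sup>+ M. h (R2 (-b) ** M) \<partial>haarM)
    = (\<integral>\<^sup>+ x. \<integral>\<^sup>+ c. h (R2 (-b) ** (coset_rep x ** R3 c)) \<partial>circM \<partial>sphereM)"
    by (rule nn_integral_haar_coset) measurable
  also have "\<dots> = (\<integral>\<^sup>+ x. K (R2 (-b) *v x) \<partial>sphereM)"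
  proof (rule nn_integral_cong_AE)
    have "AE x in sphereM. x $ 1 \<noteq> 0 \<or> x $ 2 \<noteq> 0"
      using AE_sphereM_R2[of 0] by (simp add: R2_mult_vec)
    then show "AE x in sphereM. (\<integral>\<^sup>+ c. h (R2 (-b) ** (coset_rep x ** R3 c)) \<partial>circM) = K (R2 (-b) *v x)"
      using AE_sphereM_norm AE_sphereM_R2[of "-b"]
    proof eventually_elim
      case (elim x)
      then obtain t where t: "R2 (-b) ** coset_rep x = coset_rep (R2 (-b) *v x) ** R3 t" "0 \<le> t" "t < 2 * pi"
        using R2_coset_rep by blast
      have "(\<integral>\<^sup>+ c. h (R2 (-b) ** (coset_rep x ** R3 c)) \<partial>circM)
        = (\<integral>\<^sup>+ c. h (coset_rep (R2 (-b) *v x) ** R3 (t + c)) \<partial>circM)"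
        by (simp add: matrix_mul_assoc t(1) R3_add[symmetric])
      also have "\<dots> = K (R2 (-b) *v x)"
        unfolding K_def by (rule nn_integral_circ_shift) (use t R3_periodic in auto)
      finally show ?case .
    qed
  qed
  also have "\<dots> = (\<integral>\<^sup>+ x. K x \<partial>distr sphereM borel (\<lambda>x. R2 (-b) *v x))"
    by (subst nn_integral_distr) auto
  also have "\<dots> = integral\<^sup>N haarM h"
    unfolding sphereM_R2[OF b] K_def by (rule nn_integral_haar_coset[symmetric]) simp
  finally show ?thesis .
qed

lemma nn_integral_haar_R3:
  assumes [measurable]: "h \<in> borel_measurable borel"
  shows "(\<integral>\<^sup>+ M. h (R3 s ** M) \<partial>haarM) = integral\<^sup>N haarM h"
proof -
  \<comment> \<open>The angle is first reduced to one period, as the shift lemma requires.\<close>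
  have "(cos s)\<^sup>2 + (sin s)\<^sup>2 = 1" by simp
  then obtain t where t: "0 \<le> t" "t < 2 * pi" "cos s = cos t" "sin s = sin t"
    using sincos_total_2pi by metis
  then have st: "R3 s = R3 t" by (simp add: R3_def)
  define H where "H a = (\<integral>\<^sup>+ b. \<integral>\<^sup>+ c. h (R3 a ** R2 b ** R3 c) \<partial>circM \<partial>polarM)" for a
  have [measurable]: "H \<in> borel_measurable borel" unfolding H_def by measurable
  have "(\<integral>\<^sup>+ M. h (R3 s ** M) \<partial>haarM) = (\<integral>\<^sup>+ a. H (t + a) \<partial>circM)"
    unfolding H_def st by (subst nn_integral_haar_iterated) (simp_all add: matrix_mul_assoc R3_add)
  also have "\<dots> = integral\<^sup>N circM H"
    by (rule nn_integral_circ_shift) (use t in \<open>auto simp: H_def R3_periodic\<close>)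
  also have "\<dots> = integral\<^sup>N haarM h"
    unfolding H_def by (rule nn_integral_haar_iterated[symmetric]) simp
  finally show ?thesis .
qed

lemma distr_haar_eqI:
  assumes [measurable]: "T \<in> borel_measurable borel"
    and *: "\<And>h. h \<in> borel_measurable borel \<Longrightarrow> (\<integral>\<^sup>+ M. h (T M) \<partial>haarM) = integral\<^sup>N haarM h"
  shows "distr haarM borel T = haarM"
proof (rule measure_eqI)
  fix A assume "A \<in> sets (distr haarM borel T)"
  then have [measurable]: "A \<in> sets borel" by simp
  have "emeasure (distr haarM borel T) A = (\<integral>\<^sup>+ M. indicator A M \<partial>distr haarM borel T)" by simp
  also have "\<dots> = (\<integral>\<^sup>+ M. indicator A (T M) \<partial>haarM)" by (subst nn_integral_distr) auto
  also have "\<dots> = emeasure haarM A" by (subst *) auto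
  finally show "emeasure (distr haarM borel T) A = emeasure haarM A" .
qed simp

lemma haarM_R2:
  assumes "0 < b" "b < pi"
  shows "distr haarM borel (\<lambda>M. R2 (-b) ** M) = haarM"
  by (rule distr_haar_eqI) (use nn_integral_haar_R2[OF assms] in auto)

lemma haarM_R3: "distr haarM borel (\<lambda>M. R3 s ** M) = haarM"
  by (rule distr_haar_eqI) (use nn_integral_haar_R3 in auto)

lemma euler_rot_row_3: "transpose (R3 a ** R2 b ** R3 c) *v axis 3 1 = sph (pi + - c) b"
  by (simp add: matrix_transpose_mul transpose_R2 transpose_R3)
     (simp add: vec_eq_iff forall_3 matrix_matrix_mult_def R2_def R3_def matrix_vector_mult_def sum_3 axis_def cos_add sin_add)

text \<open>The third row depends on the polar angle and on \<pi> - c alone. The factor 2 \<pi> is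
  the mass of the free first angle, and the reflection and shift of c preserve the circle
  measure.\<close>

lemma distr_haar_row_3: "distr haarM borel (\<lambda>M. transpose M *v axis 3 1) = density sphereM (\<lambda>_. ennreal (2 * pi))"
  (is "?D = _")
proof (rule measure_eqI)
  fix A assume "A \<in> sets (?D)"
  then have [measurable]: "A \<in> sets borel" by simp
  define h :: "real^3 \<Rightarrow> ennreal" where "h = indicator A"
  have [measurable]: "h \<in> borel_measurable borel" by (simp add: h_def)
  have "emeasure (?D) A = (\<integral>\<^sup>+ x. h x \<partial>?D)"
    by (simp add: h_def)
  also have "\<dots> = (\<integral>\<^sup>+ M. h (transpose M *v axis 3 1) \<partial>haarM)"
    by (rule nn_integral_distr) measurable
  also have "\<dots> = (\<integral>\<^sup>+ a. \<integral>\<^sup>+ b. \<integral>\<^sup>+ c. h (transpose (R3 a ** R2 b ** R3 c) *v axis 3 1) \<partial>circM \<partial>polarM \<partial>circM)"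
    by (rule nn_integral_haar_iterated) measurable
  also have "\<dots> = (\<integral>\<^sup>+ a. \<integral>\<^sup>+ b. \<integral>\<^sup>+ c. h (sph (pi + - c) b) \<partial>circM \<partial>polarM \<partial>circM)"
    by (simp only: euler_rot_row_3)
  also have "\<dots> = (\<integral>\<^sup>+ a. \<integral>\<^sup>+ b. \<integral>\<^sup>+ c. h (sph c b) \<partial>circM \<partial>polarM \<partial>circM)"
  proof (rule nn_integral_cong, rule nn_integral_cong)
    fix b
    have [measurable]: "(\<lambda>c. h (sph c b)) \<in> borel_measurable borel" unfolding sph_def by measurable
    have per: "sph (c + 2 * pi) b = sph c b" for c by (simp add: sph_def)
    have per': "sph (pi + (c + 2 * pi)) b = sph (pi + c) b" for c
      using per[of "pi + c"] by (simp only: add.assoc)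
    have "(\<lambda>c. h (sph (pi + c) b)) \<in> borel_measurable borel" unfolding sph_def by measurable
    then have "(\<integral>\<^sup>+ c. h (sph (pi + - c) b) \<partial>circM) = (\<integral>\<^sup>+ c. h (sph (pi + c) b) \<partial>circM)"
      by (rule nn_integral_circ_reflect) (simp only: per')
    also have "\<dots> = (\<integral>\<^sup>+ c. h (sph c b) \<partial>circM)"
      by (rule nn_integral_circ_shift[of "\<lambda>c. h (sph c b)"]) (auto simp: per)
    finally show "(\<integral>\<^sup>+ c. h (sph (pi + - c) b) \<partial>circM) = (\<integral>\<^sup>+ c. h (sph c b) \<partial>circM)" .
  qed
  also have "\<dots> = ennreal (2 * pi) * (\<integral>\<^sup>+ b. \<integral>\<^sup>+ c. h (sph c b) \<partial>circM \<partial>polarM)"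
    by (simp add: circM_def emeasure_density mult.commute)
  also have "(\<integral>\<^sup>+ b. \<integral>\<^sup>+ c. h (sph c b) \<partial>circM \<partial>polarM) = (\<integral>\<^sup>+ p. h (sph (fst p) (snd p)) \<partial>S2_measure)"
    unfolding S2_measure_eq_pair by (subst circ_polar.nn_integral_snd[symmetric]) auto
  also have "\<dots> = integral\<^sup>N sphereM h"
    unfolding sphereM_def by (subst nn_integral_distr) auto
  also have "ennreal (2 * pi) * \<dots> = emeasure (density sphereM (\<lambda>_. ennreal (2 * pi))) A"
    by (simp add: emeasure_density nn_integral_cmult h_def)
  finally show "emeasure (?D) A = emeasure (density sphereM (\<lambda>_. ennreal (2 * pi))) A" .
qed simp

section \<open>Wigner coefficients of the arc transform\<close>

text \<open>For rotations this is the action of the inverse. The transpose is defined and measurable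
  for every matrix, so no restriction to rotations is carried along.\<close>

definition inv_rot :: "real^3^3 \<Rightarrow> real^3 \<Rightarrow> real^3" where
  "inv_rot M x = transpose M *v x"

lemma borel_measurable_inv_rot [measurable (raw)]:
  assumes [measurable]: "f \<in> borel_measurable M" "g \<in> borel_measurable M"
  shows "(\<lambda>x. inv_rot (f x) (g x)) \<in> borel_measurable M"
  unfolding inv_rot_def by measurable

lemma inv_rot_mult: "inv_rot (A ** B) x = inv_rot B (inv_rot A x)"
  by (simp only: inv_rot_def matrix_transpose_mul matrix_vector_mul_assoc)

lemma inv_rot_R3: "inv_rot (R3 a) x = R3 (- a) *v x"
  by (simp only: inv_rot_def transpose_R3)

lemma inv_rot_R2: "inv_rot (R2 b) x = R2 (- b) *v x"
  by (simp only: inv_rot_def transpose_R2)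

lemma inv_rot_euler: "inv_rot (euler_rot a b c) x = R3 (- c) *v (R2 (- b) *v (R3 (- a) *v x))"
  by (simp only: euler_rot_def inv_rot_mult inv_rot_R3 inv_rot_R2)

lemma norm_R3: "norm (R3 a *v x) = norm x"
proof -
  have "(cos a * x $ 1 - sin a * x $ 2)\<^sup>2 + (sin a * x $ 1 + cos a * x $ 2)\<^sup>2 + (x $ 3)\<^sup>2 = (x $ 1)\<^sup>2 + (x $ 2)\<^sup>2 + (x $ 3)\<^sup>2"
    using sin_cos_squared_add[of a] by algebra
  then show ?thesis by (simp add: norm_vec_def L2_set_def sum_3 R3_mult_vec)
qed

lemma matrix_inv_euler_rot: "matrix_inv (euler_rot a b c) = transpose (euler_rot a b c)"
proof -
  have "rotation_matrix (euler_rot a b c)"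
    unfolding euler_rot_def by (intro rotation_matrix_mult rotation_R3 rotation_R2)
  then have o: "transpose (euler_rot a b c) ** euler_rot a b c = mat 1" "euler_rot a b c ** transpose (euler_rot a b c) = mat 1"
    by (simp_all add: rotation_matrix_def orthogonal_matrix_def)
  show ?thesis
    unfolding matrix_inv_def
  proof (rule some_equality)
    fix B assume B: "euler_rot a b c ** B = mat 1 \<and> B ** euler_rot a b c = mat 1"
    have "B = B ** (euler_rot a b c ** transpose (euler_rot a b c))" by (simp add: o)
    also have "\<dots> = transpose (euler_rot a b c)" using B by (simp add: matrix_mul_assoc)
    finally show "B = transpose (euler_rot a b c)" .
  qed (use o in auto)
qed

lemma e_vec_nth [simp]: "e_vec d $ 1 = cos d" "e_vec d $ 2 = sin d" "e_vec d $ 3 = 0"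
  by (simp_all add: e_vec_def)

lemma e_vec_eq_sph: "e_vec d = sph d (pi / 2)"
  by (simp add: vec_eq_iff forall_3)

lemma borel_measurable_e_vec [measurable]: "e_vec \<in> borel_measurable borel"
  unfolding e_vec_def[abs_def] by measurable

text \<open>The equator after \<open>R2 (- (pi / 2))\<close>: a great circle through the north pole,
  on which d is the angle from the pole.\<close>

definition tilted_circle :: "real \<Rightarrow> real^3" where
  "tilted_circle d = vector [0, sin d, cos d]"

lemma tilted_circle_nth [simp]: "tilted_circle d $ 1 = 0" "tilted_circle d $ 2 = sin d" "tilted_circle d $ 3 = cos d"
  by (simp_all add: tilted_circle_def)

lemma norm_unit_vectors [simp]: "norm (e_vec d) = 1" "norm (tilted_circle d) = 1"
  by (simp_all add: norm_vec_def L2_set_def sum_3)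

lemma inv_rot_special:
  "inv_rot (R3 a) (e_vec a) = axis 1 1" "inv_rot (R3 a) (axis 3 1) = axis 3 1"
  "inv_rot (R2 (- (pi / 2))) (axis 3 1) = axis 1 1" "inv_rot (R2 (- (pi / 2))) (tilted_circle d) = e_vec d"
  "R2 (- (pi / 2)) *v e_vec d = tilted_circle d"
  using sin_cos_squared_add[of a]
  by (simp_all add: inv_rot_R3 inv_rot_R2 vec_eq_iff forall_3 R2_mult_vec R3_mult_vec axis_def power2_eq_square)

text \<open>The cut-off makes products with \<open>harm_bar\<close> integrable over all matrices, not just rotations.\<close>

definition harm_bar :: "nat \<Rightarrow> int \<Rightarrow> real^3 \<Rightarrow> complex" where
  "harm_bar n k x = (if norm x = 1 then solid_harm n k x else 0)"

lemma borel_measurable_harm_bar [measurable]: "harm_bar n k \<in> borel_measurable borel"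
  unfolding harm_bar_def[abs_def] by measurable

lemma harm_bar_bounded:
  obtains B where "\<And>x. norm (harm_bar n k x) \<le> B" "B \<ge> 0"
proof -
  obtain B where B: "\<And>x. norm x = 1 \<Longrightarrow> norm (solid_harm n k x) \<le> B" "B \<ge> 0"
    using solid_harm_bounded by blast
  then have "norm (harm_bar n k x) \<le> B" for x by (simp add: harm_bar_def)
  then show thesis using B(2) by (rule that)
qed

text \<open>Inversion reverses the order of the three factors and negates the angles. The outer
  rotation gives the phase of order k in c, the middle one mixes the orders, and the inner one gives
  the phase of order j in a.\<close>

lemma harm_bar_inv_rot_euler:
  assumes b: "0 < b" "b < pi" and k: "\<bar>k\<bar> \<le> int n" and x: "norm x = 1"
  shows "harm_bar n k (inv_rot (euler_rot a b c) x) = (\<Sum>j=-int n..int n. wigner_D n j k (a, b, c) * solid_harm n j x)"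
proof -
  have "harm_bar n k (inv_rot (euler_rot a b c) x) = solid_harm n k (R3 (- c) *v (R2 (- b) *v (R3 (- a) *v x)))"
    using x by (simp add: harm_bar_def inv_rot_euler norm_R3 norm_R2)
  also have "\<dots> = circ_exp k (- c) *
      (\<Sum>j=-int n..int n. of_real (wigner_d n j k (cos b)) * (circ_exp j (- a) * solid_harm n j x))"
    unfolding solid_harm_R3[OF k] solid_harm_R2[OF b k]
    by (intro arg_cong2[of _ _ _ _ "(*)"] refl sum.cong) (auto simp: solid_harm_R3)
  also have "\<dots> = (\<Sum>j=-int n..int n. wigner_D n j k (a, b, c) * solid_harm n j x)"
    by (simp add: sum_distrib_left wigner_D_def mult_ac)
  finally show ?thesis .
qed

lemma solid_harm_e_vec:
  assumes "\<bar>j\<bar> \<le> int n"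
  shows "solid_harm n j (e_vec d) = of_real (norm_legendre n j 0) * circ_exp j d"
  unfolding e_vec_eq_sph using sph_harm_eq_solid_harm[of "pi/2" j n d] assms by (simp add: sph_harm_def)

lemma measure_circM [simp]: "measure circM UNIV = 2 * pi"
  by (simp add: circM_def measure_def emeasure_density)

lemma norm_exp_i_int [simp]: "norm (circ_exp k a) = 1" "norm (circ_exp_cnj k a) = 1"
  using norm_exp_i_times[of "of_int k * a"] norm_exp_i_times[of "- (of_int k * a)"] by (simp_all add: mult_ac)

lemma integrable_circ_exp: "integrable circM (\<lambda>a. circ_exp k a)"
  by (intro circ.integrable_const_bound[where B = 1]) auto

lemma integral_circ_trig_poly:
  fixes F :: "int \<Rightarrow> complex"
  assumes "finite I" "j \<in> I"
  shows "(LINT d|circM. (\<Sum>i\<in>I. F i * circ_exp i d) * circ_exp_cnj j d) = 2 * pi * F j"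
proof -
  have "(\<Sum>i\<in>I. F i * circ_exp i d) * circ_exp_cnj j d
      = (\<Sum>i\<in>I. F i * circ_exp (i - j) d)" for d
    unfolding sum_distrib_right
  proof (intro sum.cong refl)
    fix i
    have "\<i> * of_int (i - j) * of_real d = \<i> * of_int i * of_real d + - (\<i> * of_int j * of_real d)"
      by (simp add: algebra_simps)
    then show "F i * circ_exp i d * circ_exp_cnj j d = F i * circ_exp (i - j) d"
      by (simp only: exp_add mult.assoc)
  qed
  then have "(LINT d|circM. (\<Sum>i\<in>I. F i * circ_exp i d) * circ_exp_cnj j d)
    = (\<Sum>i\<in>I. F i * (LINT d|circM. circ_exp (i - j) d))"
    by (simp only:) (subst Bochner_Integration.integral_sum; simp add: integrable_circ_exp del: of_int_diff)
  also have "\<dots> = (\<Sum>i\<in>I. if i = j then 2 * pi * F j else 0)"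
    unfolding integral_circ_exp by (intro sum.cong) auto
  finally show ?thesis using assms by (simp add: sum.delta)
qed

text \<open>The Fourier coefficient of a harmonic along the rotated equator. On rotations it is the
  Legendre value at 0 times \<open>wigner_D n j k\<close>, but it is a function of the matrix, to
  which left translations apply.\<close>

definition harm_coeff :: "nat \<Rightarrow> int \<Rightarrow> int \<Rightarrow> real^3^3 \<Rightarrow> complex" where
  "harm_coeff n k j M = (LINT d|circM. harm_bar n k (inv_rot M (e_vec d)) * circ_exp_cnj j d) / (2 * pi)"

lemma borel_measurable_harm_coeff [measurable]: "harm_coeff n k j \<in> borel_measurable borel"
  unfolding harm_coeff_def[abs_def] by measurable

lemma harm_coeff_bounded:
  obtains B where "\<And>M. norm (harm_coeff n k j M) \<le> B" "B \<ge> 0"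
proof -
  obtain B where B: "\<And>x. norm (harm_bar n k x) \<le> B" "B \<ge> 0" using harm_bar_bounded by blast
  have "norm (harm_coeff n k j M) \<le> B" for M
  proof -
    let ?g = "\<lambda>d. harm_bar n k (inv_rot M (e_vec d)) * circ_exp_cnj j d"
    have g: "integrable circM ?g"
      using B by (intro circ.integrable_const_bound[where B = B]) (auto simp: norm_mult)
    have "norm (LINT d|circM. ?g d) \<le> (LINT d|circM. norm (?g d))"
      by (rule integral_norm_bound)
    also have "\<dots> \<le> (LINT d|circM. B)"
    proof (rule integral_mono_AE)
      show "integrable circM (\<lambda>d. norm (?g d))" by (rule integrable_norm[OF g])
    qed (use B(1) in \<open>auto simp: norm_mult\<close>)
    finally have "norm (LINT d|circM. ?g d) \<le> 2 * pi * B" by simp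
    then show ?thesis by (simp add: harm_coeff_def norm_divide field_simps)
  qed
  then show thesis using B(2) by (rule that)
qed

lemma harm_coeff_euler:
  assumes b: "0 < b" "b < pi" and k: "\<bar>k\<bar> \<le> int n" and j: "\<bar>j\<bar> \<le> int n"
  shows "harm_coeff n k j (euler_rot a b c) = of_real (norm_legendre n j 0) * wigner_D n j k (a, b, c)"
proof -
  have "harm_bar n k (inv_rot (euler_rot a b c) (e_vec d)) =
      (\<Sum>i=-int n..int n. (wigner_D n i k (a, b, c) * of_real (norm_legendre n i 0)) * circ_exp i d)" for d
    unfolding harm_bar_inv_rot_euler[OF b k norm_unit_vectors(1)]
    by (intro sum.cong refl) (auto simp: solid_harm_e_vec)
  then have "(LINT d|circM. harm_bar n k (inv_rot (euler_rot a b c) (e_vec d)) * circ_exp_cnj j d)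
    = 2 * pi * (wigner_D n j k (a, b, c) * of_real (norm_legendre n j 0))"
    using j by (simp only:) (rule integral_circ_trig_poly; auto)
  then show ?thesis by (simp add: harm_coeff_def)
qed

lemma harm_coeff_R3:
  assumes b: "0 < b" "b < pi" and k: "\<bar>k\<bar> \<le> int n" and j: "\<bar>j\<bar> \<le> int n"
  shows "harm_coeff n k j (R3 d ** euler_rot a b c) = circ_exp_cnj j d * harm_coeff n k j (euler_rot a b c)"
proof -
  have "R3 d ** euler_rot a b c = euler_rot (d + a) b c"
    by (simp add: euler_rot_def matrix_mul_assoc R3_add)
  moreover have "- \<i> * of_int j * of_real (d + a) = - (\<i> * of_int j * of_real d) + - \<i> * of_int j * of_real a"
    by (simp add: algebra_simps)
  then have "wigner_D n j k (d + a, b, c) = circ_exp_cnj j d * wigner_D n j k (a, b, c)"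
    unfolding wigner_D_def by (simp only: exp_add prod.case mult_ac)
  ultimately show ?thesis
    unfolding harm_coeff_euler[OF b k j] by (simp only: harm_coeff_euler[OF b k j] mult_ac)
qed

lemma AE_SO3_measure: "AE q in SO3_measure. 0 < fst (snd q) \<and> fst (snd q) < pi"
proof -
  have "AE q in SO3_measure. \<not> (fst (snd q) \<le> 0 \<or> pi \<le> fst (snd q))"
    unfolding SO3_measure_def
  proof (subst AE_density)
    show "AE q in lborel. 0 < (case q of (a, b, c) \<Rightarrow> indicator ({0..2*pi} \<times> {0..pi} \<times> {0..2*pi}) (a, b, c) * ennreal (sin b))
      \<longrightarrow> \<not> (fst (snd q) \<le> 0 \<or> pi \<le> fst (snd q))"
    proof (rule AE_I2)
      fix q :: "real \<times> real \<times> real"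
      obtain a b c where "q = (a, b, c)" by (cases q)
      then show "0 < (case q of (a, b, c) \<Rightarrow> indicator ({0..2*pi} \<times> {0..pi} \<times> {0..2*pi}) (a, b, c) * ennreal (sin b))
        \<longrightarrow> \<not> (fst (snd q) \<le> 0 \<or> pi \<le> fst (snd q))"
        using sin_pos_imp_interior[of b] by (auto simp: indicator_def zero_less_mult_iff)
    qed
  qed (simp add: borel_prod[symmetric])
  then show ?thesis by eventually_elim auto
qed

section \<open>Integration over rotations\<close>

lemma integral_haar:
  fixes F :: "real^3^3 \<Rightarrow> complex"
  assumes "F \<in> borel_measurable borel"
  shows "(LINT M|haarM. F M) = (LINT q|SO3_measure. F (case q of (a, b, c) \<Rightarrow> euler_rot a b c))"
  unfolding haarM_def using assms by (intro integral_distr) measurable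

lemma integral_haar_cong:
  fixes F G :: "real^3^3 \<Rightarrow> complex"
  assumes [measurable]: "F \<in> borel_measurable borel" "G \<in> borel_measurable borel"
    and eq: "\<And>a b c. 0 < b \<Longrightarrow> b < pi \<Longrightarrow> F (euler_rot a b c) = G (euler_rot a b c)"
  shows "(LINT M|haarM. F M) = (LINT M|haarM. G M)"
  unfolding integral_haar[OF assms(1)] integral_haar[OF assms(2)]
proof (rule integral_cong_AE)
  show "AE q in SO3_measure. F (case q of (a, b, c) \<Rightarrow> euler_rot a b c) = G (case q of (a, b, c) \<Rightarrow> euler_rot a b c)"
    using AE_SO3_measure by eventually_elim (auto simp: eq)
qed measurable

lemma integral_haar_R3:
  fixes F :: "real^3^3 \<Rightarrow> complex"
  assumes [measurable]: "F \<in> borel_measurable borel"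
  shows "(LINT M|haarM. F (R3 s ** M)) = (LINT M|haarM. F M)"
proof -
  have "(LINT M|haarM. F M) = (LINT M|distr haarM borel (\<lambda>M. R3 s ** M). F M)"
    by (simp add: haarM_R3)
  also have "\<dots> = (LINT M|haarM. F (R3 s ** M))" by (rule integral_distr) measurable
  finally show ?thesis by simp
qed

lemma integral_haar_R2:
  fixes F :: "real^3^3 \<Rightarrow> complex"
  assumes [measurable]: "F \<in> borel_measurable borel" and b: "0 < b" "b < pi"
  shows "(LINT M|haarM. F (R2 (- b) ** M)) = (LINT M|haarM. F M)"
proof -
  have "(LINT M|haarM. F M) = (LINT M|distr haarM borel (\<lambda>M. R2 (- b) ** M). F M)"
    by (simp add: haarM_R2[OF b])
  also have "\<dots> = (LINT M|haarM. F (R2 (- b) ** M))" by (rule integral_distr) measurable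
  finally show ?thesis by simp
qed

lemma integral_haar_row_3:
  fixes F :: "real^3 \<Rightarrow> complex"
  assumes [measurable]: "F \<in> borel_measurable borel"
  shows "(LINT M|haarM. F (inv_rot M (axis 3 1))) = 2 * pi * (LINT x|sphereM. F x)"
proof -
  have "(LINT M|haarM. F (inv_rot M (axis 3 1))) = (LINT x|distr haarM borel (\<lambda>M. transpose M *v axis 3 1). F x)"
    unfolding inv_rot_def by (rule integral_distr[symmetric]) measurable
  also have "\<dots> = (LINT x|sphereM. (2 * pi) *\<^sub>R F x)"
    unfolding distr_haar_row_3 by (rule integral_density) auto
  also have "\<dots> = (2 * pi) *\<^sub>R (LINT x|sphereM. F x)" by (rule integral_scaleR_right)
  finally show ?thesis by (simp add: scaleR_conv_of_real)
qed

text \<open>Left translations by \<open>R3 d\<close> and then \<open>R2 (- (pi / 2))\<close> bring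
  an equatorial point to the pole, so at every such point the law is the same multiple of the
  surface measure.\<close>

lemma nn_integral_haar_row:
  fixes h :: "real^3 \<Rightarrow> ennreal"
  assumes [measurable]: "h \<in> borel_measurable borel"
  shows "(\<integral>\<^sup>+ M. h (inv_rot M (axis 3 1)) \<partial>haarM) = ennreal (2 * pi) * integral\<^sup>N sphereM h" (is "?A = ?R")
    and "(\<integral>\<^sup>+ M. h (inv_rot M (e_vec d)) \<partial>haarM) = ennreal (2 * pi) * integral\<^sup>N sphereM h" (is "?B = _")
proof -
  have "?A = (\<integral>\<^sup>+ x. h x \<partial>distr haarM borel (\<lambda>M. transpose M *v axis 3 1))"
    unfolding inv_rot_def by (rule nn_integral_distr[symmetric]) measurable
  also have "\<dots> = ?R"
    unfolding distr_haar_row_3 by (subst nn_integral_density) (auto simp: nn_integral_cmult)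
  finally show 1: "?A = ?R" .
  have "?B = (\<integral>\<^sup>+ M. h (inv_rot (R3 d ** M) (e_vec d)) \<partial>haarM)"
    by (rule nn_integral_haar_R3[symmetric]) measurable
  also have "\<dots> = (\<integral>\<^sup>+ M. h (inv_rot (R2 (- (pi / 2)) ** M) (axis 3 1)) \<partial>haarM)"
    by (simp only: inv_rot_mult inv_rot_special)
  also have "\<dots> = ?A"
    by (rule nn_integral_haar_R2) auto
  finally show "?B = ?R"
    unfolding 1 .
qed

text \<open>Absolute integrability holds uniformly in t, because the image of each
  \<open>v t\<close> under a random rotation has the law of \<open>nn_integral_haar_row\<close> and
  \<open>Z\<close> is bounded. The outer measure stays general so that it can be the full circle or
  the arc.\<close>

lemma integral_circ_haar_swap:
  fixes f :: "real^3 \<Rightarrow> complex" and Z :: "real \<Rightarrow> real^3^3 \<Rightarrow> complex"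
  assumes C: "finite_measure C" "sets C = sets borel"
    and f: "integrable sphereM f" and v: "v \<in> borel_measurable borel" "\<And>t. v t = axis 3 1 \<or> (\<exists>d. v t = e_vec d)"
    and Z: "case_prod Z \<in> borel_measurable (borel \<Otimes>\<^sub>M borel)" "\<And>t M. norm (Z t M) \<le> B"
  shows "(LINT M|haarM. LINT t|C. f (inv_rot M (v t)) * Z t M) = (LINT t|C. LINT M|haarM. f (inv_rot M (v t)) * Z t M)"
proof -
  interpret C: finite_measure C by (rule C(1))
  interpret CH: pair_sigma_finite C haarM ..
  note [measurable_cong] = C(2)
  have [measurable]: "f \<in> borel_measurable borel" "v \<in> borel_measurable borel" "case_prod Z \<in> borel_measurable (borel \<Otimes>\<^sub>M borel)"
    using f v Z by auto
  have B: "B \<ge> 0" using Z(2) norm_ge_zero order_trans by blast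
  define K where "K = (\<integral>\<^sup>+ x. ennreal (norm (f x)) \<partial>sphereM)"
  have K: "K < \<infinity>" using f unfolding K_def integrable_iff_bounded by simp
  have "integrable (C \<Otimes>\<^sub>M haarM) (\<lambda>(t, M). f (inv_rot M (v t)) * Z t M)"
  proof (rule integrableI_bounded)
    have "(\<integral>\<^sup>+ p. ennreal (norm (case p of (t, M) \<Rightarrow> f (inv_rot M (v t)) * Z t M)) \<partial>(C \<Otimes>\<^sub>M haarM))
      = (\<integral>\<^sup>+ t. \<integral>\<^sup>+ M. ennreal (norm (f (inv_rot M (v t)) * Z t M)) \<partial>haarM \<partial>C)"
      by (subst haar.nn_integral_fst[symmetric]) auto
    also have "\<dots> \<le> (\<integral>\<^sup>+ t. ennreal B * (ennreal (2 * pi) * K) \<partial>C)"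
    proof (rule nn_integral_mono)
      fix t
      have "(\<integral>\<^sup>+ M. ennreal (norm (f (inv_rot M (v t)) * Z t M)) \<partial>haarM)
        \<le> (\<integral>\<^sup>+ M. ennreal B * ennreal (norm (f (inv_rot M (v t)))) \<partial>haarM)"
        using Z(2) B by (intro nn_integral_mono) (auto simp: norm_mult ennreal_mult[symmetric] mult.commute intro!: ennreal_leI mult_right_mono)
      also have "\<dots> = ennreal B * (\<integral>\<^sup>+ M. ennreal (norm (f (inv_rot M (v t)))) \<partial>haarM)"
        by (rule nn_integral_cmult) measurable
      also have "(\<integral>\<^sup>+ M. ennreal (norm (f (inv_rot M (v t)))) \<partial>haarM) = ennreal (2 * pi) * K"
        using v(2)[of t] nn_integral_haar_row[of "\<lambda>x. ennreal (norm (f x))"] unfolding K_def by auto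
      finally show "(\<integral>\<^sup>+ M. ennreal (norm (f (inv_rot M (v t)) * Z t M)) \<partial>haarM) \<le> ennreal B * (ennreal (2 * pi) * K)" .
    qed
    also have "\<dots> < \<infinity>"
      using K by (simp add: ennreal_mult_less_top C.emeasure_eq_measure)
    finally show "(\<integral>\<^sup>+ p. ennreal (norm (case p of (t, M) \<Rightarrow> f (inv_rot M (v t)) * Z t M)) \<partial>(C \<Otimes>\<^sub>M haarM)) < \<infinity>" .
  qed measurable
  then show ?thesis by (rule CH.Fubini_integral)
qed

lemma borel_measurable_wigner_d [measurable (raw)]:
  assumes [measurable]: "f \<in> borel_measurable M"
  shows "(\<lambda>x. wigner_d n k j (f x)) \<in> borel_measurable M"
proof -
  have "(\<lambda>s::real. (1 + s) ^ p * (1 - s) ^ q) = poly ([:1, 1:] ^ p * [:1, -1:] ^ q)" for p q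
    by (auto simp: poly_power)
  then show ?thesis
    unfolding wigner_d_def by (simp only: higher_deriv_poly) measurable
qed

lemma borel_measurable_wigner_D [measurable]:
  "wigner_D n k j \<in> borel_measurable (borel \<Otimes>\<^sub>M borel \<Otimes>\<^sub>M borel)"
  unfolding wigner_D_def by measurable

text \<open>At the pole the generating polynomial is the monomial 2 w, whose n-th power has only the
  middle coefficient.\<close>

lemma solid_harm_axis_3:
  assumes "\<bar>j\<bar> \<le> int n"
  shows "solid_harm n j (axis 3 1) = (if j = 0 then of_real (sqrt ((2 * real n + 1) / (4 * pi))) else 0)"
proof -
  have "harm_poly (axis 3 1) = monom 2 1"
    by (simp add: harm_poly_def axis_def monom_altdef complex_eq_iff)
  then have "coeff (harm_poly (axis 3 1) ^ n) (nat (int n + j)) = (if j = 0 then 2 ^ n else 0)"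
    using assms by (auto simp: monom_power coeff_monom)
  then show ?thesis by (simp add: solid_harm_def)
qed

text \<open>At half angle \<pi>/4 and k = 0 the two linear forms multiply to (1 - w^2) / 2, which is
  half the generating polynomial at the equatorial point \<open>axis 1 1\<close>. Column 0 of the
  Wigner matrix thus reproduces the Legendre values at 0.\<close>

lemma wigner_d_zero_half_pi:
  assumes j: "\<bar>j\<bar> \<le> int n"
  shows "sqrt ((2 * real n + 1) / (4 * pi)) * wigner_d n j 0 (cos (pi / 2)) = norm_legendre n j 0"
proof -
  have e: "e_vec 0 = axis 1 1" by (simp add: vec_eq_iff forall_3 axis_def)
  let ?p = "[:1, 0, -1 :: real:]"
  have "[:sin (pi/2/2), cos (pi/2/2):] * [:cos (pi/2/2), - sin (pi/2/2):] = smult (1/2) ?p"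
  proof -
    have "sin (pi/2/2) = sqrt 2 / 2" "cos (pi/2/2) = sqrt 2 / 2" by (simp_all add: sin_45 cos_45)
    then show ?thesis by (simp only:) simp
  qed
  then have "[:sin (pi/2/2), cos (pi/2/2):] ^ n * [:cos (pi/2/2), - sin (pi/2/2):] ^ n = smult ((1/2) ^ n) (?p ^ n)"
    by (simp only: power_mult_distrib[symmetric] smult_power)
  then have rc: "rot_coeff n j 0 (pi/2) = coeff (?p ^ n) (nat (int n + j)) / 2 ^ n"
    by (simp add: rot_coeff_def power_one_over)
  have "harm_poly (axis 1 1) = map_poly of_real ?p"
    by (simp add: harm_poly_def axis_def map_poly_pCons complex_eq_iff)
  then have hp: "coeff (harm_poly (axis 1 1) ^ n) i = of_real (coeff (?p ^ n) i)" for i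
    using coeff_map_poly_power[of "of_real :: real \<Rightarrow> complex" ?p n i] by simp
  have "of_real (norm_legendre n j 0) = solid_harm n j (axis 1 1)"
    using solid_harm_e_vec[OF j, of 0] by (simp add: e)
  also have "\<dots> = of_real (sqrt ((2 * real n + 1) / (4 * pi)) * sqrt (fact (nat (int n - j)) * fact (nat (int n + j)))
      / (2 ^ n * fact n) * coeff (?p ^ n) (nat (int n + j)))"
    by (simp add: solid_harm_def hp)
  finally have "norm_legendre n j 0 = sqrt ((2 * real n + 1) / (4 * pi)) * sqrt (fact (nat (int n - j)) * fact (nat (int n + j)))
      / (2 ^ n * fact n) * coeff (?p ^ n) (nat (int n + j))"
    unfolding of_real_eq_iff .
  moreover have "wigner_d n j 0 (cos (pi / 2)) = sqrt (fact (nat (int n + j)) * fact (nat (int n - j)) / (fact n * fact n))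
      * (coeff (?p ^ n) (nat (int n + j)) / 2 ^ n)"
    using wigner_d_eq_rot_coeff[of "pi/2" j n 0] j unfolding rc by simp
  ultimately show ?thesis by (simp add: real_sqrt_divide mult_ac)
qed

text \<open>At \<open>axis 1 1\<close> the generating power is (1 - w^2)^n, whose even coefficients
  are nonzero, so the order is chosen to make n + j even. The orders 0 and 1 are wanted because s_j
  cannot vanish there.\<close>

lemma norm_legendre_zero_nonzero:
  obtains j where "\<bar>j\<bar> \<le> int n" "j = 0 \<or> j = 1" "norm_legendre n j 0 \<noteq> 0"
proof -
  define j where "j = (if even n then 0 else 1 :: int)"
  have j: "\<bar>j\<bar> \<le> int n" by (auto simp: j_def dest: odd_pos)
  define m where "m = nat (int n + j) div 2"
  have "nat (int n + j) = (if even n then n else Suc n)" by (simp add: j_def nat_add_distrib)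
  then have m: "nat (int n + j) = 2 * m" "m \<le> n"
    by (auto simp: m_def elim!: oddE)
  let ?p = "[:1, 0, -1 :: complex:]"
  have "?p = monom (-1) 2 + 1"
    by (simp add: monom_altdef numeral_2_eq_2 one_pCons)
  then have "?p ^ n = (\<Sum>i\<le>n. of_nat (n choose i) * monom (-1) 2 ^ i * 1 ^ (n - i))"
    by (simp only: binomial_ring)
  then have "coeff (?p ^ n) (2 * m) = (\<Sum>i\<le>n. if i = m then of_nat (n choose i) * (-1) ^ i else 0)"
    by (simp add: coeff_sum monom_power of_nat_mult_conv_smult coeff_monom)
      (simp add: if_distrib[of "\<lambda>x. _ * x"] sum.delta cong: if_cong)
  also have "\<dots> \<noteq> 0" using m(2) by (simp add: sum.delta)
  finally have "coeff (harm_poly (axis 1 1) ^ n) (nat (int n + j)) \<noteq> 0"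
    unfolding m(1) by (simp add: harm_poly_def axis_def complex_eq_iff Complex_eq)
  then have "solid_harm n j (axis 1 1) \<noteq> 0"
    by (simp add: solid_harm_def add_nonneg_eq_0_iff)
  moreover have "e_vec 0 = axis 1 1" by (simp add: vec_eq_iff forall_3 axis_def)
  ultimately have "norm_legendre n j 0 \<noteq> 0"
    using solid_harm_e_vec[OF j, of 0] by auto
  then show thesis using that[of j] j by (auto simp: j_def)
qed

section \<open>Correlation of a function with rotated harmonics\<close>

context
  fixes f :: "real^3 \<Rightarrow> complex" and n :: nat and k :: int
  assumes f: "integrable sphereM f" and k: "\<bar>k\<bar> \<le> int n"
begin

lemma borel_measurable_f [measurable]: "f \<in> borel_measurable borel"
  using f by auto

definition sph_coeff :: complex where
  "sph_coeff = (LINT x|sphereM. f x * cnj (solid_harm n k x))"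

text \<open>\<open>axis 1 1\<close> is the point d = 0 of the same equator. Integrating against e^(i
  j d) in d will give \<open>f\<close> paired with the conjugate of
  \<open>harm_coeff n k j\<close>.\<close>

definition circle_corr :: "real \<Rightarrow> complex" where
  "circle_corr d = (LINT M|haarM. f (inv_rot M (axis 1 1)) * cnj (harm_bar n k (inv_rot M (e_vec d))))"

text \<open>The circle of angular distance \<open>d\<close> around \<open>axis 3 1\<close> may be averaged, since rotations about
  this axis fix the argument of \<open>f\<close>; of the rotated harmonic only the zonal part survives.\<close>

lemma circle_corr_eq:
  "of_real (sqrt ((2 * real n + 1) / (4 * pi))) * circle_corr d = cnj (solid_harm n 0 (tilted_circle d)) * (2 * pi * sph_coeff)"
proof -
  define c0 where "c0 = sqrt ((2 * real n + 1) / (4 * pi))"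
  define y where "y = solid_harm n 0 (tilted_circle d)"
  obtain B where B: "\<And>x. norm (harm_bar n k x) \<le> B" "B \<ge> 0" using harm_bar_bounded by blast
  define F where "F M = f (inv_rot M (axis 3 1)) * cnj (harm_bar n k (inv_rot M (tilted_circle d)))" for M
  have [measurable]: "F \<in> borel_measurable borel" unfolding F_def[abs_def] by measurable
  \<comment> \<open>This translation takes the argument of \<open>f\<close> to the pole and the
    equator to \<open>tilted_circle\<close>.\<close>
  have "circle_corr d = (LINT M|haarM. F (R2 (- (pi / 2)) ** M))"
    by (simp only: circle_corr_def F_def inv_rot_mult inv_rot_special)
  also have "\<dots> = (LINT M|haarM. F M)" by (rule integral_haar_R2) auto
  finally have cF: "circle_corr d = (LINT M|haarM. F M)" .
  have FR: "F (R3 t ** M) = f (inv_rot M (axis 3 1)) * cnj (harm_bar n k (inv_rot M (inv_rot (R3 t) (tilted_circle d))))" for t M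
    by (simp only: F_def inv_rot_mult inv_rot_special)
  define G where "G M = (LINT t|circM. harm_bar n k (inv_rot M (inv_rot (R3 t) (tilted_circle d))))" for M
  have [measurable]: "G \<in> borel_measurable borel" unfolding G_def[abs_def] by measurable
  have "2 * pi * circle_corr d = (LINT t|circM. circle_corr d)"
    by (simp add: scaleR_conv_of_real)
  also have "\<dots> = (LINT t|circM. LINT M|haarM. F (R3 t ** M))"
    unfolding cF by (simp add: integral_haar_R3)
  also have "\<dots> = (LINT M|haarM. LINT t|circM. F (R3 t ** M))"
    unfolding FR
    by (rule integral_circ_haar_swap[symmetric, where B = B]) (use f B circ.finite_measure_axioms in auto)
  also have "\<dots> = (LINT M|haarM. f (inv_rot M (axis 3 1)) * cnj (G M))"
    unfolding FR G_def by simp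
  finally have 1: "2 * pi * circle_corr d = (LINT M|haarM. f (inv_rot M (axis 3 1)) * cnj (G M))" .
  \<comment> \<open>The average leaves the order 0 term, the zonal value \<open>y\<close> times one
    Wigner function. The harmonic at the pole is \<open>c0\<close> times the same function, so that
    function can be eliminated.\<close>
  have G: "c0 * G (euler_rot a b c) = 2 * pi * y * harm_bar n k (inv_rot (euler_rot a b c) (axis 3 1))"
    if b: "0 < b" "b < pi" for a b c
  proof -
    define D where "D j = wigner_D n j k (a, b, c)" for j
    have "harm_bar n k (inv_rot (euler_rot a b c) (inv_rot (R3 t) (tilted_circle d)))
      = (\<Sum>j=-int n..int n. (D (- j) * solid_harm n (- j) (tilted_circle d)) * circ_exp j t) * circ_exp_cnj 0 t" for t
    proof -
      have "harm_bar n k (inv_rot (euler_rot a b c) (inv_rot (R3 t) (tilted_circle d)))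
        = (\<Sum>j=-int n..int n. wigner_D n j k (a, b, c) * solid_harm n j (R3 (- t) *v tilted_circle d))"
        unfolding inv_rot_R3 by (rule harm_bar_inv_rot_euler[OF b k]) (simp add: norm_R3)
      also have "\<dots> = (\<Sum>j=-int n..int n. (D j * solid_harm n j (tilted_circle d)) * circ_exp_cnj j t)"
        by (intro sum.cong) (auto simp: D_def solid_harm_R3)
      also have "\<dots> = (\<Sum>j=-int n..int n. (D (- j) * solid_harm n (- j) (tilted_circle d)) * circ_exp j t)"
        by (rule sum.reindex_bij_witness[of _ uminus uminus]) auto
      finally show ?thesis by simp
    qed
    then have "G (euler_rot a b c) = 2 * pi * (D (- 0) * solid_harm n (- 0) (tilted_circle d))"
      unfolding G_def by (simp only:) (rule integral_circ_trig_poly; auto)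
    moreover have "harm_bar n k (inv_rot (euler_rot a b c) (axis 3 1)) = (\<Sum>j=-int n..int n. if j = 0 then c0 * D 0 else 0)"
    proof -
      have n: "norm (axis 3 1 :: real^3) = 1" by (simp add: norm_vec_def L2_set_def sum_3 axis_def)
      show ?thesis unfolding harm_bar_inv_rot_euler[OF b k n]
        by (intro sum.cong) (auto simp: D_def c0_def solid_harm_axis_3)
    qed
    ultimately show ?thesis by (simp add: y_def sum.delta)
  qed
  have "c0 * (2 * pi * circle_corr d) = (LINT M|haarM. f (inv_rot M (axis 3 1)) * cnj (c0 * G M))"
    unfolding 1 by (simp add: mult_ac)
  also have "\<dots> = (LINT M|haarM. f (inv_rot M (axis 3 1)) * cnj (2 * pi * y * harm_bar n k (inv_rot M (axis 3 1))))"
    by (rule integral_haar_cong) (simp_all only: G, measurable)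
  also have "\<dots> = (LINT M|haarM. (2 * pi * cnj y) * (f (inv_rot M (axis 3 1)) * cnj (harm_bar n k (inv_rot M (axis 3 1)))))"
    by (simp add: mult_ac)
  also have "\<dots> = 2 * pi * cnj y * (LINT M|haarM. f (inv_rot M (axis 3 1)) * cnj (harm_bar n k (inv_rot M (axis 3 1))))"
    by simp
  also have "(LINT M|haarM. f (inv_rot M (axis 3 1)) * cnj (harm_bar n k (inv_rot M (axis 3 1))))
    = 2 * pi * (LINT x|sphereM. f x * cnj (harm_bar n k x))"
    by (rule integral_haar_row_3) measurable
  also have "(LINT x|sphereM. f x * cnj (harm_bar n k x)) = sph_coeff"
    unfolding sph_coeff_def
  proof (rule integral_cong_AE)
    show "AE x in sphereM. f x * cnj (harm_bar n k x) = f x * cnj (solid_harm n k x)"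
      using AE_sphereM_norm by eventually_elim (simp add: harm_bar_def)
  qed measurable
  finally have "(2 * pi) * (c0 * circle_corr d) = (2 * pi) * (cnj y * (2 * pi * sph_coeff))"
    by (simp add: mult_ac)
  then show ?thesis unfolding c0_def y_def by (simp add: mult_ac)
qed

text \<open>The square arises because the zonal harmonic along the tilted circle has Fourier
  coefficients \<open>w j * P j\<close>, and \<open>c0 * w j = P j\<close>. Two factors
  \<open>c0\<close> are divided out, one from \<open>circle_corr_eq\<close> and one from this
  relation, so the constant is 2 \<pi> / c0^2.\<close>

lemma integral_harm_coeff:
  assumes j: "\<bar>j\<bar> \<le> int n"
  shows "(LINT M|haarM. f (inv_rot M (axis 1 1)) * cnj (harm_coeff n k j M))
    = of_real (8 * pi\<^sup>2 / (2 * real n + 1) * (norm_legendre n j 0)\<^sup>2) * sph_coeff" (is "?T = _")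
proof -
  define c0 where "c0 = sqrt ((2 * real n + 1) / (4 * pi))"
  have c0: "c0 > 0" "c0\<^sup>2 = (2 * real n + 1) / (4 * pi)" by (simp_all add: c0_def)
  define w where "w i = wigner_d n i 0 (cos (pi / 2))" for i
  define P where "P i = norm_legendre n i 0" for i
  obtain B where B: "\<And>x. norm (harm_bar n k x) \<le> B" "B \<ge> 0" using harm_bar_bounded by blast
  have e: "axis 1 1 = e_vec 0" by (simp add: vec_eq_iff forall_3 axis_def)
  let ?E = "\<lambda>d. circ_exp j d"
  have "2 * pi * cnj (harm_coeff n k j M) = (LINT d|circM. cnj (harm_bar n k (inv_rot M (e_vec d))) * ?E d)" for M
  proof -
    have "2 * pi * cnj (harm_coeff n k j M) = cnj (LINT d|circM. harm_bar n k (inv_rot M (e_vec d)) * circ_exp_cnj j d)"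
      by (simp add: harm_coeff_def)
    also have "\<dots> = (LINT d|circM. cnj (harm_bar n k (inv_rot M (e_vec d)) * circ_exp_cnj j d))"
      by (rule integral_bounded_linear'[OF bounded_linear_cnj bounded_linear_cnj, symmetric]) simp_all
    finally show ?thesis by (simp add: exp_cnj)
  qed
  note hc = this
  have "2 * pi * ?T = (LINT M|haarM. 2 * pi * (f (inv_rot M (axis 1 1)) * cnj (harm_coeff n k j M)))"
    by (rule integral_mult_right_zero[symmetric])
  also have "\<dots> = (LINT M|haarM. f (inv_rot M (axis 1 1)) * (2 * pi * cnj (harm_coeff n k j M)))"
    by (simp only: mult.left_commute)
  also have "\<dots> = (LINT M|haarM. f (inv_rot M (axis 1 1)) * (LINT d|circM. cnj (harm_bar n k (inv_rot M (e_vec d))) * ?E d))"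
    unfolding hc ..
  also have "\<dots> = (LINT M|haarM. LINT d|circM. f (inv_rot M (axis 1 1)) * (cnj (harm_bar n k (inv_rot M (e_vec d))) * ?E d))"
    by simp
  also have "\<dots> = (LINT d|circM. LINT M|haarM. f (inv_rot M (axis 1 1)) * (cnj (harm_bar n k (inv_rot M (e_vec d))) * ?E d))"
    unfolding e
    by (rule integral_circ_haar_swap[where B = B and v = "\<lambda>_. e_vec 0"]) (use f B circ.finite_measure_axioms in \<open>auto simp: norm_mult\<close>)
  also have "\<dots> = (LINT d|circM. circle_corr d * ?E d)"
    unfolding circle_corr_def by (simp add: mult.assoc[symmetric])
  finally have T: "2 * pi * ?T = (LINT d|circM. circle_corr d * ?E d)" .
  let ?Z = "\<lambda>d. \<Sum>i=-int n..int n. of_real (w (- i) * P (- i)) * circ_exp i d"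
  \<comment> \<open>The tilted circle is a rotated equator, so the expansion uses column 0 of the
    Wigner matrix; conjugation negates the frequencies, whence the indices - i.\<close>
  have y: "cnj (solid_harm n 0 (tilted_circle d)) = ?Z d" for d
  proof -
    have "solid_harm n 0 (tilted_circle d) = (\<Sum>i=-int n..int n. of_real (w i) * solid_harm n i (e_vec d))"
      unfolding inv_rot_special(5)[symmetric] w_def by (rule solid_harm_R2) auto
    also have "\<dots> = (\<Sum>i=-int n..int n. of_real (w i * P i) * circ_exp i d)"
      by (intro sum.cong) (auto simp: solid_harm_e_vec P_def)
    finally have "cnj (solid_harm n 0 (tilted_circle d)) = (\<Sum>i=-int n..int n. of_real (w i * P i) * circ_exp_cnj i d)"
      by (simp add: exp_cnj)
    also have "\<dots> = ?Z d"
      by (rule sum.reindex_bij_witness[of _ uminus uminus]) auto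
    finally show ?thesis .
  qed
  have "c0 * (2 * pi * ?T) = (LINT d|circM. (of_real c0 * circle_corr d) * ?E d)"
    unfolding T by (simp add: mult.assoc)
  also have "\<dots> = (LINT d|circM. (2 * pi * sph_coeff) * (?Z d * circ_exp_cnj (- j) d))"
    unfolding c0_def circle_corr_eq y by (simp add: mult_ac)
  also have "\<dots> = (2 * pi * sph_coeff) * (2 * pi * complex_of_real (w (- (- j)) * P (- (- j))))"
  proof -
    have "(LINT d|circM. ?Z d * circ_exp_cnj (- j) d)
      = 2 * pi * complex_of_real (w (- (- j)) * P (- (- j)))"
      by (rule integral_circ_trig_poly) (use j in auto)
    then show ?thesis by (simp only: integral_mult_right_zero)
  qed
  finally have "2 * pi * (c0 * ?T) = 2 * pi * (2 * pi * sph_coeff * of_real (w j * P j))"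
    by (simp add: mult_ac)
  then have "c0 * ?T = 2 * pi * sph_coeff * of_real (w j * P j)" by simp
  \<comment> \<open>A second factor \<open>c0\<close> is multiplied in to complete
    \<open>w j\<close> to \<open>P j\<close>.\<close>
  then have "of_real (c0\<^sup>2) * ?T = 2 * pi * sph_coeff * of_real ((c0 * w j) * P j)"
    by (simp add: power2_eq_square mult_ac)
  also have "c0 * w j = P j"
    unfolding c0_def w_def P_def by (rule wigner_d_zero_half_pi[OF j])
  finally have T': "of_real ((2 * real n + 1) / (4 * pi)) * ?T = 2 * pi * sph_coeff * complex_of_real ((P j)\<^sup>2)"
    unfolding c0 by (simp add: power2_eq_square)
  have "complex_of_real (4 * pi / (2 * real n + 1)) * complex_of_real ((2 * real n + 1) / (4 * pi)) = 1"
    unfolding of_real_mult[symmetric] by simp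
  then have "?T = complex_of_real (4 * pi / (2 * real n + 1)) * (complex_of_real ((2 * real n + 1) / (4 * pi)) * ?T)"
    by (simp only: mult.assoc[symmetric] mult_1)
  also have "\<dots> = of_real (8 * pi\<^sup>2 / (2 * real n + 1) * (norm_legendre n j 0)\<^sup>2) * sph_coeff"
    unfolding T' P_def by (simp add: power2_eq_square)
  finally show ?thesis .
qed

text \<open>After exchanging integrals, each point of the arc is translated to angle 0, which costs
  e^(i j p). The factor (2 n + 1) / (8 \<pi>^2) in \<open>wigner_coeff\<close> cancels the constant
  of \<open>integral_harm_coeff\<close>. The equation stays multiplied by the Legendre value, which
  is 0 for odd n + j.\<close>

lemma wigner_coeff_arc_transform:
  assumes j: "\<bar>j\<bar> \<le> int n" and \<psi>: "0 < \<psi>"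
  shows "of_real (norm_legendre n j 0) * wigner_coeff (arc_transform \<psi> f) n j k
    = of_real (s_coef \<psi> j * (norm_legendre n j 0)\<^sup>2) * sph_coeff"
proof -
  let ?T = "LINT M|haarM. f (inv_rot M (axis 1 1)) * cnj (harm_coeff n k j M)"
  let ?E = "\<lambda>q. case q of (a, b, c) \<Rightarrow> euler_rot a b c"
  let ?W = "LINT q|SO3_measure. arc_transform \<psi> f q * cnj (of_real (norm_legendre n j 0) * wigner_D n j k q)"
  define J where "J = density lborel (\<lambda>p. ennreal (indicator {-\<psi>..\<psi>} p))"
  have J: "finite_measure J" "sets J = sets borel"
    using \<psi> by (auto simp: J_def emeasure_density ennreal_indicator intro!: finite_measureI)
  note [measurable_cong] = J(2)
  interpret J: finite_measure J by (rule J)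
  \<comment> \<open>For nonintegrable \<open>g\<close> both integrals have the value 0. Hence the
    transform and its matrix version agree at every triple of angles.\<close>
  have LJ: "(LINT p|J. g p) = (LBINT p=-\<psi>..\<psi>. g p)" if [measurable]: "g \<in> borel_measurable borel" for g :: "real \<Rightarrow> complex"
  proof -
    have "(LINT p|J. g p) = (LINT p|lborel. indicator {-\<psi>..\<psi>} p *\<^sub>R g p)"
      unfolding J_def by (rule integral_density) auto
    also have "\<dots> = (LBINT p=-\<psi>..\<psi>. g p)"
      using \<psi> by (subst interval_integral_Icc) (auto simp: set_lebesgue_integral_def)
    finally show ?thesis .
  qed
  define g where "g M = (LINT p|J. f (inv_rot M (e_vec p)))" for M
  have [measurable]: "g \<in> borel_measurable borel" unfolding g_def[abs_def] by measurable
  have ga: "arc_transform \<psi> f q = g (?E q)" for q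
  proof -
    obtain a b c where q: "q = (a, b, c)" by (cases q)
    show ?thesis
      unfolding g_def q by (subst LJ) (simp_all only: arc_transform_def prod.case matrix_inv_euler_rot inv_rot_def, measurable)
  qed
  obtain B where B: "\<And>M. norm (harm_coeff n k j M) \<le> B" "B \<ge> 0" using harm_coeff_bounded by blast
  define K where "K = complex_of_real ((2 * real n + 1) / (8 * pi\<^sup>2))"
  have "of_real (norm_legendre n j 0) * wigner_coeff (arc_transform \<psi> f) n j k
    = K * ?W"
  proof -
    have "arc_transform \<psi> f q * cnj (of_real (norm_legendre n j 0) * wigner_D n j k q)
      = of_real (norm_legendre n j 0) * (arc_transform \<psi> f q * cnj (wigner_D n j k q))" for q
      by (simp add: mult_ac)
    then have I: "?W
      = of_real (norm_legendre n j 0) * (LINT q|SO3_measure. arc_transform \<psi> f q * cnj (wigner_D n j k q))"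
      by (simp only: integral_mult_right_zero)
    show ?thesis
      unfolding wigner_coeff_def K_def I by (rule mult.left_commute)
  qed
  also have "?W
    = (LINT q|SO3_measure. g (?E q) * cnj (harm_coeff n k j (?E q)))"
  proof (rule integral_cong_AE)
    show "AE q in SO3_measure. arc_transform \<psi> f q * cnj (of_real (norm_legendre n j 0) * wigner_D n j k q)
      = g (?E q) * cnj (harm_coeff n k j (?E q))"
      using AE_SO3_measure by eventually_elim (auto simp: ga harm_coeff_euler k j)
  qed (unfold ga, measurable)
  also have "\<dots> = (LINT M|haarM. g M * cnj (harm_coeff n k j M))"
    by (rule integral_haar[symmetric]) measurable
  also have "\<dots> = (LINT M|haarM. LINT p|J. f (inv_rot M (e_vec p)) * cnj (harm_coeff n k j M))"
    unfolding g_def by simp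
  also have "\<dots> = (LINT p|J. LINT M|haarM. f (inv_rot M (e_vec p)) * cnj (harm_coeff n k j M))"
    by (rule integral_circ_haar_swap[OF J, where B = B]) (use f B in auto)
  also have "\<dots> = (LINT p|J. circ_exp j p * ?T)"
  proof (intro Bochner_Integration.integral_cong refl)
    fix p
    have "(LINT M|haarM. f (inv_rot M (e_vec p)) * cnj (harm_coeff n k j M))
      = (LINT M|haarM. f (inv_rot (R3 p ** M) (e_vec p)) * cnj (harm_coeff n k j (R3 p ** M)))"
      by (rule integral_haar_R3[symmetric]) measurable
    also have "\<dots> = (LINT M|haarM. circ_exp j p * (f (inv_rot M (axis 1 1)) * cnj (harm_coeff n k j M)))"
      by (rule integral_haar_cong) (measurable, simp add: inv_rot_mult inv_rot_special harm_coeff_R3 k j exp_cnj)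
    also have "\<dots> = circ_exp j p * ?T"
      by simp
    finally show "(LINT M|haarM. f (inv_rot M (e_vec p)) * cnj (harm_coeff n k j M))
      = circ_exp j p * ?T" .
  qed
  also have "\<dots> = (LINT p|J. circ_exp j p) * ?T"
    by simp
  also have "(LINT p|J. circ_exp j p) = of_real (s_coef \<psi> j)"
  proof -
    have "(LINT p|J. circ_exp j p) = (LINT p|lborel. indicator {-\<psi>..\<psi>} p *\<^sub>R circ_exp j p)"
      unfolding J_def by (rule integral_density) auto
    also have "\<dots> = of_real (s_coef \<psi> j)"
    proof (cases "j = 0")
      case True
      have "(LINT p|lborel. indicator {-\<psi>..\<psi>} p *\<^sub>R (1 :: complex)) = of_real \<psi> - of_real (- \<psi>)"
        using \<psi> by (intro integral_FTC_atLeastAtMost) (auto intro!: derivative_eq_intros)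
      then show ?thesis using True by (simp add: s_coef_def)
    next
      case False
      define H where "H x = circ_exp j x / (\<i> * of_int j)" for x :: real
      have "(LINT p|lborel. indicator {-\<psi>..\<psi>} p *\<^sub>R circ_exp j p) = H \<psi> - H (- \<psi>)"
        unfolding H_def using \<psi>
        by (intro integral_FTC_atLeastAtMost has_vector_derivative_circ_exp[OF False]) (auto intro!: continuous_intros)
      also have "\<dots> = of_real (s_coef \<psi> j)"
      proof -
        have e: "circ_exp j x = cis (of_int j * x)" for x
          by (simp add: cis_conv_exp mult_ac)
        show ?thesis
          unfolding H_def e using False by (simp add: s_coef_def complex_eq_iff Re_divide Im_divide power2_eq_square)
      qed
      finally show ?thesis .
    qed
    finally show ?thesis .
  qed
  also have "K * (of_real (s_coef \<psi> j) * ?T)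
    = of_real (s_coef \<psi> j * (norm_legendre n j 0)\<^sup>2) * sph_coeff"
  proof -
    have "(2 * real n + 1) / (8 * pi\<^sup>2) * (8 * pi\<^sup>2 / (2 * real n + 1)) = 1" by simp
    then have KA: "K * of_real (8 * pi\<^sup>2 / (2 * real n + 1)) = 1"
      unfolding K_def of_real_mult[symmetric] by (simp only: of_real_1)
    have "K * (x * (A * y * z)) = (K * A) * (x * y * z)" for x y z A :: complex
      by simp
    then show ?thesis
      unfolding integral_harm_coeff[OF j] of_real_mult by (simp only: KA mult_1)
  qed
  finally show ?thesis .
qed

end

section \<open>Convergence of the harmonic expansion\<close>

lemma integrable_norm_square_imp:
  fixes f :: "'a \<Rightarrow> complex"
  assumes "finite_measure M" and [measurable]: "f \<in> borel_measurable M" and f: "integrable M (\<lambda>x. (norm (f x))\<^sup>2)"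
  shows "integrable M f"
proof -
  interpret finite_measure M by fact
  have "integrable M (\<lambda>x. 1 + (norm (f x))\<^sup>2)" using f by simp
  then show ?thesis
  proof (rule Bochner_Integration.integrable_bound)
    have "y \<le> 1 + y\<^sup>2" for y :: real
      using zero_le_power2[of "y - 1/2"] by (simp add: power2_eq_square algebra_simps)
    then show "AE x in M. norm (f x) \<le> norm (1 + (norm (f x))\<^sup>2)" by simp
  qed measurable
qed

text \<open>Pythagoras: the residual of the sum with Fourier coefficients is orthogonal to each
  \<open>e i\<close>, hence to the difference from any other sum. Boundedness of the
  \<open>e i\<close> supplies all integrability.\<close>

lemma best_approximation:
  fixes h :: "'a \<Rightarrow> complex" and e :: "'i \<Rightarrow> 'a \<Rightarrow> complex"
  assumes "finite_measure M" and I: "finite I"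
    and h [measurable]: "h \<in> borel_measurable M" and h2: "integrable M (\<lambda>x. (norm (h x))\<^sup>2)"
    and e: "\<And>i. i \<in> I \<Longrightarrow> e i \<in> borel_measurable M" and eb: "\<And>i. i \<in> I \<Longrightarrow> \<exists>B. \<forall>x. norm (e i x) \<le> B"
    and on: "\<And>i j. i \<in> I \<Longrightarrow> j \<in> I \<Longrightarrow> (LINT x|M. e i x * cnj (e j x)) = (if i = j then 1 else 0)"
  defines "S \<equiv> \<lambda>b x. \<Sum>i\<in>I. b i * e i x" and "a \<equiv> \<lambda>i. LINT x|M. h x * cnj (e i x)"
  shows "(LINT x|M. (norm (h x - (S a x)))\<^sup>2) \<le> (LINT x|M. (norm (h x - (S c x)))\<^sup>2)"
    and "integrable M (\<lambda>x. (norm (h x - (S c x)))\<^sup>2)"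
proof -
  interpret finite_measure M by fact
  have bsum: "\<exists>B\<ge>0. \<forall>x. norm (S b x) \<le> B" for b
  proof -
    from eb obtain B where B: "\<And>i x. i \<in> I \<Longrightarrow> norm (e i x) \<le> B i" by metis
    have "norm (S b x) \<le> (\<Sum>i\<in>I. norm (b i) * \<bar>B i\<bar>)" for x
      unfolding S_def using B by (intro sum_norm_le) (auto simp: norm_mult intro!: mult_left_mono order_trans[OF B])
    then show ?thesis
      by (intro exI[of _ "\<Sum>i\<in>I. norm (b i) * \<bar>B i\<bar>"]) (auto intro!: sum_nonneg)
  qed
  have msum: "(\<lambda>x. S b x) \<in> borel_measurable M" for b
    unfolding S_def using e by (intro borel_measurable_sum borel_measurable_times) auto
  have hi: "integrable M h" by (rule integrable_norm_square_imp) (use h h2 finite_measure_axioms in auto)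
  have int2: "integrable M (\<lambda>x. (norm (h x - (S b x)))\<^sup>2)" for b
  proof -
    obtain B where B: "B \<ge> 0" "\<And>x. norm (S b x) \<le> B" using bsum by blast
    have "integrable M (\<lambda>x. 2 * (norm (h x))\<^sup>2 + 2 * B\<^sup>2)" using h2 by simp
    then show ?thesis
    proof (rule Bochner_Integration.integrable_bound)
      have "(norm (h x - (S b x)))\<^sup>2 \<le> 2 * (norm (h x))\<^sup>2 + 2 * B\<^sup>2" for x
      proof -
        have "norm (h x - (S b x)) \<le> norm (h x) + B"
          using norm_triangle_ineq4[of "h x" "S b x"] B(2)[of x] by linarith
        then have "(norm (h x - (S b x)))\<^sup>2 \<le> (norm (h x) + B)\<^sup>2" by (intro power_mono) auto
        also have "\<dots> \<le> 2 * (norm (h x))\<^sup>2 + 2 * B\<^sup>2"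
          using zero_le_power2[of "norm (h x) - B"] by (simp add: power2_eq_square algebra_simps)
        finally show ?thesis .
      qed
      then show "AE x in M. norm ((norm (h x - (S b x)))\<^sup>2) \<le> norm (2 * (norm (h x))\<^sup>2 + 2 * B\<^sup>2)"
        by (intro AE_I2) (simp add: order_trans[OF zero_le_power2])
    qed (use msum in measurable)
  qed
  show "integrable M (\<lambda>x. (norm (h x - (S c x)))\<^sup>2)" by (rule int2)
  define r where "r x = h x - (S a x)" for x
  define d where "d x = S (\<lambda>i. a i - c i) x" for x
  have [measurable]: "r \<in> borel_measurable M" "d \<in> borel_measurable M"
    unfolding r_def[abs_def] d_def[abs_def] using msum by measurable
  have r2: "integrable M (\<lambda>x. (norm (r x))\<^sup>2)" unfolding r_def by (rule int2)
  have ri: "integrable M r" by (rule integrable_norm_square_imp) (use r2 finite_measure_axioms in auto)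
  obtain D where D: "D \<ge> 0" "\<And>x. norm (d x) \<le> D" using bsum[of "\<lambda>i. a i - c i"] unfolding d_def by blast
  have d2: "integrable M (\<lambda>x. (norm (d x))\<^sup>2)"
    using D by (intro integrable_const_bound[where B = "D\<^sup>2"]) (auto intro!: power_mono)
  have ei: "integrable M (\<lambda>x. e i x * cnj (e j x))" if ij: "i \<in> I" "j \<in> I" for i j
  proof -
    obtain B1 B2 where B: "\<And>x. norm (e i x) \<le> B1" "\<And>x. norm (e j x) \<le> B2" using eb[OF ij(1)] eb[OF ij(2)] by blast
    have [measurable]: "e i \<in> borel_measurable M" "e j \<in> borel_measurable M" using e ij by auto
    have "norm (e i x * cnj (e j x)) \<le> B1 * B2" for x
      unfolding norm_mult using B order_trans[OF norm_ge_zero B(1)] by (auto intro!: mult_mono)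
    then show ?thesis by (intro integrable_const_bound[where B = "B1 * B2"]) auto
  qed
  have he: "integrable M (\<lambda>x. g x * cnj (e j x))" if gj: "integrable M g" "j \<in> I" for g j
  proof -
    obtain B where B: "\<And>x. norm (e j x) \<le> B" using eb[OF gj(2)] by blast
    have [measurable]: "e j \<in> borel_measurable M" "g \<in> borel_measurable M" using e gj by auto
    have "integrable M (\<lambda>x. B * norm (g x))" using gj by simp
    then show ?thesis
    proof (rule Bochner_Integration.integrable_bound)
      show "AE x in M. norm (g x * cnj (e j x)) \<le> norm (B * norm (g x))"
      proof (intro AE_I2)
        fix x
        have "norm (g x) * norm (e j x) \<le> norm (g x) * \<bar>B\<bar>"
          by (intro mult_left_mono order_trans[OF B]) auto
        then show "norm (g x * cnj (e j x)) \<le> norm (B * norm (g x))"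
          by (simp add: norm_mult abs_mult mult.commute)
      qed
    qed measurable
  qed
  have orth: "(LINT x|M. r x * cnj (e j x)) = 0" if "j \<in> I" for j
  proof -
    have "(LINT x|M. r x * cnj (e j x)) = (LINT x|M. h x * cnj (e j x) - (\<Sum>i\<in>I. a i * (e i x * cnj (e j x))))"
      by (simp add: r_def S_def left_diff_distrib sum_distrib_right mult.assoc)
    also have "\<dots> = a j - (\<Sum>i\<in>I. a i * (LINT x|M. e i x * cnj (e j x)))"
      using he[OF hi that] ei that by (simp add: a_def)
    also have "(\<Sum>i\<in>I. a i * (LINT x|M. e i x * cnj (e j x))) = (\<Sum>i\<in>I. if i = j then a j else 0)"
      using on that by (intro sum.cong) auto
    finally show ?thesis using I that by (simp add: sum.delta)
  qed
  have "(LINT x|M. r x * cnj (d x)) = (LINT x|M. (\<Sum>i\<in>I. cnj (a i - c i) * (r x * cnj (e i x))))"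
    by (simp add: d_def S_def sum_distrib_left mult_ac)
  also have "\<dots> = (\<Sum>i\<in>I. cnj (a i - c i) * (LINT x|M. r x * cnj (e i x)))"
    using he[OF ri] by (subst Bochner_Integration.integral_sum) (auto simp del: complex_cnj_diff)
  also have "\<dots> = 0" using orth by simp
  finally have rd: "(LINT x|M. r x * cnj (d x)) = 0" .
  have rdi: "integrable M (\<lambda>x. r x * cnj (d x))"
  proof -
    have "integrable M (\<lambda>x. \<Sum>i\<in>I. cnj (a i - c i) * (r x * cnj (e i x)))"
      using he[OF ri] by (intro Bochner_Integration.integrable_sum) (auto simp del: complex_cnj_diff)
    then show ?thesis by (simp add: d_def S_def sum_distrib_left mult_ac)
  qed
  define w where "w x = Re (r x * cnj (d x))" for x
  have w: "integrable M w" "(LINT x|M. w x) = 0"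
    using integrable_Re[OF rdi] integral_Re[OF rdi] rd by (simp_all add: w_def[abs_def])
  have sq: "(norm (r x + d x))\<^sup>2 = (norm (r x))\<^sup>2 + (norm (d x))\<^sup>2 + 2 * w x" for x
    unfolding cmod_power2 w_def by (simp add: power2_eq_square algebra_simps)
  have "(LINT x|M. (norm (r x + d x))\<^sup>2) = (LINT x|M. (norm (r x))\<^sup>2) + (LINT x|M. (norm (d x))\<^sup>2) + 2 * (LINT x|M. w x)"
    unfolding sq using r2 d2 w(1) by simp
  also note w(2)
  finally have "(LINT x|M. (norm (r x))\<^sup>2) \<le> (LINT x|M. (norm (r x + d x))\<^sup>2)"
    by simp
  moreover have "r x + d x = h x - (S c x)" for x
    by (simp add: r_def d_def S_def left_diff_distrib sum_subtractf)
  ultimately show "(LINT x|M. (norm (h x - (S a x)))\<^sup>2) \<le> (LINT x|M. (norm (h x - (S c x)))\<^sup>2)"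
    unfolding r_def[symmetric] by (simp only:)
qed

text \<open>Real and imaginary parts are approximated by polynomials with error e / 2 each, as their
  squares add up to the squared modulus. On the sphere a polynomial is a finite harmonic
  sum.\<close>

lemma harmonic_sums_dense:
  fixes f :: "real^3 \<Rightarrow> complex"
  assumes [measurable]: "f \<in> borel_measurable borel"
    and f2: "integrable sphereM (\<lambda>x. (norm (f x))\<^sup>2)" and e: "e > 0"
  obtains N c where "(LINT p|S2_measure. (norm (f (sph (fst p) (snd p)) - harm_sum N c (fst p) (snd p)))\<^sup>2) < e"
proof -
  have S: "compact (sphere 0 1 :: (real^3) set)" "AE x in sphereM. x \<in> sphere 0 1"
    using AE_sphereM_norm by auto
  have fin: "(\<integral>\<^sup>+ x. ennreal ((norm (f x))\<^sup>2) \<partial>sphereM) < \<infinity>"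
  proof -
    have "(\<integral>\<^sup>+ x. ennreal (norm ((norm (f x))\<^sup>2)) \<partial>sphereM) < \<infinity>"
      using f2 unfolding integrable_iff_bounded by blast
    then show ?thesis by simp
  qed
  have approx: "\<exists>g. real_polynomial_function g \<and> sq_dist sphereM u g < ennreal (e/2)"
    if u: "u \<in> borel_measurable borel" "\<And>x. \<bar>u x\<bar> \<le> norm (f x)" for u
  proof -
    have "(\<integral>\<^sup>+ x. ennreal ((u x)\<^sup>2) \<partial>sphereM) \<le> (\<integral>\<^sup>+ x. ennreal ((norm (f x))\<^sup>2) \<partial>sphereM)"
      using u(2) by (intro nn_integral_mono ennreal_leI) (simp add: abs_le_square_iff[symmetric])
    also note fin
    finally have "poly_approx sphereM u"
      by (intro poly_approx_L2[OF sphere.finite_measure_axioms sets_sphereM S u(1)])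
    then show ?thesis using e unfolding poly_approx_def by simp
  qed
  obtain g1 where g1: "real_polynomial_function g1" "(\<integral>\<^sup>+ x. ennreal ((Re (f x) - g1 x)\<^sup>2) \<partial>sphereM) < ennreal (e/2)"
    using approx[of "\<lambda>x. Re (f x)"] abs_Re_le_cmod by auto
  obtain g2 where g2: "real_polynomial_function g2" "(\<integral>\<^sup>+ x. ennreal ((Im (f x) - g2 x)\<^sup>2) \<partial>sphereM) < ennreal (e/2)"
    using approx[of "\<lambda>x. Im (f x)"] abs_Im_le_cmod by auto
  have [measurable]: "g1 \<in> borel_measurable borel" "g2 \<in> borel_measurable borel"
    using g1 g2 by (auto intro: borel_measurable_real_polynomial)
  define g where "g x = complex_of_real (g1 x) + \<i> * complex_of_real (g2 x)" for x
  have "in_harm_span (\<lambda>a b. complex_of_real (g1 (sph a b)) + \<i> * complex_of_real (g2 (sph a b)))"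
    by (intro in_harm_span_add in_harm_span_scale in_harm_span_polynomial g1 g2)
  then obtain N c where Nc: "\<And>a b. 0 < b \<Longrightarrow> b < pi \<Longrightarrow> g (sph a b) = harm_sum N c a b"
    unfolding in_harm_span_def g_def by blast
  define F where "F p = f (sph (fst p) (snd p)) - harm_sum N c (fst p) (snd p)" for p
  have "(\<lambda>p. \<Sum>k=-int n..int n. c n k * sph_harm n k (fst p) (snd p)) \<in> borel_measurable S2_measure" for n
    by (intro borel_measurable_sum borel_measurable_times measurable_sph_harm) auto
  then have [measurable]: "F \<in> borel_measurable S2_measure"
    unfolding F_def[abs_def] by measurable
  have "(\<integral>\<^sup>+ p. ennreal ((norm (F p))\<^sup>2) \<partial>S2_measure) = (\<integral>\<^sup>+ p. ennreal ((norm (f (sph (fst p) (snd p)) - g (sph (fst p) (snd p))))\<^sup>2) \<partial>S2_measure)"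
    by (rule nn_integral_cong_AE) (use AE_S2_measure in eventually_elim, simp add: F_def Nc)
  also have "\<dots> = (\<integral>\<^sup>+ x. ennreal ((norm (f x - g x))\<^sup>2) \<partial>sphereM)"
    unfolding sphereM_def g_def by (subst nn_integral_distr) measurable
  also have "\<dots> = (\<integral>\<^sup>+ x. ennreal ((Re (f x) - g1 x)\<^sup>2) + ennreal ((Im (f x) - g2 x)\<^sup>2) \<partial>sphereM)"
    by (intro nn_integral_cong) (simp add: cmod_power2 g_def flip: ennreal_plus)
  also have "\<dots> = (\<integral>\<^sup>+ x. ennreal ((Re (f x) - g1 x)\<^sup>2) \<partial>sphereM) + (\<integral>\<^sup>+ x. ennreal ((Im (f x) - g2 x)\<^sup>2) \<partial>sphereM)"
    by (rule nn_integral_add) measurable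
  also have "\<dots> < ennreal (e/2) + ennreal (e/2)" by (intro add_strict_mono g1(2) g2(2))
  also have "\<dots> = ennreal e" using e by (simp flip: ennreal_plus)
  finally have lt: "(\<integral>\<^sup>+ p. ennreal ((norm (F p))\<^sup>2) \<partial>S2_measure) < ennreal e" .
  have "(LINT p|S2_measure. (norm (F p))\<^sup>2) = enn2real (\<integral>\<^sup>+ p. ennreal ((norm (F p))\<^sup>2) \<partial>S2_measure)"
    by (rule integral_eq_nn_integral) auto
  also have "\<dots> < e"
  proof -
    let ?x = "\<integral>\<^sup>+ p. ennreal ((norm (F p))\<^sup>2) \<partial>S2_measure"
    have "?x < top" using lt by (rule order_less_trans) simp
    then have "ennreal (enn2real ?x) = ?x" by (rule ennreal_enn2real)
    then have "ennreal (enn2real ?x) < ennreal e" using lt by (simp only:)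
    then show ?thesis by (subst (asm) ennreal_less_iff) simp_all
  qed
  finally show thesis unfolding F_def by (rule that)
qed

abbreviation (input) S2_coeff :: "(real^3 \<Rightarrow> complex) \<Rightarrow> nat \<Rightarrow> int \<Rightarrow> complex" where
  "S2_coeff f n k \<equiv> LINT q|S2_measure. f (sph (fst q) (snd q)) * cnj (sph_harm n k (fst q) (snd q))"

text \<open>Density gives some finite harmonic sum within e, and every later partial Fourier sum is
  at least as good by best approximation.\<close>

lemma harmonic_expansion:
  fixes f :: "real^3 \<Rightarrow> complex"
  assumes f: "f \<in> borel_measurable borel"
    and f2: "integrable S2_measure (\<lambda>p. (norm (f (sph (fst p) (snd p))))\<^sup>2)"
  shows "(\<lambda>N. LINT p|S2_measure. (norm (f (sph (fst p) (snd p)) - (\<Sum>n<N. \<Sum>k=-int n..int n.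
      S2_coeff f n k * sph_harm n k (fst p) (snd p))))\<^sup>2) \<longlonglongrightarrow> 0"
proof -
  note [measurable] = f
  define h where "h p = f (sph (fst p) (snd p))" for p
  have [measurable]: "h \<in> borel_measurable S2_measure" unfolding h_def by measurable
  define E where "E i p = sph_harm (fst i) (snd i) (fst p) (snd p)" for i p
  define I where "I N = Sigma {..<N} (\<lambda>n. {-int n..int n})" for N :: nat
  define a where "a i = (LINT q|S2_measure. h q * cnj (E i q))" for i
  have sumI: "(\<Sum>n<N. \<Sum>k=-int n..int n. b (n, k) * sph_harm n k (fst p) (snd p)) = (\<Sum>i\<in>I N. b i * E i p)" for N b p
    unfolding I_def E_def by (subst sum.Sigma) (auto simp: case_prod_unfold)
  define err where "err N = (LINT p|S2_measure. (norm (h p - (\<Sum>i\<in>I N. a i * E i p)))\<^sup>2)" for N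
  have fs: "integrable sphereM (\<lambda>x. (norm (f x))\<^sup>2)"
    unfolding sphereM_def by (subst integrable_distr_eq) (use f2 in auto)
  have best: "err N \<le> (LINT p|S2_measure. (norm (h p - (\<Sum>i\<in>I N. c i * E i p)))\<^sup>2)" for N c
    unfolding err_def a_def
  proof (rule best_approximation(1)[OF S2.finite_measure_axioms])
    show "E i \<in> borel_measurable S2_measure" if "i \<in> I N" for i
      unfolding E_def[abs_def] using that by (intro measurable_sph_harm) (auto simp: I_def)
    show "\<exists>B. \<forall>x. norm (E i x) \<le> B" if "i \<in> I N" for i
      using that sph_harm_bounded[of "snd i" "fst i"] unfolding E_def I_def by fastforce
    show "(LINT x|S2_measure. E i x * cnj (E j x)) = (if i = j then 1 else 0)" if "i \<in> I N" "j \<in> I N" for i j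
      using that sph_harm_orthonormal[of "snd i" "fst i" "snd j" "fst j"] unfolding E_def I_def
      by (auto simp: prod_eq_iff)
  qed (use f2 in \<open>auto simp: I_def h_def\<close>)
  have "err \<longlonglongrightarrow> 0"
  proof (rule LIMSEQ_I)
    fix e :: real assume "e > 0"
    then obtain N c where Nc: "(LINT p|S2_measure. (norm (h p - harm_sum N c (fst p) (snd p)))\<^sup>2) < e"
      unfolding h_def by (rule harmonic_sums_dense[OF f fs])
    have "norm (err M - 0) < e" if "M \<ge> N" for M
    proof -
      \<comment> \<open>Padding with zeros makes the competitor a sum up to the larger bound M,
        where optimality applies.\<close>
      define c' where "c' i = (if fst i < N then c (fst i) (snd i) else 0)" for i
      have "harm_sum N c (fst p) (snd p) = (\<Sum>n<M. \<Sum>k=-int n..int n. c' (n, k) * sph_harm n k (fst p) (snd p))" for p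
        using that by (intro sum.mono_neutral_cong_left) (auto simp: c'_def)
      then have "err M < e"
        using best[of M c'] Nc by (simp add: sumI)
      moreover have "err M \<ge> 0" unfolding err_def by simp
      ultimately show ?thesis by simp
    qed
    then show "\<exists>no. \<forall>n\<ge>no. norm (err n - 0) < e" by blast
  qed
  moreover have "err = (\<lambda>N. LINT p|S2_measure. (norm (f (sph (fst p) (snd p)) - (\<Sum>n<N. \<Sum>k=-int n..int n.
      S2_coeff f n k * sph_harm n k (fst p) (snd p))))\<^sup>2)"
    unfolding err_def sumI[symmetric] by (simp add: a_def h_def E_def)
  ultimately show ?thesis by simp
qed

section \<open>The inversion formula\<close>

lemma sph_coeff_eq_S2:
  assumes [measurable]: "f \<in> borel_measurable borel" and k: "\<bar>k\<bar> \<le> int n"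
  shows "(LINT x|sphereM. f x * cnj (solid_harm n k x)) = S2_coeff f n k"
proof -
  note [measurable] = measurable_sph_harm[OF k]
  have "(LINT x|sphereM. f x * cnj (solid_harm n k x)) = (LINT q|S2_measure. f (sph (fst q) (snd q)) * cnj (solid_harm n k (sph (fst q) (snd q))))"
    unfolding sphereM_def by (subst integral_distr) measurable
  also have "\<dots> = S2_coeff f n k"
  proof (rule integral_cong_AE)
    show "AE q in S2_measure. f (sph (fst q) (snd q)) * cnj (solid_harm n k (sph (fst q) (snd q))) = f (sph (fst q) (snd q)) * cnj (sph_harm n k (fst q) (snd q))"
      using AE_S2_measure by eventually_elim (use k in \<open>simp add: sph_harm_eq_solid_harm\<close>)
  qed measurable
  finally show ?thesis .
qed

text \<open>One summand suffices: s_0 = 2 \<psi> and s_1 = 2 sin \<psi> are nonzero on (0, \<pi>),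
  whereas s_j may vanish for larger j.\<close>

lemma singular_value_pos:
  assumes "0 < \<psi>" "\<psi> < pi"
  shows "(\<Sum>j=-int n..int n. (norm_legendre n j 0)\<^sup>2 * (s_coef \<psi> j)\<^sup>2) > 0"
proof -
  obtain j where j: "\<bar>j\<bar> \<le> int n" "j = 0 \<or> j = 1" "norm_legendre n j 0 \<noteq> 0"
    using norm_legendre_zero_nonzero by blast
  have "s_coef \<psi> j \<noteq> 0"
    using j(2) assms sin_gt_zero[of \<psi>] by (auto simp: s_coef_def)
  then show ?thesis
    using j by (intro sum_pos2[of _ j]) auto
qed

theorem theorem6:
  fixes \<psi> :: real and f :: "real^3 \<Rightarrow> complex"
  assumes "0 < \<psi>" and "\<psi> < pi"
    and "f \<in> borel_measurable borel"
    and "integrable S2_measure (\<lambda>p. (cmod (f (sph (fst p) (snd p))))\<^sup>2)"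
  shows "(\<lambda>N. LINT p|S2_measure.
            (cmod (f (sph (fst p) (snd p))
               - (\<Sum>n<N. \<Sum>k=-int n..int n.
                   ((\<Sum>j=-int n..int n.
                        complex_of_real (norm_legendre n j 0 * s_coef \<psi> j)
                        * wigner_coeff (arc_transform \<psi> f) n j k)
                    / complex_of_real (\<Sum>j=-int n..int n. (norm_legendre n j 0)\<^sup>2 * (s_coef \<psi> j)\<^sup>2))
                   * sph_harm n k (fst p) (snd p))))\<^sup>2)
         \<longlonglongrightarrow> 0"
proof -
  let ?D = "\<lambda>n. \<Sum>j=-int n..int n. (norm_legendre n j 0)\<^sup>2 * (s_coef \<psi> j)\<^sup>2"
  let ?N = "\<lambda>n k. \<Sum>j=-int n..int n. complex_of_real (norm_legendre n j 0 * s_coef \<psi> j) * wigner_coeff (arc_transform \<psi> f) n j k"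
  note [measurable] = assms(3)
  have "integrable S2_measure (\<lambda>p. f (sph (fst p) (snd p)))"
    by (rule integrable_norm_square_imp[OF S2.finite_measure_axioms _ assms(4)]) measurable
  then have fi: "integrable sphereM f"
    unfolding sphereM_def by (subst integrable_distr_eq) auto
  have coeff: "?N n k
      / complex_of_real (?D n)
    = S2_coeff f n k"
    if "k \<in> {-int n..int n}" for n k
  proof -
    have k: "\<bar>k\<bar> \<le> int n" using that by auto
    define C where "C = S2_coeff f n k"
    have C: "sph_coeff f n k = C"
      unfolding C_def sph_coeff_def[OF fi k] by (rule sph_coeff_eq_S2[OF assms(3) k])
    have "?N n k
      = (\<Sum>j=-int n..int n. of_real ((norm_legendre n j 0)\<^sup>2 * (s_coef \<psi> j)\<^sup>2) * C)"
    proof (intro sum.cong refl)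
      fix j assume "j \<in> {-int n..int n}"
      then have j: "\<bar>j\<bar> \<le> int n" by auto
      have "complex_of_real (norm_legendre n j 0 * s_coef \<psi> j) * wigner_coeff (arc_transform \<psi> f) n j k
        = of_real (s_coef \<psi> j) * (of_real (norm_legendre n j 0) * wigner_coeff (arc_transform \<psi> f) n j k)"
        by (simp add: mult_ac)
      also have "\<dots> = of_real ((norm_legendre n j 0)\<^sup>2 * (s_coef \<psi> j)\<^sup>2) * C"
        unfolding wigner_coeff_arc_transform[OF fi k j assms(1)] C by (simp add: power2_eq_square mult_ac)
      finally show "complex_of_real (norm_legendre n j 0 * s_coef \<psi> j) * wigner_coeff (arc_transform \<psi> f) n j k
        = of_real ((norm_legendre n j 0)\<^sup>2 * (s_coef \<psi> j)\<^sup>2) * C" .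
    qed
    also have "\<dots> = of_real (?D n) * C"
      by (simp only: sum_distrib_right of_real_sum)
    finally have num: "?N n k
      = of_real (?D n) * C" .
    have "complex_of_real (?D n) \<noteq> 0"
      using singular_value_pos[OF assms(1,2), of n] by (simp only: of_real_eq_0_iff)
    then show ?thesis
      unfolding num C_def[symmetric] by (rule nonzero_mult_div_cancel_left)
  qed
  show ?thesis
    using harmonic_expansion[OF assms(3,4)] by (simp only: coeff cong: sum.cong)
qed

end
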